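(* Let $\Gamma$ be a non-elementary discrete group acting properly by isometries on hyperbolic space $\mathbb{H}^{d}$ with basepoint $x_0\in\mathbb{H}^d$, and let $\epsilon>0$. Then there exist $K>0$ and a free subsemigroup $F \subseteq \Gamma$ such that the following properties hold. (1) (Divergence) The Poincaré series $\mathcal{P}_{F}(s) := \sum_{g \in F} e^{-s\, d(x_0, gx_0)}$ diverges at $s=\delta_F$, the critical exponent of $F$. (2) (Approximation) $\delta_{F} \ge \delta_{\Gamma} -\epsilon$. (3) (Myrberg property) For any $g \in \Gamma$, there exists $f \in F$ such that the $K$-neighborhood of the geodesic $[x_0, fx_0]$ contains a $\Gamma$-translate of the geodesic $[x_0, gx_0]$.
   Context: $\mathbb{H}^d$ is real hyperbolic space with metric $d$ and $[x,y]$ denotes the geodesic segment from $x$ to $y$. The limit set $\Lambda\Gamma$ is the set of accumulation points of $\Gamma x_0$ in $\mathbb{H}^d\cup\partial\mathbb{H}^d$; $\Gamma$ is non-elementary if $\#\Lambda\Gamma>2$. For a set $A$ of isometries of $\mathbb{H}^d$, $\mathcal{P}_A(s)=\sum_{g\in A}e^{-s\,d(x_0,gx_0)}$ for $s\ge 0$, and the critical exponent $\delta_A$ is the abscissa of convergence of $\mathcal{P}_A$, equivalently $\delta_A=\limsup_{R\to+\infty}\frac1R\log\#\{g\in A: d(x_0,gx_0)<R\}$. *)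

theory Defs
  imports "HOL-Analysis.Analysis" "HOL-Algebra.Group_Action"
begin

text \<open>
  Hyperbolic space of dimension \<open>CARD('n)\<close> in the Poincare ball model (curvature \<open>-1\<close>): the points
  are the open unit ball of \<open>real ^ 'n\<close> and the boundary at infinity is the unit sphere. In this
  model the metric topology of hyperbolic space is the Euclidean one, and the compactification by
  the boundary at infinity is the closed unit ball with its Euclidean topology. Hence \<open>compact\<close>
  and \<open>islimpt\<close> below are used with respect to the topology of \<open>real ^ 'n\<close>.
\<close>

definition hyp_space :: "(real ^ 'n) set" where
  "hyp_space = ball 0 1"

definition hyp_boundary :: "(real ^ 'n) set" where
  "hyp_boundary = sphere 0 1"

definition hyp_dist :: "real ^ 'n \<Rightarrow> real ^ 'n \<Rightarrow> real" where
  "hyp_dist x y =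
     arcosh (1 + 2 * (norm (x - y))\<^sup>2 / ((1 - (norm x)\<^sup>2) * (1 - (norm y)\<^sup>2)))"

definition geodesic_from_to :: "(real \<Rightarrow> real ^ 'n) \<Rightarrow> real ^ 'n \<Rightarrow> real ^ 'n \<Rightarrow> bool" where
  "geodesic_from_to c x y \<longleftrightarrow>
     c ` {0..hyp_dist x y} \<subseteq> hyp_space \<and>
     c 0 = x \<and> c (hyp_dist x y) = y \<and>
     (\<forall>s\<in>{0..hyp_dist x y}. \<forall>t\<in>{0..hyp_dist x y}. hyp_dist (c s) (c t) = \<bar>s - t\<bar>)"

text \<open>
  Geodesics between two points of hyperbolic space exist and are unique, so the following union
  consists of exactly one arc.
\<close>

definition geodesic_segment :: "real ^ 'n \<Rightarrow> real ^ 'n \<Rightarrow> (real ^ 'n) set" where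
  "geodesic_segment x y = (\<Union>c\<in>{c. geodesic_from_to c x y}. c ` {0..hyp_dist x y})"

definition hyp_neighborhood :: "real \<Rightarrow> (real ^ 'n) set \<Rightarrow> (real ^ 'n) set" where
  "hyp_neighborhood K S = {z \<in> hyp_space. \<exists>w\<in>S. hyp_dist z w < K}"

definition acts_by_isometries ::
    "('g, 'b) monoid_scheme \<Rightarrow> ('g \<Rightarrow> real ^ 'n \<Rightarrow> real ^ 'n) \<Rightarrow> bool" where
  "acts_by_isometries G \<phi> \<longleftrightarrow>
     group_action G hyp_space \<phi> \<and>
     (\<forall>g\<in>carrier G. \<forall>x\<in>hyp_space. \<forall>y\<in>hyp_space.
        hyp_dist (\<phi> g x) (\<phi> g y) = hyp_dist x y)"

text \<open>
  The group carries the discrete topology, so its compact subsets are the finite ones.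
\<close>

definition acts_properly ::
    "('g, 'b) monoid_scheme \<Rightarrow> ('g \<Rightarrow> real ^ 'n \<Rightarrow> real ^ 'n) \<Rightarrow> bool" where
  "acts_properly G \<phi> \<longleftrightarrow>
     (\<forall>C. compact C \<and> C \<subseteq> hyp_space \<longrightarrow> finite {g \<in> carrier G. \<phi> g ` C \<inter> C \<noteq> {}})"

definition limit_set ::
    "('g, 'b) monoid_scheme \<Rightarrow> ('g \<Rightarrow> real ^ 'n \<Rightarrow> real ^ 'n) \<Rightarrow> real ^ 'n \<Rightarrow> (real ^ 'n) set" where
  "limit_set G \<phi> x0 =
     {\<xi> \<in> hyp_space \<union> hyp_boundary. \<xi> islimpt ((\<lambda>g. \<phi> g x0) ` carrier G)}"

definition non_elementary ::
    "('g, 'b) monoid_scheme \<Rightarrow> ('g \<Rightarrow> real ^ 'n \<Rightarrow> real ^ 'n) \<Rightarrow> real ^ 'n \<Rightarrow> bool" where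
  "non_elementary G \<phi> x0 \<longleftrightarrow> infinite (limit_set G \<phi> x0) \<or> card (limit_set G \<phi> x0) > 2"

definition poincare_series ::
    "('g \<Rightarrow> real ^ 'n \<Rightarrow> real ^ 'n) \<Rightarrow> real ^ 'n \<Rightarrow> 'g set \<Rightarrow> real \<Rightarrow> ennreal" where
  "poincare_series \<phi> x0 A s = (\<Sum>\<^sub>\<infinity>g\<in>A. ennreal (exp (- s * hyp_dist x0 (\<phi> g x0))))"

text \<open>
  The abscissa of convergence, taken over \<open>s \<ge> 0\<close>; it is \<open>\<infinity>\<close> if the series never converges.
\<close>

definition critical_exponent ::
    "('g \<Rightarrow> real ^ 'n \<Rightarrow> real ^ 'n) \<Rightarrow> real ^ 'n \<Rightarrow> 'g set \<Rightarrow> ereal" where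
  "critical_exponent \<phi> x0 A = Inf (ereal ` {s. 0 \<le> s \<and> poincare_series \<phi> x0 A s < \<infinity>})"

text \<open>
  \<open>F\<close> is the subsemigroup generated by some set \<open>S\<close>, finite or infinite, and every element of \<open>F\<close>
  is the product of a unique nonempty word over \<open>S\<close>.
\<close>

definition free_subsemigroup :: "('g, 'b) monoid_scheme \<Rightarrow> 'g set \<Rightarrow> bool" where
  "free_subsemigroup G F \<longleftrightarrow>
     (\<exists>S \<subseteq> carrier G. bij_betw (\<lambda>w. foldr (mult G) w (one G)) (lists S - {[]}) F)"

end

theory Submission
  imports Defs
begin

text \<open>
  All estimates concern the length function \<open>len g = d(x0, g x0)\<close>, which satisfies Gromov's
  four-point condition: Ptolemy's inequality for the Euclidean distance gives the same inequality for
  \<open>sinh (d / 2)\<close>. Properness and three limit points produce two elements \<open>v1\<close>, \<open>v2\<close>, very long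
  compared with all Gromov products among \<open>v1\<close>, \<open>v2\<close> and their inverses. For every long \<open>g\<close> there are
  \<open>a, b \<in> {v1, v2}\<close> such that words in \<open>v1\<close>, \<open>v2\<close> and \<open>a g b\<close> have no backtracking, so that lengths
  are additive up to a constant. The generators of the semigroup are \<open>v2 a g b\<close>, where \<open>g\<close> runs through a
  separated subset of one large annulus (this gives the exponent), and \<open>v1\<^sup>i v2 a g b\<close> with a different
  \<open>i > 0\<close> for every long \<open>g\<close> (this gives the Myrberg property, while the powers of \<open>v1\<close> keep the sum over
  the generators finite at every positive exponent). If the Poincare series of the
  semigroup converged at an exponent, then the sum over words of some length \<open>n\<close> would be
  small there, hence by convexity also at a smaller exponent, and the almost additivity of the length
  would give convergence at that smaller exponent.
\<close>

section \<open>The Poincare ball\<close>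

text \<open>The difficulty is to have divergence and the Myrberg property together. Giving every
  long \<open>g\<close> its own generator makes the generating set infinite, and an infinitely
  generated semigroup may well converge at its critical exponent. This is excluded because the
  generating set alone has exponent 0: words of a fixed number of letters then have a finite sum at
  every positive exponent, and this lets smallness at one exponent be carried to a smaller one. The
  block \<open>v1\<^sup>i v2\<close> serves two purposes: its length grows at least like
  \<open>i\<close>, and it is a prefix code, so only generators with \<open>i = 0\<close> must be
  told apart by the separation of their middle letters. The pair \<open>v1\<close>,
  \<open>v2\<close> consists of a high power of a loxodromic element and a conjugate of that power;
  the Gromov products stay bounded as the power grows, so the constant is fixed before the lengths.
  If the target exponent is not positive, no annulus is required, since critical exponents are
  infima over \<open>s \<ge> 0\<close>.\<close>

lemma norm_inversion_diff:
  fixes a b :: "'a::real_inner"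
  assumes "a \<noteq> 0" "b \<noteq> 0"
  shows "norm (a /\<^sub>R (norm a)\<^sup>2 - b /\<^sub>R (norm b)\<^sup>2) = norm (a - b) / (norm a * norm b)"
proof -
  have "(norm (a /\<^sub>R (norm a)\<^sup>2 - b /\<^sub>R (norm b)\<^sup>2))\<^sup>2 = (norm (a - b) / (norm a * norm b))\<^sup>2"
  proof -
    define p where "p = (norm a)\<^sup>2"
    define q where "q = (norm b)\<^sup>2"
    have pq: "p \<noteq> 0" "q \<noteq> 0" "a \<bullet> a = p" "b \<bullet> b = q"
      using assms by (auto simp: p_def q_def power2_norm_eq_inner)
    have "(norm (a /\<^sub>R p - b /\<^sub>R q))\<^sup>2 = 1 / p - 2 * (a \<bullet> b) / (p * q) + 1 / q"
      using pq unfolding power2_norm_eq_inner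
      by (simp add: inner_diff_left inner_diff_right inner_commute[of b a] field_simps)
    also have "\<dots> = (p + q - 2 * (a \<bullet> b)) / (p * q)" using pq by (simp add: field_simps)
    also have "p + q - 2 * (a \<bullet> b) = (norm (a - b))\<^sup>2"
      using pq by (simp add: power2_norm_eq_inner inner_diff inner_commute)
    finally show ?thesis by (simp add: power_divide power_mult_distrib p_def q_def)
  qed
  then show ?thesis by (simp add: power2_eq_iff_nonneg)
qed

text \<open>Inversion in the unit sphere divides the distance of \<open>a\<close> and
  \<open>b\<close> by \<open>norm a * norm b\<close>, so this is the triangle inequality for the
  inverted points. The fourth point of Ptolemy's inequality is 0.\<close>

lemma ptolemy_0:
  fixes a b c :: "'a::real_inner"
  shows "norm (a - b) * norm c \<le> norm (a - c) * norm b + norm a * norm (b - c)"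
proof (cases "a = 0 \<or> b = 0 \<or> c = 0")
  case True
  then show ?thesis by (auto simp: mult.commute)
next
  case False
  let ?i = "\<lambda>x::'a. x /\<^sub>R (norm x)\<^sup>2"
  have pos: "0 < norm a" "0 < norm b" "0 < norm c" using False by auto
  have "norm (?i a - ?i b) \<le> norm (?i a - ?i c) + norm (?i c - ?i b)"
    using norm_triangle_ineq[of "?i a - ?i c" "?i c - ?i b"] by simp
  then have "norm (a - b) / (norm a * norm b)
      \<le> norm (a - c) / (norm a * norm c) + norm (c - b) / (norm c * norm b)"
    using False by (simp add: norm_inversion_diff)
  then have "norm (a - b) / (norm a * norm b) * (norm a * norm b * norm c)
      \<le> (norm (a - c) / (norm a * norm c) + norm (c - b) / (norm c * norm b)) * (norm a * norm b * norm c)"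
    by (rule mult_right_mono) simp
  moreover have "norm (a - b) / (norm a * norm b) * (norm a * norm b * norm c) = norm (a - b) * norm c"
    using pos by simp
  moreover have "(norm (a - c) / (norm a * norm c) + norm (c - b) / (norm c * norm b)) * (norm a * norm b * norm c)
      = norm (a - c) * norm b + norm a * norm (c - b)"
    using pos by (simp add: field_simps)
  ultimately show ?thesis by (simp add: norm_minus_commute)
qed

lemma ptolemy:
  fixes x y z w :: "'a::real_inner"
  shows "norm (x - y) * norm (z - w) \<le> norm (x - z) * norm (y - w) + norm (x - w) * norm (y - z)"
  using ptolemy_0[of "x - w" "y - w" "z - w"] by simp

section \<open>Half-distance formulas, triangle inequality and four-point condition\<close>

lemma hyp_space_iff: "x \<in> hyp_space \<longleftrightarrow> (norm x)\<^sup>2 < 1"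
  by (simp add: hyp_space_def power_less_one_iff abs_square_less_1)

lemma hyp_dist_arg_ge:
  assumes "x \<in> hyp_space" "y \<in> hyp_space"
  shows "1 \<le> 1 + 2 * (norm (x - y))\<^sup>2 / ((1 - (norm x)\<^sup>2) * (1 - (norm y)\<^sup>2))"
  using assms by (simp add: hyp_space_iff)

lemma cosh_hyp_dist:
  assumes "x \<in> hyp_space" "y \<in> hyp_space"
  shows "cosh (hyp_dist x y) = 1 + 2 * (norm (x - y))\<^sup>2 / ((1 - (norm x)\<^sup>2) * (1 - (norm y)\<^sup>2))"
  using cosh_arcosh_real[OF hyp_dist_arg_ge[OF assms]] by (simp add: hyp_dist_def)

lemma hyp_dist_nonneg:
  assumes "x \<in> hyp_space" "y \<in> hyp_space"
  shows "0 \<le> hyp_dist x y"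
  using arcosh_nonneg_real[OF hyp_dist_arg_ge[OF assms]] by (simp add: hyp_dist_def)

lemma hyp_dist_commute: "hyp_dist x y = hyp_dist y x"
  by (simp add: hyp_dist_def norm_minus_commute mult.commute)

lemma hyp_dist_self [simp]: "hyp_dist x x = 0"
  by (simp add: hyp_dist_def)

lemma sinh_half_hyp_dist:
  assumes "x \<in> hyp_space" "y \<in> hyp_space"
  shows "sinh (hyp_dist x y / 2) = norm (x - y) / (sqrt (1 - (norm x)\<^sup>2) * sqrt (1 - (norm y)\<^sup>2))"
proof -
  have "(sinh (hyp_dist x y / 2))\<^sup>2 = (norm (x - y))\<^sup>2 / ((1 - (norm x)\<^sup>2) * (1 - (norm y)\<^sup>2))"
    using cosh_hyp_dist[OF assms] cosh_double[of "hyp_dist x y / 2"] cosh_square_eq[of "hyp_dist x y / 2"]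
    by simp
  also have "\<dots> = (norm (x - y) / (sqrt (1 - (norm x)\<^sup>2) * sqrt (1 - (norm y)\<^sup>2)))\<^sup>2"
    using assms by (simp add: power_divide power_mult_distrib hyp_space_iff less_imp_le)
  finally show ?thesis
    by (rule power2_eq_imp_eq) (use assms hyp_dist_nonneg[OF assms] in \<open>auto simp: hyp_space_iff less_imp_le\<close>)
qed

lemma cosh_half_hyp_dist:
  assumes "x \<in> hyp_space" "y \<in> hyp_space"
  shows "cosh (hyp_dist x y / 2)
    = sqrt ((norm (x - y))\<^sup>2 + (1 - (norm x)\<^sup>2) * (1 - (norm y)\<^sup>2)) / (sqrt (1 - (norm x)\<^sup>2) * sqrt (1 - (norm y)\<^sup>2))"
proof -
  have p: "0 < 1 - (norm x)\<^sup>2" "0 < 1 - (norm y)\<^sup>2" using assms by (simp_all add: hyp_space_iff)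
  have "(cosh (hyp_dist x y / 2))\<^sup>2 = 1 + (norm (x - y))\<^sup>2 / ((1 - (norm x)\<^sup>2) * (1 - (norm y)\<^sup>2))"
    using sinh_half_hyp_dist[OF assms] p by (simp add: cosh_square_eq power_divide power_mult_distrib)
  also have "\<dots> = ((norm (x - y))\<^sup>2 + (1 - (norm x)\<^sup>2) * (1 - (norm y)\<^sup>2)) / ((1 - (norm x)\<^sup>2) * (1 - (norm y)\<^sup>2))"
    using p by (simp add: add_divide_distrib)
  also have "\<dots> = (sqrt ((norm (x - y))\<^sup>2 + (1 - (norm x)\<^sup>2) * (1 - (norm y)\<^sup>2)) / (sqrt (1 - (norm x)\<^sup>2) * sqrt (1 - (norm y)\<^sup>2)))\<^sup>2"
    using p by (simp add: power_divide power_mult_distrib)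
  finally show ?thesis
    by (rule power2_eq_imp_eq) (use p in auto)
qed

text \<open>Ptolemy's inequality for \<open>x\<close>, \<open>y\<close>, \<open>z\<close> and the
  mirror image \<open>i\<close> of \<open>y\<close> in the unit sphere. Divided by the conformal
  factors it bounds \<open>sinh\<close> of half the distance from \<open>x\<close> to
  \<open>z\<close> by the addition formula for \<open>sinh\<close>, that is, it is the hyperbolic
  triangle inequality.\<close>

lemma bracket_triangle:
  fixes x y z :: "'a::real_inner"
  assumes "(norm y)\<^sup>2 < 1"
  shows "norm (x - z) * (1 - (norm y)\<^sup>2)
    \<le> norm (x - y) * sqrt ((norm (y - z))\<^sup>2 + (1 - (norm y)\<^sup>2) * (1 - (norm z)\<^sup>2))
      + sqrt ((norm (x - y))\<^sup>2 + (1 - (norm x)\<^sup>2) * (1 - (norm y)\<^sup>2)) * norm (y - z)"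
proof (cases "y = 0")
  case True
  then show ?thesis using norm_triangle_ineq4[of x z] by simp
next
  case False
  define i where "i = y /\<^sub>R (norm y)\<^sup>2"
  have y: "0 < norm y" "y \<bullet> y \<noteq> 0" using False by auto
  have *: "sqrt ((norm (u - y))\<^sup>2 + (1 - (norm u)\<^sup>2) * (1 - (norm y)\<^sup>2)) = norm y * norm (u - i)" for u
  proof (rule real_sqrt_unique)
    show "(norm y * norm (u - i))\<^sup>2 = (norm (u - y))\<^sup>2 + (1 - (norm u)\<^sup>2) * (1 - (norm y)\<^sup>2)"
      using y unfolding i_def power_mult_distrib power2_norm_eq_inner
      by (simp add: inner_diff inner_commute field_simps power2_eq_square)
  qed simp
  have yi: "norm y * norm (y - i) = 1 - (norm y)\<^sup>2"
  proof -
    have "y - i = (1 - 1 / (norm y)\<^sup>2) *\<^sub>R y" by (simp add: i_def algebra_simps divide_inverse)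
    then have "norm y * norm (y - i) = \<bar>1 - 1 / (norm y)\<^sup>2\<bar> * (norm y)\<^sup>2" by (simp add: power2_eq_square)
    also have "\<bar>1 - 1 / (norm y)\<^sup>2\<bar> = 1 / (norm y)\<^sup>2 - 1" using assms y by (simp add: field_simps)
    finally show ?thesis using y by (simp add: field_simps)
  qed
  have "norm (x - z) * (1 - (norm y)\<^sup>2) = norm (x - z) * norm (y - i) * norm y"
    unfolding yi[symmetric] by simp
  also have "\<dots> \<le> (norm (x - y) * norm (z - i) + norm (x - i) * norm (z - y)) * norm y"
    by (intro mult_right_mono ptolemy) auto
  also have "\<dots> = norm (x - y) * (norm y * norm (z - i)) + (norm y * norm (x - i)) * norm (y - z)"
    by (simp add: norm_minus_commute[of y z] algebra_simps)
  finally show ?thesis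
    unfolding *[symmetric] by (simp add: norm_minus_commute[of y z] mult.commute[of "1 - (norm z)\<^sup>2"])
qed

lemma hyp_dist_triangle:
  assumes "x \<in> hyp_space" "y \<in> hyp_space" "z \<in> hyp_space"
  shows "hyp_dist x z \<le> hyp_dist x y + hyp_dist y z"
proof -
  define a where "a = sqrt (1 - (norm x)\<^sup>2)"
  define b where "b = sqrt (1 - (norm y)\<^sup>2)"
  define c where "c = sqrt (1 - (norm z)\<^sup>2)"
  have p: "0 < a" "0 < b" "0 < c" "b * b = 1 - (norm y)\<^sup>2"
    using assms by (simp_all add: a_def b_def c_def hyp_space_iff less_imp_le)
  define Cyz where "Cyz = sqrt ((norm (y - z))\<^sup>2 + (1 - (norm y)\<^sup>2) * (1 - (norm z)\<^sup>2))"
  define Cxy where "Cxy = sqrt ((norm (x - y))\<^sup>2 + (1 - (norm x)\<^sup>2) * (1 - (norm y)\<^sup>2))"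
  have le: "norm (x - z) * (b * b) \<le> norm (x - y) * Cyz + Cxy * norm (y - z)"
    using bracket_triangle[of y x z] assms(2) p by (simp add: Cyz_def Cxy_def hyp_space_iff)
  have "sinh (hyp_dist x z / 2) = norm (x - z) * (b * b) / (a * b * b * c)"
    using sinh_half_hyp_dist[of x z] assms p(1-3) by (simp add: a_def c_def)
  also have "\<dots> \<le> (norm (x - y) * Cyz + Cxy * norm (y - z)) / (a * b * b * c)"
    using le p(1-3) by (intro divide_right_mono) auto
  also have "\<dots> = norm (x - y) / (a * b) * (Cyz / (b * c)) + Cxy / (a * b) * (norm (y - z) / (b * c))"
    using p(1-3) by (simp add: field_simps)
  also have "\<dots> = sinh (hyp_dist x y / 2 + hyp_dist y z / 2)"
    using sinh_half_hyp_dist[of x y] sinh_half_hyp_dist[of y z] cosh_half_hyp_dist[of x y]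
      cosh_half_hyp_dist[of y z] assms
    by (simp add: sinh_add a_def b_def c_def Cyz_def Cxy_def)
  finally show ?thesis by simp
qed

lemma sinh_half_bounds:
  fixes t :: real
  shows "sinh (t / 2) \<le> exp (t / 2) / 2" "1 \<le> t \<Longrightarrow> exp (t / 2) / 4 \<le> sinh (t / 2)"
proof -
  show "sinh (t / 2) \<le> exp (t / 2) / 2" by (simp add: sinh_field_def)
  assume "1 \<le> t"
  have "2 \<le> exp t" using exp_ge_add_one_self[of t] \<open>1 \<le> t\<close> by linarith
  then have "2 \<le> exp (t / 2) * exp (t / 2)" by (simp add: exp_add[symmetric])
  then have "exp (- (t / 2)) \<le> exp (t / 2) / 2" by (simp add: exp_minus field_simps)
  then show "exp (t / 2) / 4 \<le> sinh (t / 2)" by (simp add: sinh_field_def)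
qed

text \<open>The 8 is made of a factor 16 from the two lower bounds \<open>exp (d / 2) / 4\<close>, a
  factor 1/4 from the upper bounds \<open>exp (d / 2) / 2\<close>, and 2 for replacing a sum by a
  maximum. The lower bound fails for distances below 1; there the triangle inequality suffices
  because \<open>1 \<le> ln 8\<close>.\<close>

lemma hyp_dist_four_point:
  fixes x y z w :: "real ^ 'n"
  assumes "x \<in> hyp_space" "y \<in> hyp_space" "z \<in> hyp_space" "w \<in> hyp_space"
  shows "hyp_dist x y + hyp_dist z w
    \<le> max (hyp_dist x z + hyp_dist y w) (hyp_dist x w + hyp_dist y z) + 2 * ln 8"
proof -
  have ln8: "1 \<le> ln (8::real)" using ln_ge_iff[of 8 1] exp_le by simp
  consider "hyp_dist x y < 1" | "hyp_dist z w < 1" | "1 \<le> hyp_dist x y" "1 \<le> hyp_dist z w" by linarith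
  then show ?thesis
  proof cases
    case 1
    have "hyp_dist z w \<le> hyp_dist z x + hyp_dist x y + hyp_dist y w"
      using hyp_dist_triangle[of z x w] hyp_dist_triangle[of x y w] assms by linarith
    then show ?thesis using 1 ln8 hyp_dist_commute[of z x] by simp
  next
    case 2
    have "hyp_dist x y \<le> hyp_dist x z + hyp_dist z w + hyp_dist w y"
      using hyp_dist_triangle[of x z y] hyp_dist_triangle[of z w y] assms by linarith
    then show ?thesis using 2 ln8 hyp_dist_commute[of w y] by simp
  next
    case 3
    define S where "S u v = sinh (hyp_dist u v / 2)" for u v :: "real^'n"
    define r where "r u = sqrt (1 - (norm u)\<^sup>2)" for u :: "real^'n"
    have r: "0 < r x" "0 < r y" "0 < r z" "0 < r w"
      using assms by (simp_all add: r_def hyp_space_iff)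
    have S: "S u v = norm (u - v) / (r u * r v)" if "u \<in> hyp_space" "v \<in> hyp_space" for u v
      using sinh_half_hyp_dist[OF that] by (simp add: S_def r_def)
    have "S x y * S z w = (norm (x - y) * norm (z - w)) / (r x * r y * r z * r w)"
      using assms by (simp add: S)
    also have "\<dots> \<le> (norm (x - z) * norm (y - w) + norm (x - w) * norm (y - z)) / (r x * r y * r z * r w)"
      using r by (intro divide_right_mono ptolemy) auto
    also have "\<dots> = S x z * S y w + S x w * S y z"
      using assms r by (simp add: S field_simps)
    finally have pt: "S x y * S z w \<le> S x z * S y w + S x w * S y z" .
    have up: "S u v * S u' v' \<le> exp ((hyp_dist u v + hyp_dist u' v') / 2) / 4"
      if "u \<in> hyp_space" "v \<in> hyp_space" "u' \<in> hyp_space" "v' \<in> hyp_space" for u v u' v'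
    proof -
      have "S u v * S u' v' \<le> (exp (hyp_dist u v / 2) / 2) * (exp (hyp_dist u' v' / 2) / 2)"
        using sinh_half_bounds(1) hyp_dist_nonneg that unfolding S_def by (intro mult_mono) auto
      then show ?thesis by (simp add: add_divide_distrib exp_add)
    qed
    have "exp ((hyp_dist x y + hyp_dist z w) / 2) / 16 = (exp (hyp_dist x y / 2) / 4) * (exp (hyp_dist z w / 2) / 4)"
      by (simp add: add_divide_distrib exp_add)
    also have "\<dots> \<le> S x y * S z w"
      using sinh_half_bounds(2) 3 hyp_dist_nonneg assms unfolding S_def by (intro mult_mono) auto
    also have "\<dots> \<le> S x z * S y w + S x w * S y z" by (rule pt)
    also have "\<dots> \<le> exp ((hyp_dist x z + hyp_dist y w) / 2) / 4 + exp ((hyp_dist x w + hyp_dist y z) / 2) / 4"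
      using up assms by (intro add_mono) auto
    also have "\<dots> \<le> 2 * (exp (max (hyp_dist x z + hyp_dist y w) (hyp_dist x w + hyp_dist y z) / 2) / 4)"
    proof -
      have "exp (a / 2) / 4 + exp (b / 2) / 4 \<le> 2 * (exp (max a b / 2) / 4)" for a b :: real
      proof -
        have "exp (a / 2) \<le> exp (max a b / 2)" "exp (b / 2) \<le> exp (max a b / 2)" by simp_all
        then show ?thesis by linarith
      qed
      then show ?thesis .
    qed
    finally have "exp ((hyp_dist x y + hyp_dist z w) / 2)
        \<le> exp (max (hyp_dist x z + hyp_dist y w) (hyp_dist x w + hyp_dist y z) / 2) * 8" by simp
    also have "\<dots> = exp (max (hyp_dist x z + hyp_dist y w) (hyp_dist x w + hyp_dist y z) / 2 + ln 8)"
      by (simp add: exp_add)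
    finally show ?thesis by simp
  qed
qed

section \<open>Comparison of Euclidean and hyperbolic distance\<close>

lemma inverse_conformal_le_exp:
  assumes "x \<in> hyp_space"
  shows "1 / (1 - (norm x)\<^sup>2) = (cosh (hyp_dist 0 x / 2))\<^sup>2" "1 / (1 - (norm x)\<^sup>2) \<le> exp (hyp_dist 0 x)"
proof -
  have 0: "0 \<in> hyp_space" by (simp add: hyp_space_iff)
  show 1: "1 / (1 - (norm x)\<^sup>2) = (cosh (hyp_dist 0 x / 2))\<^sup>2"
    using assms unfolding cosh_square_eq sinh_half_hyp_dist[OF 0 assms]
    by (simp add: power_divide hyp_space_iff field_simps)
  have "cosh (hyp_dist 0 x / 2) \<le> exp (hyp_dist 0 x / 2)"
    using hyp_dist_nonneg[OF 0 assms] by (simp add: cosh_field_def)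
  then have "(cosh (hyp_dist 0 x / 2))\<^sup>2 \<le> (exp (hyp_dist 0 x / 2))\<^sup>2"
    by (intro power_mono) auto
  then show "1 / (1 - (norm x)\<^sup>2) \<le> exp (hyp_dist 0 x)"
    unfolding 1 by (simp add: exp_double[symmetric])
qed

text \<open>\<open>sinh\<close> of half the distance is the Euclidean distance times the two factors
  \<open>cosh (hyp_dist 0 _ / 2)\<close>, so Euclidean separation leaves little room for
  cancellation. Distinct limit points thus yield bounded Gromov products.\<close>

lemma gromov_product_origin_le:
  assumes "x \<in> hyp_space" "y \<in> hyp_space" "0 < \<rho>" "\<rho> \<le> norm (x - y)"
  shows "hyp_dist 0 x + hyp_dist 0 y - hyp_dist x y \<le> 2 * ln (2 / \<rho>)"
proof -
  define a where "a = cosh (hyp_dist 0 x / 2)"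
  define b where "b = cosh (hyp_dist 0 y / 2)"
  have ab: "0 < a" "0 < b" by (simp_all add: a_def b_def)
  have "sqrt (1 - (norm x)\<^sup>2) = 1 / a" "sqrt (1 - (norm y)\<^sup>2) = 1 / b"
  proof -
    have "1 - (norm x)\<^sup>2 = 1 / a\<^sup>2" "1 - (norm y)\<^sup>2 = 1 / b\<^sup>2"
      using inverse_conformal_le_exp(1)[OF assms(1)] inverse_conformal_le_exp(1)[OF assms(2)]
      by (simp_all add: a_def b_def inverse_eq_divide[symmetric] inverse_eq_imp_eq)
    then show "sqrt (1 - (norm x)\<^sup>2) = 1 / a" "sqrt (1 - (norm y)\<^sup>2) = 1 / b"
      using ab by (simp_all add: real_sqrt_divide)
  qed
  then have s: "sinh (hyp_dist x y / 2) = norm (x - y) * a * b"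
    using sinh_half_hyp_dist[OF assms(1,2)] by simp
  have "exp (hyp_dist 0 x / 2) / 2 * (exp (hyp_dist 0 y / 2) / 2) \<le> a * b"
    using ab unfolding a_def b_def by (intro mult_mono) (auto simp: cosh_field_def)
  then have "\<rho> * (exp (hyp_dist 0 x / 2) * exp (hyp_dist 0 y / 2) / 4) \<le> norm (x - y) * (a * b)"
    using assms(3,4) ab by (intro mult_mono) auto
  also have "\<dots> \<le> exp (hyp_dist x y / 2) / 2"
    using s sinh_half_bounds(1)[of "hyp_dist x y"] by (simp add: mult.assoc)
  finally have "exp (hyp_dist 0 x / 2) * exp (hyp_dist 0 y / 2) \<le> 2 / \<rho> * exp (hyp_dist x y / 2)"
    using assms(3) by (simp add: field_simps)
  also have "\<dots> = exp (ln (2 / \<rho>) + hyp_dist x y / 2)" using assms(3) by (simp add: exp_add)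
  finally show ?thesis by (simp add: exp_add[symmetric])
qed

text \<open>Within distance \<open>R\<close> of the origin both conformal factors are at least
  \<open>exp (- R)\<close>, so \<open>sinh (hyp_dist x y / 2) \<le> 1\<close>, and
  \<open>1 \<le> sinh 1\<close>.\<close>

lemma hyp_dist_le_two:
  fixes x y :: "real ^ 'n"
  assumes "x \<in> hyp_space" "y \<in> hyp_space" "hyp_dist 0 x \<le> R" "hyp_dist 0 y \<le> R"
    and "norm (x - y) \<le> exp (- R)"
  shows "hyp_dist x y \<le> 2"
proof -
  have p: "0 < 1 - (norm x)\<^sup>2" "0 < 1 - (norm y)\<^sup>2" using assms by (simp_all add: hyp_space_iff)
  have "exp (- R) \<le> 1 - (norm u)\<^sup>2" if "u \<in> hyp_space" "hyp_dist 0 u \<le> R" for u :: "real^'n"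
  proof -
    have "1 / (1 - (norm u)\<^sup>2) \<le> exp R"
      using inverse_conformal_le_exp(2)[OF that(1)] that(2) by (meson exp_le_cancel_iff order_trans)
    moreover have "0 < 1 - (norm u)\<^sup>2" using that by (simp add: hyp_space_iff)
    ultimately show ?thesis by (simp add: exp_minus field_simps)
  qed
  then have "exp (- R) * exp (- R) \<le> (1 - (norm x)\<^sup>2) * (1 - (norm y)\<^sup>2)"
    using assms p by (intro mult_mono) (auto simp: less_imp_le)
  then have "exp (- R) \<le> sqrt ((1 - (norm x)\<^sup>2) * (1 - (norm y)\<^sup>2))"
    by (intro real_le_rsqrt) (simp add: power2_eq_square)
  then have "norm (x - y) \<le> sqrt (1 - (norm x)\<^sup>2) * sqrt (1 - (norm y)\<^sup>2)"
    using assms(5) by (simp add: real_sqrt_mult)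
  then have "sinh (hyp_dist x y / 2) \<le> 1"
    unfolding sinh_half_hyp_dist[OF assms(1,2)] using p by (simp add: field_simps)
  also have "1 \<le> sinh (1::real)"
  proof -
    have "exp (1::real) \<ge> 1 + 1 + 1/2" using exp_lower_Taylor_quadratic[of 1] by simp
    moreover have "exp (-1::real) \<le> 1 / 2" using calculation by (simp add: exp_minus field_simps)
    ultimately show ?thesis by (simp add: sinh_field_def)
  qed
  finally show ?thesis by simp
qed

section \<open>Geodesics and orbit growth in the ball\<close>

text \<open>\<open>V\<close> stands for the point of the hyperboloid with spatial part
  \<open>V\<close> and time coordinate \<open>sqrt (1 + (norm V)\<^sup>2)\<close>; the map is the
  stereographic projection to the ball. On the hyperboloid geodesics are linear combinations of
  their end points.\<close>

definition ball_of :: "real ^ 'n \<Rightarrow> real ^ 'n" where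
  "ball_of V = V /\<^sub>R (1 + sqrt (1 + (norm V)\<^sup>2))"

lemma one_minus_norm_ball_of: "1 - (norm (ball_of V))\<^sup>2 = 2 / (1 + sqrt (1 + (norm V)\<^sup>2))"
proof -
  define T where "T = sqrt (1 + (norm V)\<^sup>2)"
  have T: "0 < 1 + T" "(norm V)\<^sup>2 = (T - 1) * (T + 1)"
    by (auto simp: T_def algebra_simps power2_eq_square[symmetric] intro: add_pos_nonneg)
  have "(norm (ball_of V))\<^sup>2 = (norm V)\<^sup>2 / (1 + T)\<^sup>2"
    using T(1) by (simp add: ball_of_def T_def[symmetric] power_mult_distrib divide_inverse power_inverse mult.commute)
  also have "\<dots> = (T - 1) / (1 + T)" using T by (simp add: power2_eq_square add.commute)
  finally show ?thesis using T(1) by (simp add: T_def[symmetric] field_simps)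
qed

lemma ball_of_in_hyp_space: "ball_of V \<in> hyp_space"
proof -
  have "0 < 2 / (1 + sqrt (1 + (norm V)\<^sup>2))" by (simp add: add_pos_nonneg)
  then show ?thesis unfolding one_minus_norm_ball_of[symmetric] by (simp add: hyp_space_iff)
qed

lemma cosh_hyp_dist_ball_of:
  "cosh (hyp_dist (ball_of V) (ball_of W)) = sqrt (1 + (norm V)\<^sup>2) * sqrt (1 + (norm W)\<^sup>2) - V \<bullet> W"
proof -
  define T where "T = sqrt (1 + (norm V)\<^sup>2)"
  define U where "U = sqrt (1 + (norm W)\<^sup>2)"
  have p: "0 < 1 + T" "0 < 1 + U" by (auto simp: T_def U_def intro: add_pos_nonneg)
  have x: "(norm (ball_of V))\<^sup>2 = 1 - 2 / (1 + T)" "(norm (ball_of W))\<^sup>2 = 1 - 2 / (1 + U)"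
    using one_minus_norm_ball_of[of V] one_minus_norm_ball_of[of W] by (simp_all add: T_def U_def)
  have i: "ball_of V \<bullet> ball_of W = V \<bullet> W / ((1 + T) * (1 + U))"
    by (simp add: ball_of_def T_def U_def divide_inverse)
  have "(norm (ball_of V - ball_of W))\<^sup>2
      = (norm (ball_of V))\<^sup>2 + (norm (ball_of W))\<^sup>2 - 2 * (ball_of V \<bullet> ball_of W)"
    by (simp add: power2_norm_eq_inner inner_diff_left inner_diff_right inner_commute)
  then have n: "(norm (ball_of V - ball_of W))\<^sup>2
      = 2 - 2 / (1 + T) - 2 / (1 + U) - 2 * (V \<bullet> W) / ((1 + T) * (1 + U))"
    by (simp add: x i)
  have "cosh (hyp_dist (ball_of V) (ball_of W))
      = 1 + 2 * (2 - 2 / (1 + T) - 2 / (1 + U) - 2 * (V \<bullet> W) / ((1 + T) * (1 + U))) / (2 / (1 + T) * (2 / (1 + U)))"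
    unfolding cosh_hyp_dist[OF ball_of_in_hyp_space ball_of_in_hyp_space] n
    by (simp add: one_minus_norm_ball_of T_def U_def)
  also have "\<dots> = T * U - V \<bullet> W"
  proof -
    have "1 + 2 * (2 - 2 / P - 2 / Q - 2 * v / (P * Q)) / (2 / P * (2 / Q)) = (P - 1) * (Q - 1) - v"
      if "0 < P" "0 < Q" for P Q v :: real
      using that by (simp add: field_simps)
    from this[OF p] show ?thesis by simp
  qed
  finally show ?thesis by (simp add: T_def U_def)
qed

lemma ball_of_surj:
  assumes "x \<in> hyp_space"
  shows "ball_of ((2 / (1 - (norm x)\<^sup>2)) *\<^sub>R x) = x"
proof -
  define q where "q = (norm x)\<^sup>2"
  have q: "0 < 1 - q" "0 \<le> q" using assms by (simp_all add: q_def hyp_space_iff)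
  have "1 + (norm ((2 / (1 - q)) *\<^sub>R x))\<^sup>2 = ((1 + q) / (1 - q))\<^sup>2"
  proof -
    have "(norm ((2 / (1 - q)) *\<^sub>R x))\<^sup>2 = (2 / (1 - q))\<^sup>2 * q"
      by (simp add: power_mult_distrib power_divide q_def)
    moreover have "1 + (2 / (1 - q))\<^sup>2 * q = ((1 + q) / (1 - q))\<^sup>2"
    proof -
      have "1 + (2 / d)\<^sup>2 * (1 - d) = ((2 - d) / d)\<^sup>2" if "0 < d" for d :: real
        using that by (simp add: power_divide field_simps power2_eq_square)
      from this[OF q(1)] show ?thesis by (simp add: algebra_simps)
    qed
    ultimately show ?thesis by simp
  qed
  then have "sqrt (1 + (norm ((2 / (1 - q)) *\<^sub>R x))\<^sup>2) = (1 + q) / (1 - q)" using q by simp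
  then have "ball_of ((2 / (1 - q)) *\<^sub>R x) = (inverse (1 + (1 + q) / (1 - q)) * (2 / (1 - q))) *\<^sub>R x"
    by (simp add: ball_of_def)
  also have "inverse (1 + (1 + q) / (1 - q)) * (2 / (1 - q)) = 1"
    using q by (simp add: field_simps)
  finally show ?thesis by (simp add: q_def)
qed

text \<open>The left side is the Lorentz form \<open>T * U - V \<bullet> W\<close> evaluated at the
  times \<open>s\<close> and \<open>t\<close> of the geodesic, before division by
  \<open>sinh L\<close>.\<close>

lemma sinh_geodesic_identity:
  fixes L s t :: real
  shows "sinh (L - s) * sinh (L - t) + sinh s * sinh t
      + (sinh (L - s) * sinh t + sinh s * sinh (L - t)) * cosh L = (sinh L)\<^sup>2 * cosh (s - t)"
proof -
  have C: "cosh L * cosh L = sinh L * sinh L + 1"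
    using cosh_square_eq[of L] by (simp add: power2_eq_square)
  have "sinh (L - s) * sinh (L - t) + sinh s * sinh t
      + (sinh (L - s) * sinh t + sinh s * sinh (L - t)) * cosh L
    = (sinh L)\<^sup>2 * cosh s * cosh t + sinh s * sinh t - (cosh L * cosh L) * (sinh s * sinh t)"
    unfolding sinh_diff power2_eq_square by (simp add: algebra_simps)
  also have "\<dots> = (sinh L)\<^sup>2 * cosh (s - t)"
    unfolding C cosh_diff power2_eq_square by (simp add: algebra_simps)
  finally show ?thesis .
qed

text \<open>On the hyperboloid the unit speed geodesic of length \<open>L\<close> from \<open>V\<close> to \<open>W\<close> is
  \<open>t \<mapsto> (sinh (L - t) V + sinh t W) / sinh L\<close>.\<close>

lemma geodesic_exists:
  assumes "x \<in> hyp_space" "y \<in> hyp_space"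
  shows "\<exists>c. geodesic_from_to c x y"
proof (cases "x = y")
  case True
  then show ?thesis using assms by (intro exI[of _ "\<lambda>_. x"]) (auto simp: geodesic_from_to_def)
next
  case False
  define L where "L = hyp_dist x y"
  obtain V W where VW: "x = ball_of V" "y = ball_of W"
    using ball_of_surj[OF assms(1)] ball_of_surj[OF assms(2)] by metis
  have "L \<noteq> 0"
  proof
    assume "L = 0"
    then show False
      using cosh_hyp_dist[OF assms] False assms by (auto simp: L_def hyp_space_iff)
  qed
  then have L: "0 < L" using hyp_dist_nonneg[OF assms] by (simp add: L_def)
  define T where "T = sqrt (1 + (norm V)\<^sup>2)"
  define U where "U = sqrt (1 + (norm W)\<^sup>2)"
  have TU: "0 \<le> T" "0 \<le> U" "T * T = 1 + V \<bullet> V" "U * U = 1 + W \<bullet> W"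
    by (auto simp: T_def U_def power2_norm_eq_inner)
  have coshL: "cosh L = T * U - V \<bullet> W"
    by (simp add: L_def VW cosh_hyp_dist_ball_of T_def U_def)
  define a where "a t = sinh (L - t) / sinh L" for t
  define b where "b t = sinh t / sinh L" for t
  define Z where "Z t = a t *\<^sub>R V + b t *\<^sub>R W" for t
  have S: "0 < sinh L" using L by simp
  have bil: "(a s * T + b s * U) * (a t * T + b t * U) - Z s \<bullet> Z t = cosh (s - t)" for s t
  proof -
    have "(a s * T + b s * U) * (a t * T + b t * U) - Z s \<bullet> Z t
      = a s * a t * (T * T - V \<bullet> V) + b s * b t * (U * U - W \<bullet> W) + (a s * b t + b s * a t) * (T * U - V \<bullet> W)"
      by (simp add: Z_def inner_add_left inner_add_right inner_commute[of W V] algebra_simps)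
    also have "\<dots> = a s * a t + b s * b t + (a s * b t + b s * a t) * cosh L"
      by (simp add: TU coshL)
    also have "\<dots> = (sinh (L - s) * sinh (L - t) + sinh s * sinh t
      + (sinh (L - s) * sinh t + sinh s * sinh (L - t)) * cosh L) / (sinh L)\<^sup>2"
      using S by (simp add: a_def b_def power2_eq_square add_divide_distrib distrib_right)
    also have "\<dots> = cosh (s - t)" unfolding sinh_geodesic_identity using S by simp
    finally show ?thesis .
  qed
  \<comment> \<open>The time coordinate of a combination is the same combination of the time
    coordinates. The sign of the root needs both coefficients nonnegative, hence the restriction to
    \<open>{0..L}\<close>.\<close>
  have root: "sqrt (1 + (norm (Z t))\<^sup>2) = a t * T + b t * U" if "t \<in> {0..L}" for t
  proof (rule real_sqrt_unique)
    show "(a t * T + b t * U)\<^sup>2 = 1 + (norm (Z t))\<^sup>2"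
      using bil[of t t] by (simp add: power2_eq_square power2_norm_eq_inner[symmetric])
    have "0 \<le> a t" "0 \<le> b t" using that S by (simp_all add: a_def b_def)
    then show "0 \<le> a t * T + b t * U" using TU by simp
  qed
  have "hyp_dist (ball_of (Z s)) (ball_of (Z t)) = \<bar>s - t\<bar>" if "s \<in> {0..L}" "t \<in> {0..L}" for s t
  proof -
    have "cosh (hyp_dist (ball_of (Z s)) (ball_of (Z t))) = cosh (s - t)"
      using bil[of s t] by (simp add: cosh_hyp_dist_ball_of root[OF that(1)] root[OF that(2)])
    then show ?thesis
      using hyp_dist_nonneg[OF ball_of_in_hyp_space ball_of_in_hyp_space, of "Z s" "Z t"] by simp
  qed
  moreover have "ball_of (Z 0) = x" "ball_of (Z L) = y"
    using S by (auto simp: Z_def a_def b_def VW)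
  ultimately have "geodesic_from_to (\<lambda>t. ball_of (Z t)) x y"
    unfolding geodesic_from_to_def L_def[symmetric] using ball_of_in_hyp_space by auto
  then show ?thesis by blast
qed

lemma geodesic_fromD:
  assumes "geodesic_from_to c x y" "t \<in> {0..hyp_dist x y}"
  shows "hyp_dist (c t) (c 0) = t" "hyp_dist (c t) (c (hyp_dist x y)) = hyp_dist x y - t"
proof -
  have iso: "hyp_dist (c s) (c u) = \<bar>s - u\<bar>"
    if "s \<in> {0..hyp_dist x y}" "u \<in> {0..hyp_dist x y}" for s u
    using assms(1) that unfolding geodesic_from_to_def by blast
  show "hyp_dist (c t) (c 0) = t" using iso[of t 0] assms(2) by simp
  show "hyp_dist (c t) (c (hyp_dist x y)) = hyp_dist x y - t"
    using iso[of t "hyp_dist x y"] assms(2) by simp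
qed

text \<open>\<open>p\<close> is compared with the point \<open>w\<close> of a geodesic at the same
  distance from \<open>x\<close>: in the four-point condition for \<open>p\<close>,
  \<open>w\<close>, \<open>x\<close>, \<open>y\<close> both terms of the maximum are at most
  \<open>hyp_dist x y + E\<close>. If \<open>p\<close> is farther from \<open>x\<close> than
  \<open>y\<close> is, then \<open>w = y\<close>.\<close>

lemma geodesic_segment_near:
  assumes "x \<in> hyp_space" "y \<in> hyp_space" "p \<in> hyp_space"
    and "hyp_dist x p + hyp_dist p y \<le> hyp_dist x y + E"
  shows "\<exists>w\<in>geodesic_segment x y. hyp_dist p w \<le> E + 2 * ln 8"
proof -
  obtain c where c: "geodesic_from_to c x y" using geodesic_exists[OF assms(1,2)] by blast
  define t where "t = min (hyp_dist x p) (hyp_dist x y)"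
  have t: "t \<in> {0..hyp_dist x y}" using hyp_dist_nonneg assms by (auto simp: t_def)
  define w where "w = c t"
  have w: "w \<in> hyp_space" "w \<in> geodesic_segment x y"
    using c t unfolding geodesic_segment_def w_def by (auto simp: geodesic_from_to_def)[1] (use c t in blast)
  have "hyp_dist (c t) (c 0) = t" "hyp_dist (c t) (c (hyp_dist x y)) = hyp_dist x y - t"
    using geodesic_fromD[OF c t] by auto
  then have d: "hyp_dist w x = t" "hyp_dist w y = hyp_dist x y - t"
    using c by (auto simp: geodesic_from_to_def w_def)
  have ln8: "0 \<le> ln (8::real)" by simp
  have "hyp_dist p w \<le> E + 2 * ln 8"
  proof (cases "hyp_dist x p \<le> hyp_dist x y")
    case True
    then have "t = hyp_dist x p" by (simp add: t_def)
    then show ?thesis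
      using hyp_dist_four_point[of p w x y] assms w d hyp_dist_commute[of p x]
        hyp_dist_triangle[of x p y] by (auto simp: max_def split: if_splits)
  next
    case False
    then have "hyp_dist w y = 0" using d by (simp add: t_def)
    then have "hyp_dist p w \<le> hyp_dist p y"
      using hyp_dist_triangle[of p y w] assms w hyp_dist_commute[of y w] by simp
    then show ?thesis using False assms(4) ln8 by linarith
  qed
  then show ?thesis using w by blast
qed

lemma geodesic_segment_between:
  assumes "p \<in> geodesic_segment x y" "x \<in> hyp_space" "y \<in> hyp_space"
  shows "p \<in> hyp_space" "hyp_dist x p + hyp_dist p y = hyp_dist x y"
proof -
  obtain c t where c: "geodesic_from_to c x y" and t: "t \<in> {0..hyp_dist x y}" "p = c t"
    using assms by (auto simp: geodesic_segment_def)
  show "p \<in> hyp_space" using c t by (auto simp: geodesic_from_to_def)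
  have "hyp_dist (c 0) (c t) = t" "hyp_dist (c t) (c (hyp_dist x y)) = hyp_dist x y - t"
    using geodesic_fromD[OF c t(1)] hyp_dist_commute[of "c 0"] by auto
  moreover have "c 0 = x" "c (hyp_dist x y) = y" using c by (simp_all add: geodesic_from_to_def)
  ultimately show "hyp_dist x p + hyp_dist p y = hyp_dist x y" using t(2) by simp
qed

section \<open>Compactness and counting in hyperbolic balls\<close>

lemma hyp_ball_subset_compact:
  assumes "x0 \<in> hyp_space"
  shows "\<exists>C. compact C \<and> C \<subseteq> hyp_space \<and> {z \<in> hyp_space. hyp_dist x0 z \<le> R} \<subseteq> C"
proof -
  define R' where "R' = hyp_dist 0 x0 + R"
  define r where "r = sqrt (1 - exp (- R'))"
  have 0: "0 \<in> hyp_space" by (simp add: hyp_space_iff)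
  have "r < 1" by (simp add: r_def)
  then have "cball 0 r \<subseteq> hyp_space" by (auto simp: hyp_space_def)
  moreover have "z \<in> cball 0 r" if "z \<in> hyp_space" "hyp_dist x0 z \<le> R" for z
  proof -
    have "hyp_dist 0 z \<le> R'" using hyp_dist_triangle[OF 0 assms that(1)] that(2) by (simp add: R'_def)
    then have "1 / (1 - (norm z)\<^sup>2) \<le> exp R'"
      using inverse_conformal_le_exp(2)[OF that(1)] by (meson exp_le_cancel_iff order_trans)
    moreover have "0 < 1 - (norm z)\<^sup>2" using that by (simp add: hyp_space_iff)
    ultimately have "(norm z)\<^sup>2 \<le> 1 - exp (- R')" by (simp add: exp_minus field_simps)
    then show ?thesis unfolding r_def by (simp add: real_le_rsqrt)
  qed
  ultimately show ?thesis by (intro exI[of _ "cball 0 r"]) auto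
qed

text \<open>Box counting: points in one cell of mesh \<open>1 / m\<close> are within Euclidean
  distance \<open>n / m \<le> exp (- R)\<close>, hence within hyperbolic distance 2, so a cell holds
  at most \<open>M\<close> indices. The growth rate \<open>CARD('n)\<close> is above the true volume
  growth, but the purpose is only to see that the critical exponent is finite.\<close>

lemma card_le_grid:
  fixes p :: "'g \<Rightarrow> real ^ 'n"
  assumes A: "finite A" and p: "\<And>g. g \<in> A \<Longrightarrow> p g \<in> hyp_space \<and> hyp_dist 0 (p g) \<le> R" and "0 \<le> R"
    and M: "\<And>g. g \<in> A \<Longrightarrow> card {h \<in> A. hyp_dist (p g) (p h) \<le> 2} \<le> M"
  shows "real (card A) \<le> real M * (2 * real CARD('n) + 3) ^ CARD('n) * exp (real CARD('n) * R)"
proof -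
  define n where "n = CARD('n)"
  define m where "m = \<lceil>real n * exp R\<rceil>"
  have n: "0 < n" by (simp add: n_def)
  have m: "real n * exp R \<le> real_of_int m" "real_of_int m \<le> real n * exp R + 1"
    unfolding m_def by linarith+
  have m0: "0 < real_of_int m" using m(1) n by (meson exp_gt_zero less_le_trans mult_pos_pos of_nat_0_less_iff)
  define f where "f g = (\<lambda>i. \<lfloor>p g $ i * real_of_int m\<rfloor>)" for g
  define P where "P = (PiE (UNIV :: 'n set) (\<lambda>_. {- m..m}))"
  have fP: "f g \<in> P" if "g \<in> A" for g
  proof -
    have "\<bar>p g $ i\<bar> \<le> 1" for i
      using component_le_norm_cart[of "p g" i] p[OF that] by (auto simp: hyp_space_def)
    then have "\<bar>p g $ i * real_of_int m\<bar> \<le> 1 * real_of_int m" for i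
      using m0 unfolding abs_mult by (intro mult_mono) auto
    then have "- m \<le> f g i \<and> f g i \<le> m" for i
      unfolding f_def abs_le_iff using le_floor_iff[of "- m"] floor_le_iff[of _ m]
      by (smt (verit) of_int_minus)
    then show ?thesis by (auto simp: P_def)
  qed
  have fin: "finite P" by (simp add: P_def finite_PiE)
  have cardP: "card P = nat (2 * m + 1) ^ n" by (simp add: P_def card_PiE n_def)
  have fibre: "card {h \<in> A. f h = q} \<le> M" for q
  proof (cases "\<exists>g\<in>A. f g = q")
    case True
    then obtain g where g: "g \<in> A" "f g = q" by blast
    have "hyp_dist (p g) (p h) \<le> 2" if "h \<in> A" "f h = q" for h
    proof (rule hyp_dist_le_two)
      show "p g \<in> hyp_space" "p h \<in> hyp_space" "hyp_dist 0 (p g) \<le> R" "hyp_dist 0 (p h) \<le> R"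
        using p g that by auto
      have "\<bar>(p g - p h) $ i\<bar> \<le> 1 / real_of_int m" for i
      proof -
        have "f g i = f h i" using g that by simp
        then have "\<bar>p g $ i * real_of_int m - p h $ i * real_of_int m\<bar> \<le> 1"
          unfolding f_def by linarith
        then have "\<bar>(p g $ i - p h $ i) * real_of_int m\<bar> \<le> 1" by (simp only: left_diff_distrib)
        then have "\<bar>p g $ i - p h $ i\<bar> * real_of_int m \<le> 1" using m0 by (simp only: abs_mult abs_of_pos)
        then show ?thesis using m0 by (simp add: pos_le_divide_eq)
      qed
      then have "norm (p g - p h) \<le> (\<Sum>i\<in>(UNIV :: 'n set). 1 / real_of_int m)"
        using norm_le_l1_cart[of "p g - p h"] by (meson order_trans sum_mono)
      also have "\<dots> = real n / real_of_int m" by (simp add: n_def)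
      also have "\<dots> \<le> exp (- R)" using m(1) m0 by (simp add: exp_minus field_simps)
      finally show "norm (p g - p h) \<le> exp (- R)" .
    qed
    then have "{h \<in> A. f h = q} \<subseteq> {h \<in> A. hyp_dist (p g) (p h) \<le> 2}" by auto
    then have "card {h \<in> A. f h = q} \<le> card {h \<in> A. hyp_dist (p g) (p h) \<le> 2}"
      using A by (intro card_mono) auto
    then show ?thesis using M[OF g(1)] by linarith
  next
    case False
    then have "{h \<in> A. f h = q} = {}" by auto
    then show ?thesis by (simp only: card.empty zero_le)
  qed
  have "A = (\<Union>q\<in>P. {h \<in> A. f h = q})" using fP by auto
  then have "card A \<le> (\<Sum>q\<in>P. card {h \<in> A. f h = q})" using card_UN_le[OF fin] by metis
  also have "\<dots> \<le> card P * M" using fibre sum_bounded_above[of P _ M] by simp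
  finally have "real (card A) \<le> real (card P) * real M" by (metis of_nat_le_iff of_nat_mult)
  also have "real (card P) = (2 * real_of_int m + 1) ^ n" using m0 by (simp add: cardP)
  also have "\<dots> \<le> ((2 * real n + 3) * exp R) ^ n"
  proof (rule power_mono)
    have "1 \<le> exp R" using \<open>0 \<le> R\<close> by simp
    then show "2 * real_of_int m + 1 \<le> (2 * real n + 3) * exp R" using m(2)
      by (simp only: distrib_right mult.assoc)
    show "0 \<le> 2 * real_of_int m + 1" using m0 by simp
  qed
  also have "\<dots> = (2 * real n + 3) ^ n * exp (real n * R)"
    by (simp add: power_mult_distrib exp_of_nat_mult)
  finally show ?thesis by (simp add: n_def mult.commute mult.left_commute mult_right_mono)
qed

section \<open>Groups with a hyperbolic length function\<close>

text \<open>What remains of the geometry once only the orbit of the base point matters: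
  \<open>four_point\<close> is Gromov's condition for the orbit points of \<one>, \<open>x\<close>,
  \<open>y\<close>, \<open>z\<close>, and \<open>finite_len_le\<close> is properness.\<close>

locale hyperbolic_length = group G for G (structure) +
  fixes len :: "'a \<Rightarrow> real" and \<delta> :: real
  assumes len_one [simp]: "len \<one> = 0"
    and len_inv [simp]: "x \<in> carrier G \<Longrightarrow> len (inv x) = len x"
    and len_mult_le: "x \<in> carrier G \<Longrightarrow> y \<in> carrier G \<Longrightarrow> len (x \<otimes> y) \<le> len x + len y"
    and four_point: "x \<in> carrier G \<Longrightarrow> y \<in> carrier G \<Longrightarrow> z \<in> carrier G \<Longrightarrow>
      len (inv x \<otimes> z) + len y
        \<le> max (len (inv x \<otimes> y) + len z) (len (inv y \<otimes> z) + len x) + 2 * \<delta>"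
    and finite_len_le: "finite {g \<in> carrier G. len g \<le> R}"
begin

text \<open>The Gromov product of \<open>x\<close> and \<open>y\<close> based at \<open>\<one>\<close>.\<close>

definition gp :: "'a \<Rightarrow> 'a \<Rightarrow> real" where
  "gp x y = (len x + len y - len (inv x \<otimes> y)) / 2"

abbreviation word_prod :: "'a list \<Rightarrow> 'a" where
  "word_prod w \<equiv> foldr (mult G) w \<one>"

lemma delta_nonneg: "0 \<le> \<delta>"
  using four_point[of \<one> \<one> \<one>] by simp

lemma len_nonneg: "x \<in> carrier G \<Longrightarrow> 0 \<le> len x"
  using len_mult_le[of x "inv x"] by simp

lemma len_inv_mult_sym:
  assumes "x \<in> carrier G" "y \<in> carrier G"
  shows "len (inv x \<otimes> y) = len (inv y \<otimes> x)"
  using len_inv[of "inv x \<otimes> y"] assms by (simp add: inv_mult_group del: len_inv)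

lemma mult_inv_cancel:
  assumes "x \<in> carrier G" "y \<in> carrier G"
  shows "x \<otimes> (inv x \<otimes> y) = y" "inv x \<otimes> (x \<otimes> y) = y"
  using assms by (simp_all add: m_assoc[symmetric])

lemma inv_mult_left_cancel:
  assumes "x \<in> carrier G" "y \<in> carrier G" "k \<in> carrier G"
  shows "inv (k \<otimes> x) \<otimes> (k \<otimes> y) = inv x \<otimes> y"
  using assms by (simp add: inv_mult_group m_assoc inv_solve_left')

lemma len_mult_ge:
  assumes "x \<in> carrier G" "y \<in> carrier G"
  shows "len y - len x \<le> len (x \<otimes> y)" "len x - len y \<le> len (x \<otimes> y)"
proof -
  have "inv x \<otimes> (x \<otimes> y) = y" "(x \<otimes> y) \<otimes> inv y = x"
    using assms by (simp_all add: m_assoc inv_solve_left')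
  then show "len y - len x \<le> len (x \<otimes> y)" "len x - len y \<le> len (x \<otimes> y)"
    using len_mult_le[of "inv x" "x \<otimes> y"] len_mult_le[of "x \<otimes> y" "inv y"] assms by auto
qed

lemma gp_sym: "x \<in> carrier G \<Longrightarrow> y \<in> carrier G \<Longrightarrow> gp x y = gp y x"
  by (simp add: gp_def len_inv_mult_sym)

lemma gp_le:
  assumes "x \<in> carrier G" "y \<in> carrier G"
  shows "gp x y \<le> len x" "gp x y \<le> len y"
  using len_mult_ge[of "inv x" y] assms by (simp_all add: gp_def)

lemma gp_nonneg:
  assumes "x \<in> carrier G" "y \<in> carrier G"
  shows "0 \<le> gp x y"
  using len_mult_le[of "inv x" y] assms by (simp add: gp_def)

lemma gp_self: "x \<in> carrier G \<Longrightarrow> gp x x = len x"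
  by (simp add: gp_def)

lemma gp_one [simp]: "x \<in> carrier G \<Longrightarrow> gp x \<one> = 0" "x \<in> carrier G \<Longrightarrow> gp \<one> x = 0"
  by (simp_all add: gp_def)

lemma gp_hyp:
  assumes "x \<in> carrier G" "y \<in> carrier G" "z \<in> carrier G"
  shows "min (gp x y) (gp y z) - \<delta> \<le> gp x z"
  using four_point[OF assms] by (auto simp: gp_def min_def max_def field_simps split: if_splits)

text \<open>In the minimum of \<open>gp_hyp\<close> the term \<open>gp y z\<close> is too large to
  be the smaller one. This is how hyperbolicity is used throughout: an element may be replaced by
  one that follows it long enough, at the cost of one \<delta>.\<close>

lemma gp_cases:
  assumes "x \<in> carrier G" "y \<in> carrier G" "z \<in> carrier G"
    and "gp x z \<le> c" "c + \<delta> < gp y z"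
  shows "gp x y \<le> c + \<delta>"
  using gp_hyp[OF assms(1-3)] assms(4,5) by (auto simp: min_def split: if_splits)

lemma len_mult_eq:
  assumes "x \<in> carrier G" "y \<in> carrier G"
  shows "len (x \<otimes> y) = len x + len y - 2 * gp (inv x) y"
  using assms by (simp add: gp_def field_simps)

text \<open>A small \<open>gp (inv x) y\<close> says that the path from \<one> through
  \<open>x\<close> to \<open>x \<otimes> y\<close> does not backtrack at \<open>x\<close>; the
  product then follows \<open>x\<close> almost to its end.\<close>

lemma gp_mult_self:
  assumes "x \<in> carrier G" "y \<in> carrier G"
  shows "gp x (x \<otimes> y) = len x - gp (inv x) y"
proof -
  have "inv x \<otimes> (x \<otimes> y) = y" using assms by (simp add: inv_solve_left')
  then show ?thesis using assms by (simp add: gp_def field_simps)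
qed

lemma gp_mult_left:
  assumes "k \<in> carrier G" "x \<in> carrier G" "y \<in> carrier G"
  shows "gp (k \<otimes> x) (k \<otimes> y) \<le> gp x y + len k" "gp x y - len k \<le> gp (k \<otimes> x) (k \<otimes> y)"
  using len_mult_le[of k x] len_mult_le[of k y] len_mult_ge[of k x] len_mult_ge[of k y] assms
  by (simp_all add: gp_def inv_mult_left_cancel field_simps)

lemma gp_mult_right:
  assumes "k \<in> carrier G" "x \<in> carrier G" "y \<in> carrier G"
  shows "gp (x \<otimes> k) y \<le> gp x y + len k" "gp x y - len k \<le> gp (x \<otimes> k) y"
proof -
  have "inv (x \<otimes> k) \<otimes> y = inv k \<otimes> (inv x \<otimes> y)"
    using assms by (simp add: inv_mult_group m_assoc)
  then show "gp (x \<otimes> k) y \<le> gp x y + len k" "gp x y - len k \<le> gp (x \<otimes> k) y"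
    using len_mult_le[of x k] len_mult_ge[of x k] assms len_mult_le[of "inv k" "inv x \<otimes> y"]
      len_mult_ge[of "inv k" "inv x \<otimes> y"]
    by (simp_all add: gp_def field_simps)
qed

section \<open>Words without backtracking: from local to global\<close>

lemma word_prod_closed [simp]: "set w \<subseteq> carrier G \<Longrightarrow> word_prod w \<in> carrier G"
  by (induction w) auto

lemma word_prod_append:
  "set v \<subseteq> carrier G \<Longrightarrow> set w \<subseteq> carrier G \<Longrightarrow> word_prod (v @ w) = word_prod v \<otimes> word_prod w"
  by (induction v) (auto simp: m_assoc)

lemma inv_word_prod:
  "set w \<subseteq> carrier G \<Longrightarrow> inv (word_prod w) = word_prod (rev (map (\<lambda>x. inv x) w))"
proof (induction w)
  case (Cons a w)
  have "set (rev (map (\<lambda>x. inv x) w)) \<subseteq> carrier G" using Cons.prems by auto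
  moreover have "set [inv a] \<subseteq> carrier G" using Cons.prems by auto
  ultimately show ?case using Cons by (simp add: inv_mult_group word_prod_append del: foldr_append)
qed auto

text \<open>The local condition for a broken geodesic: little backtracking at the vertices and long
  edges. The threshold is such that a letter, after losing \<open>2 * (c + \<delta>)\<close> to the
  product that follows it, still adds at least \<open>c + 2 * \<delta> + 1\<close>.\<close>

definition chain :: "real \<Rightarrow> 'a list \<Rightarrow> bool" where
  "chain c w \<longleftrightarrow> successively (\<lambda>s t. gp (inv s) t \<le> c) w \<and>
     (\<forall>s\<in>set w. s \<in> carrier G \<and> 3 * c + 6 * \<delta> + 1 < len s)"

lemma chain_closed: "chain c w \<Longrightarrow> set w \<subseteq> carrier G"
  by (auto simp: chain_def)

lemma chain_Cons_Cons [simp]: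
  "chain c (s # t # w) \<longleftrightarrow> s \<in> carrier G \<and> 3 * c + 6 * \<delta> + 1 < len s \<and> gp (inv s) t \<le> c \<and>
     chain c (t # w)"
  by (auto simp: chain_def)

lemma chain_single [simp]: "chain c [s] \<longleftrightarrow> s \<in> carrier G \<and> 3 * c + 6 * \<delta> + 1 < len s"
  by (auto simp: chain_def)

lemma chain_Nil [simp]: "chain c []"
  by (auto simp: chain_def)

lemma chain_append_iff:
  "chain c (v @ w) \<longleftrightarrow> chain c v \<and> chain c w \<and> (v = [] \<or> w = [] \<or> gp (inv (last v)) (hd w) \<le> c)"
  by (auto simp: chain_def successively_append_iff)

lemma chain_rev_inv: "chain c w \<Longrightarrow> chain c (rev (map (\<lambda>x. inv x) w))"
proof (induction w)
  case (Cons a w)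
  show ?case
  proof (cases w)
    case (Cons b u)
    then have "b \<in> carrier G" "a \<in> carrier G" "gp (inv a) b \<le> c"
      using Cons.prems chain_closed[of c "a # w"] by auto
    then have "gp (inv (inv b)) (inv a) \<le> c" using gp_sym[of b "inv a"] by simp
    then show ?thesis using Cons Cons.prems Cons.IH by (simp add: chain_append_iff)
  qed (use Cons.prems in simp)
qed auto

text \<open>The two bounds feed each other in the induction. The product of the tail follows its
  first letter \<open>t\<close> for longer than \<open>c + \<delta>\<close>, so replacing
  \<open>t\<close> by the whole tail in \<open>gp (inv s) t \<le> c\<close> costs one \<delta>, and
  the error does not accumulate with the number of letters.\<close>

lemma chain_head:
  assumes "0 \<le> c" "chain c (s # w)"
  shows "gp (inv s) (word_prod w) \<le> c + \<delta>" "len s - c - \<delta> \<le> gp s (word_prod (s # w))"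
  using assms(2)
proof (induction w arbitrary: s)
  case Nil
  { case 1 then show ?case using \<open>0 \<le> c\<close> delta_nonneg by simp }
  { case 2 then show ?case using \<open>0 \<le> c\<close> delta_nonneg by (simp add: gp_self) }
next
  case (Cons t w)
  { case 1
    then have t: "chain c (t # w)" "s \<in> carrier G" "gp (inv s) t \<le> c" by auto
    then have cl: "t \<in> carrier G" "set w \<subseteq> carrier G" using chain_closed by fastforce+
    have "3 * c + 6 * \<delta> + 1 < len t" using t(1) by (auto simp: chain_def)
    then have "c + \<delta> < gp (word_prod (t # w)) t"
      using Cons.IH(2)[OF t(1)] \<open>0 \<le> c\<close> delta_nonneg cl by (simp add: gp_sym)
    then show ?case
      using gp_cases[of "inv s" "word_prod (t # w)" t c] t(2,3) cl by simp }
  note 1 = this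
  { case 2
    then have "gp (inv s) (word_prod (t # w)) \<le> c + \<delta>" "s \<in> carrier G" using 1 by auto
    moreover have "set (t # w) \<subseteq> carrier G" using 2 chain_closed by fastforce
    ultimately show ?case using gp_mult_self[of s "word_prod (t # w)"] by simp }
qed

text \<open>\<open>chain_head\<close> is applied on both sides of the cut: the last letter
  \<open>z\<close> of \<open>v\<close> is followed by \<open>w\<close>, and the reversed word of
  inverses starts with \<open>inv z\<close>. The second \<delta> pays for passing from
  \<open>inv z\<close> to \<open>inv (word_prod v)\<close>.\<close>

lemma chain_gp:
  assumes "0 \<le> c" "chain c (v @ w)"
  shows "gp (inv (word_prod v)) (word_prod w) \<le> c + 2 * \<delta>"
proof (cases "v = []")
  case True
  then show ?thesis using assms delta_nonneg chain_closed[of c w] by simp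
next
  case False
  then obtain u z where v: "v = u @ [z]" by (metis append_butlast_last_id)
  define r where "r = rev (map (\<lambda>x. inv x) u)"
  have "chain c (u @ (z # w))" using assms(2) v by simp
  then have ch: "chain c v" "chain c (z # w)"
    using assms(2) by (simp_all add: chain_append_iff[of c u "z # w"] chain_append_iff[of c v w])
  then have cl: "z \<in> carrier G" "set v \<subseteq> carrier G" "set w \<subseteq> carrier G"
    using chain_closed by fastforce+
  have r: "rev (map (\<lambda>x. inv x) v) = inv z # r" by (simp add: v r_def)
  have c': "chain c (inv z # r)" using chain_rev_inv[OF ch(1)] by (simp only: r)
  have p: "word_prod (inv z # r) = inv (word_prod v)" using inv_word_prod[OF cl(2)] by (simp only: r)
  have *: "len z - c - \<delta> \<le> gp (inv z) (inv (word_prod v))"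
    using chain_head(2)[OF assms(1) c'] p cl(1) by simp
  have "3 * c + 6 * \<delta> + 1 < len z" using ch(2) by (auto simp: chain_def)
  then have **: "c + \<delta> + \<delta> < gp (inv z) (inv (word_prod v))"
    using * assms(1) delta_nonneg by simp
  have "gp (word_prod w) (inv z) \<le> c + \<delta>"
    using chain_head(1)[OF assms(1) ch(2)] cl by (simp add: gp_sym)
  then have "gp (word_prod w) (inv (word_prod v)) \<le> c + \<delta> + \<delta>"
    using gp_cases[of "word_prod w" "inv (word_prod v)" "inv z" "c + \<delta>"] ** cl by (simp add: gp_sym)
  then show ?thesis using cl by (simp add: gp_sym)
qed

lemma chain_len_append:
  assumes "0 \<le> c" "chain c (v @ w)"
  shows "len (word_prod v) + len (word_prod w) - 2 * (c + 2 * \<delta>) \<le> len (word_prod (v @ w))"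
proof -
  have "set v \<subseteq> carrier G" "set w \<subseteq> carrier G"
    using chain_closed[OF assms(2)] by auto
  then show ?thesis
    using chain_gp[OF assms] by (simp add: word_prod_append len_mult_eq del: foldr_append)
qed

lemma chain_len_ge:
  assumes "0 \<le> c" "chain c w"
  shows "(c + 2 * \<delta> + 1) * real (length w) \<le> len (word_prod w)"
  using assms(2)
proof (induction w)
  case (Cons a w)
  have cl: "a \<in> carrier G" "set w \<subseteq> carrier G" using chain_closed[OF Cons.prems] by auto
  have "chain c w" "3 * c + 6 * \<delta> + 1 < len a" using Cons.prems chain_append_iff[of c "[a]" w] by auto
  moreover have "gp (inv a) (word_prod w) \<le> c + \<delta>" using chain_head(1)[OF assms(1) Cons.prems] .
  ultimately show ?case using Cons.IH cl delta_nonneg assms(1)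
    by (simp add: len_mult_eq algebra_simps)
qed auto

text \<open>Both letters follow the common remaining product, hence each other. The contrapositive
  gives unique decoding: chains with equal products cannot part at two letters that diverge
  early.\<close>

lemma chain_fork:
  assumes "0 \<le> c" "chain c (v @ s # w)" "chain c (v @ s' # w')"
    and eq: "word_prod (v @ s # w) = word_prod (v @ s' # w')"
  shows "min (len s) (len s') - c - 2 * \<delta> \<le> gp s s'"
proof -
  have cl: "set v \<subseteq> carrier G" "set (s # w) \<subseteq> carrier G" "set (s' # w') \<subseteq> carrier G"
    using assms(2,3)[THEN chain_closed] by auto
  then have "word_prod (s # w) = word_prod (s' # w')"
    using eq by (simp add: word_prod_append del: foldr_append foldr.simps)
  moreover have "chain c (s # w)" "chain c (s' # w')" using assms(2,3) by (auto simp: chain_append_iff)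
  ultimately have *: "len s - c - \<delta> \<le> gp s (word_prod (s # w))" "len s' - c - \<delta> \<le> gp s' (word_prod (s # w))"
    using chain_head(2)[OF assms(1)] by (metis, metis)
  have "word_prod (s # w) \<in> carrier G" using cl(2) by simp
  then show ?thesis using gp_hyp[of s "word_prod (s # w)" s'] cl *
    by (auto simp: gp_sym[of "word_prod (s # w)" s'] min_def simp del: foldr.simps split: if_splits)
qed

section \<open>Loxodromic elements\<close>

text \<open>The condition under which all words \<open>h h ... h\<close> are chains, so that the
  powers of \<open>h\<close> move along an axis.\<close>

definition loxodromic :: "real \<Rightarrow> 'a \<Rightarrow> bool" where
  "loxodromic c h \<longleftrightarrow> 0 \<le> c \<and> h \<in> carrier G \<and> gp (inv h) h \<le> c \<and> 3 * c + 6 * \<delta> + 1 < len h"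

lemma word_prod_replicate: "h \<in> carrier G \<Longrightarrow> (mult G h ^^ n) \<one> = h [^] n"
proof (induction n)
  case (Suc n)
  then show ?case using nat_pow_Suc2[of h n] by simp
qed simp

lemma loxodromic_inv: "loxodromic c h \<Longrightarrow> loxodromic c (inv h)"
  by (auto simp: loxodromic_def gp_sym)

lemma chain_replicate: "loxodromic c h \<Longrightarrow> chain c (replicate n h)"
proof (induction n)
  case (Suc n)
  then show ?case by (cases n) (auto simp: loxodromic_def)
qed auto

lemma nat_pow_gp_inv:
  assumes "loxodromic c h"
  shows "gp (inv (h [^] (n::nat))) (h [^] (m::nat)) \<le> c + 2 * \<delta>"
  using chain_gp[of c "replicate n h" "replicate m h"] chain_replicate[OF assms, of "n + m"] assms
  by (simp add: word_prod_replicate loxodromic_def replicate_add)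

lemma nat_pow_gp:
  assumes "loxodromic c h" "n \<le> m"
  shows "len (h [^] (n::nat)) - (c + 2 * \<delta>) \<le> gp (h [^] n) (h [^] (m::nat))"
proof -
  have h: "h \<in> carrier G" using assms by (simp add: loxodromic_def)
  then have "h [^] m = h [^] n \<otimes> h [^] (m - n)" using \<open>n \<le> m\<close> by (simp add: nat_pow_mult)
  then show ?thesis
    using gp_mult_self[of "h [^] n" "h [^] (m - n)"] nat_pow_gp_inv[OF assms(1), of n "m - n"] h by simp
qed

lemma nat_pow_len_ge:
  assumes "loxodromic c h"
  shows "real n \<le> len (h [^] n)"
proof -
  have "real n \<le> (c + 2 * \<delta> + 1) * real n"
    using assms delta_nonneg by (simp add: loxodromic_def algebra_simps)
  then show ?thesis
    using chain_len_ge[of c "replicate n h"] chain_replicate[OF assms, of n] assms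
    by (simp add: word_prod_replicate loxodromic_def)
qed

lemma nat_pow_len_le: "h \<in> carrier G \<Longrightarrow> len (h [^] (n::nat)) \<le> real n * len h"
proof (induction n)
  case (Suc n)
  then show ?case using len_mult_le[of "h [^] n" h] by (simp add: algebra_simps)
qed auto

text \<open>A discrete intermediate value argument: the first power whose length reaches
  \<open>R\<close> overshoots by at most one step.\<close>

lemma nat_pow_len_reach:
  assumes "h \<in> carrier G" "0 \<le> R" "R \<le> len (h [^] (n::nat))"
  obtains j :: nat where "j \<le> n" "R \<le> len (h [^] j)" "len (h [^] j) \<le> R + len h"
proof -
  define j where "j = (LEAST j. R \<le> len (h [^] (j::nat)))"
  have j: "R \<le> len (h [^] j)" "j \<le> n"
    unfolding j_def using assms(3) by (rule LeastI, rule Least_le)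
  have "len (h [^] j) \<le> R + len h"
  proof (cases j)
    case 0
    then show ?thesis using len_nonneg[OF assms(1)] assms(2) by simp
  next
    case (Suc i)
    then have "len (h [^] i) < R" using not_less_Least[of i "\<lambda>j. R \<le> len (h [^] (j::nat))"] j_def by simp
    then show ?thesis using len_mult_le[of "h [^] i" h] assms(1) Suc by simp
  qed
  with j show ?thesis using that by blast
qed

text \<open>At distance \<open>len (h [^] i)\<close> from \<one> the paths to \<open>h [^] m\<close>
  and to \<open>k \<otimes> h' [^] n\<close> have not yet parted, so a point
  \<open>k \<otimes> h' [^] j\<close> at about that distance is close to \<open>h [^] i\<close>.
  What counts is that the bound is the same for all \<open>i\<close>.\<close>

lemma axes_fellow_travel:
  assumes h: "loxodromic c h" and h': "loxodromic c h'" and k: "k \<in> carrier G"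
    and unbdd: "\<And>B. \<exists>n m. B < gp (k \<otimes> h' [^] (n::nat)) (h [^] (m::nat))"
  shows "\<exists>j::nat. len (inv (h [^] (i::nat)) \<otimes> (k \<otimes> h' [^] j))
    \<le> len h' + 3 * len k + 2 * (c + 2 * \<delta>) + 4 * \<delta>"
proof -
  have cl: "h \<in> carrier G" "h' \<in> carrier G" using h h' by (auto simp: loxodromic_def)
  define R where "R = len (h [^] i)"
  \<comment> \<open>A Gromov product of this size forces \<open>i \<le> m\<close> and also forces
    \<open>h' [^] n\<close> to reach the length \<open>R\<close>.\<close>
  obtain n m where nm: "real i * len h + len k < gp (k \<otimes> h' [^] (n::nat)) (h [^] (m::nat))"
    using unbdd by blast
  have R: "R \<le> real i * len h" "0 \<le> R" using nat_pow_len_le[of h i] cl len_nonneg by (auto simp: R_def)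
  have "real i * len h < len (h [^] m)"
    using nm gp_le(2)[of "k \<otimes> h' [^] n" "h [^] m"] cl k len_nonneg[of k] by simp
  then have "real i * len h < real m * len h" using nat_pow_len_le[of h m] cl by simp
  then have "i \<le> m" using len_nonneg[of h] cl by (simp add: mult_less_cancel_right)
  then have 1: "R - (c + 2 * \<delta>) \<le> gp (h [^] i) (h [^] m)" using nat_pow_gp[OF h] R_def by simp
  have "0 \<le> c" using h by (simp add: loxodromic_def)
  have "min (gp (h [^] i) (h [^] m)) (gp (h [^] m) (k \<otimes> h' [^] n)) - \<delta> \<le> gp (h [^] i) (k \<otimes> h' [^] n)"
    using gp_hyp cl k by simp
  moreover have "R < gp (h [^] m) (k \<otimes> h' [^] n)"
    using nm gp_sym[of "k \<otimes> h' [^] n" "h [^] m"] cl k R len_nonneg[OF k] by simp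
  ultimately have 2: "R - (c + 2 * \<delta>) - \<delta> \<le> gp (h [^] i) (k \<otimes> h' [^] n)"
    using 1 \<open>0 \<le> c\<close> delta_nonneg by (auto simp: min_def split: if_splits)
  have "R \<le> len (h' [^] n)"
    using nm gp_le(1)[of "k \<otimes> h' [^] n" "h [^] m"] len_mult_le[of k "h' [^] n"] cl k R by simp
  then obtain j where j: "j \<le> n" "R \<le> len (h' [^] j)" "len (h' [^] j) \<le> R + len h'"
    using nat_pow_len_reach[of h' R n] cl R by blast
  have 3: "R - (c + 2 * \<delta>) - len k \<le> gp (k \<otimes> h' [^] n) (k \<otimes> h' [^] j)"
    using nat_pow_gp[OF h' j(1)] gp_mult_left(2)[of k "h' [^] n" "h' [^] j"] gp_sym[of "h' [^] n" "h' [^] j"]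
      j cl k by simp
  have "min (gp (h [^] i) (k \<otimes> h' [^] n)) (gp (k \<otimes> h' [^] n) (k \<otimes> h' [^] j)) - \<delta>
      \<le> gp (h [^] i) (k \<otimes> h' [^] j)"
    using gp_hyp cl k by simp
  then have 4: "R - (c + 2 * \<delta>) - len k - 2 * \<delta> \<le> gp (h [^] i) (k \<otimes> h' [^] j)"
    using 2 3 delta_nonneg len_nonneg[OF k] by (auto simp: min_def split: if_splits)
  have "len (k \<otimes> h' [^] j) \<le> len k + R + len h'"
    using len_mult_le[of k "h' [^] j"] j cl k by simp
  then have "len (inv (h [^] i) \<otimes> (k \<otimes> h' [^] j)) \<le> len h' + 3 * len k + 2 * (c + 2 * \<delta>) + 4 * \<delta>"
    using 4 by (simp add: gp_def R_def field_simps)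
  then show ?thesis ..
qed

text \<open>Properness enters here: the elements \<open>h\<^sup>-\<^sup>i k h'\<^sup>j\<close> of the previous lemma have bounded length, so two
  of them coincide.\<close>

lemma unbounded_imp_nat_pow_eq:
  assumes h: "loxodromic c h" and h': "loxodromic c h'" and k: "k \<in> carrier G"
    and unbdd: "\<And>B. \<exists>n m. B < gp (k \<otimes> h' [^] (n::nat)) (h [^] (m::nat))"
  shows "\<exists>N M. 0 < (N::nat) \<and> h [^] N \<otimes> k = k \<otimes> h' [^] (M::int)"
proof -
  define D where "D = len h' + 3 * len k + 2 * (c + 2 * \<delta>) + 4 * \<delta>"
  have cl: "h \<in> carrier G" "h' \<in> carrier G" using h h' by (auto simp: loxodromic_def)
  obtain J :: "nat \<Rightarrow> nat" where J: "\<And>i::nat. len (inv (h [^] i) \<otimes> (k \<otimes> h' [^] J i)) \<le> D"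
    using axes_fellow_travel[OF assms] unfolding D_def by metis
  have "range (\<lambda>i::nat. inv (h [^] i) \<otimes> (k \<otimes> h' [^] J i)) \<subseteq> {g \<in> carrier G. len g \<le> D}"
    using J cl k by auto
  then have "finite (range (\<lambda>i::nat. inv (h [^] i) \<otimes> (k \<otimes> h' [^] J i)))"
    using finite_len_le finite_subset by blast
  then have "\<not> inj (\<lambda>i::nat. inv (h [^] i) \<otimes> (k \<otimes> h' [^] J i))"
    using finite_imageD infinite_UNIV_nat by blast
  then obtain i i' :: nat where i: "i < i'"
    and eq: "inv (h [^] i) \<otimes> (k \<otimes> h' [^] J i) = inv (h [^] i') \<otimes> (k \<otimes> h' [^] J i')"
    unfolding inj_def by (metis linorder_neqE_nat)
  have "h [^] i' = h [^] (i' - i) \<otimes> h [^] i" using i cl by (simp add: nat_pow_mult)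
  then have "h [^] i' \<otimes> (inv (h [^] i) \<otimes> (k \<otimes> h' [^] J i)) = h [^] (i' - i) \<otimes> (k \<otimes> h' [^] J i)"
    using cl k by (simp add: m_assoc mult_inv_cancel)
  moreover have "h [^] i' \<otimes> (inv (h [^] i') \<otimes> (k \<otimes> h' [^] J i')) = k \<otimes> h' [^] J i'"
    using cl k by (simp add: mult_inv_cancel)
  ultimately have "h [^] (i' - i) \<otimes> (k \<otimes> h' [^] J i) = k \<otimes> h' [^] J i'"
    using eq by simp
  then have "h [^] (i' - i) \<otimes> k = k \<otimes> h' [^] J i' \<otimes> inv (h' [^] J i)"
    using cl k by (metis inv_solve_right m_assoc m_closed nat_pow_closed)
  \<comment> \<open>The sign of \<open>J i' - J i\<close> is unknown, hence the integer exponent on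
    this side.\<close>
  also have "\<dots> = k \<otimes> h' [^] (int (J i') - int (J i))"
    using cl k by (simp add: m_assoc int_pow_diff int_pow_int)
  finally show ?thesis using i by (intro exI[of _ "i' - i"]) auto
qed

lemma int_pow_cases:
  fixes i :: int
  assumes "h \<in> carrier G"
  obtains n :: nat where "0 \<le> i" "i = int n" "h [^] i = h [^] n"
  | n :: nat where "i \<le> 0" "i = - int n" "h [^] i = (inv h) [^] n"
proof (cases "0 \<le> i")
  case True
  then obtain n where "i = int n" by (metis nonneg_int_cases)
  then show ?thesis using that(1)[of n] by (simp add: int_pow_int)
next
  case False
  then obtain n where "i = - int n" by (metis nonpos_int_cases linear)
  then show ?thesis using that(2)[of n] assms by (simp add: int_pow_neg_int nat_pow_inv)
qed

lemma int_pow_len_ge: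
  fixes i :: int
  assumes "loxodromic c h"
  shows "\<bar>i\<bar> \<le> len (h [^] i)"
proof -
  have "h \<in> carrier G" using assms by (simp add: loxodromic_def)
  then show ?thesis
    using nat_pow_len_ge[OF assms] nat_pow_len_ge[OF loxodromic_inv[OF assms]]
    by (cases rule: int_pow_cases[OF \<open>h \<in> carrier G\<close>, of i]) auto
qed

lemma int_pow_gp_inv:
  fixes i :: int
  assumes "loxodromic c h"
  shows "gp (inv (h [^] i)) (h [^] i) \<le> c + 2 * \<delta>"
proof -
  have "h \<in> carrier G" using assms by (simp add: loxodromic_def)
  then show ?thesis
    using nat_pow_gp_inv[OF assms] nat_pow_gp_inv[OF loxodromic_inv[OF assms]]
    by (cases rule: int_pow_cases[OF \<open>h \<in> carrier G\<close>, of i]) auto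
qed

lemma int_pow_gp_same_sign:
  fixes i j :: int
  assumes h: "loxodromic c h" and "0 \<le> i \<and> 0 \<le> j \<or> i \<le> 0 \<and> j \<le> 0"
  shows "min (len (h [^] i)) (len (h [^] j)) - (c + 2 * \<delta>) \<le> gp (h [^] i) (h [^] j)"
proof -
  have cl: "h \<in> carrier G" using assms by (simp add: loxodromic_def)
  have *: "min (len (h' [^] n)) (len (h' [^] m)) - (c + 2 * \<delta>) \<le> gp (h' [^] n) (h' [^] m)"
    if "loxodromic c h'" for h' and n m :: nat
  proof -
    have "h' \<in> carrier G" using that by (simp add: loxodromic_def)
    then have "gp (h' [^] n) (h' [^] m) = gp (h' [^] m) (h' [^] n)" using gp_sym by simp
    then show ?thesis
      using nat_pow_gp[OF that, of n m] nat_pow_gp[OF that, of m n]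
      by (cases "n \<le> m") (simp_all add: min_def)
  qed
  consider n m where "i = int n" "j = int m" | n m where "i = - int n" "j = - int m"
    using assms(2) by (metis nonneg_int_cases nonpos_int_cases)
  then show ?thesis
  proof cases
    case 1
    then show ?thesis using *[OF h] by (simp add: int_pow_int)
  next
    case 2
    then show ?thesis
      using *[OF loxodromic_inv[OF h]] cl by (simp add: int_pow_neg_int nat_pow_inv)
  qed
qed

section \<open>Schottky pairs\<close>

lemma nat_pow_eq_conj_power:
  assumes "h \<in> carrier G" "k \<in> carrier G" "h [^] (N::nat) \<otimes> k = k \<otimes> h [^] (M::int)"
  shows "h [^] (N * l) \<otimes> k = k \<otimes> h [^] (M * int l)"
proof (induction l)
  case (Suc l)
  have "h [^] (N * Suc l) \<otimes> k = h [^] N \<otimes> (h [^] (N * l) \<otimes> k)"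
    using assms by (simp add: nat_pow_mult m_assoc[symmetric])
  also have "\<dots> = (h [^] N \<otimes> k) \<otimes> h [^] (M * int l)"
    using assms(1,2) Suc by (simp add: m_assoc)
  also have "\<dots> = k \<otimes> (h [^] M \<otimes> h [^] (M * int l))"
    using assms by (simp add: m_assoc)
  also have "\<dots> = k \<otimes> h [^] (M * int (Suc l))"
    using assms by (simp add: int_pow_mult[symmetric] algebra_simps)
  finally show ?case .
qed (use assms in simp)

text \<open>Since \<open>k\<close> conjugates a power of \<open>h\<close> to a power of \<open>h\<close>, it nearly preserves both ends of the axis
  of \<open>h\<close>, hence moves \<open>\<one>\<close> to a point near the axis. The bound must not depend on \<open>k\<close>.\<close>

lemma near_axis:
  assumes h: "loxodromic c h" and k: "k \<in> carrier G"
    and N: "0 < N" and eq: "h [^] (N::nat) \<otimes> k = k \<otimes> h [^] (M::int)"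
  shows "\<exists>i::int. len (inv (h [^] i) \<otimes> k) \<le> len h + 3 * (c + 2 * \<delta>) + 4 * \<delta>"
proof -
  have cl: "h \<in> carrier G" and c: "0 \<le> c" using h by (auto simp: loxodromic_def)
  define C where "C = c + 2 * \<delta>"
  have C: "0 \<le> C" using c delta_nonneg by (simp add: C_def)
  \<comment> \<open>\<open>l\<close> makes the power \<open>p\<close> long compared with
    \<open>k\<close>. It depends on \<open>k\<close>, but enters only the auxiliary points and not
    the final bound.\<close>
  obtain l :: nat where l: "3 * len k + C + 2 * \<delta> < real l" using reals_Archimedean2 by blast
  define P where "P = N * l"
  define p where "p = h [^] P"
  define a where "a = h [^] (M * int l)"
  have pc: "p \<in> carrier G" "a \<in> carrier G" using cl by (auto simp: p_def a_def)
  have pk: "p \<otimes> k = k \<otimes> a"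
    unfolding p_def a_def P_def using nat_pow_eq_conj_power[OF cl k eq] .
  have "l \<le> P" using N by (simp add: P_def)
  then have "real l \<le> len p" using nat_pow_len_ge[OF h, of P] by (simp add: p_def)
  moreover have "len p - len k \<le> len (p \<otimes> k)" using len_mult_ge(2)[OF pc(1) k] .
  moreover have "len (p \<otimes> k) \<le> len k + len a" using len_mult_le[OF k pc(2)] pk by simp
  ultimately have len_a: "C + 2 * \<delta> < len a - len k" using l by simp
  have kp: "inv k \<otimes> p = a \<otimes> inv k"
    using pk k pc by (metis inv_closed inv_solve_left inv_solve_right m_assoc m_closed)
  have kq: "inv k \<otimes> inv p = inv a \<otimes> inv k"
    using pk k pc by (metis inv_mult_group)
  have 1: "C + 2 * \<delta> < gp a (inv k \<otimes> p)"
    using gp_mult_self[of a "inv k"] gp_le(2)[of "inv a" "inv k"] len_a k pc by (simp add: kp)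
  have 2: "C + 2 * \<delta> < gp (inv a) (inv k \<otimes> inv p)"
    using gp_mult_self[of "inv a" "inv k"] gp_le(2)[of "a" "inv k"] len_a k pc by (simp add: kq)
  have 3: "gp (inv a) a \<le> C" using int_pow_gp_inv[OF h] by (simp add: a_def C_def)
  have 4: "gp (inv a) (inv k \<otimes> p) \<le> C + \<delta>"
    using gp_cases[of "inv a" "inv k \<otimes> p" a C] 1 3 gp_sym[of a "inv k \<otimes> p"] delta_nonneg k pc by simp
  \<comment> \<open>\<open>inv k \<otimes> p\<close> and \<open>inv k \<otimes> inv p\<close> follow
    \<open>a\<close> and \<open>inv a\<close>, which diverge. As the second one is the inverse of
    \<open>p \<otimes> k\<close>, the path from \<one> through \<open>p \<otimes> k\<close> to
    \<open>h [^] (P + P)\<close> does not backtrack there; hence \<open>p \<otimes> k\<close> is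
    near the axis, and translating by \<open>inv p\<close> brings the same for
    \<open>k\<close>.\<close>
  have 5: "gp (inv k \<otimes> p) (inv k \<otimes> inv p) \<le> C + 2 * \<delta>"
    using gp_cases[of "inv k \<otimes> p" "inv k \<otimes> inv p" "inv a" "C + \<delta>"] 2 4
      gp_sym[of "inv a" "inv k \<otimes> inv p"] gp_sym[of "inv a" "inv k \<otimes> p"] k pc by simp
  define y where "y = p \<otimes> k"
  have y: "y \<in> carrier G" using pc k by (simp add: y_def)
  have inv_y: "inv y = inv k \<otimes> inv p" using pc k by (simp add: y_def inv_mult_group)
  have pp: "h [^] (P + P) = y \<otimes> (inv k \<otimes> p)"
    using pc k cl nat_pow_mult[of h P P] by (simp add: y_def m_assoc p_def mult_inv_cancel)
  \<comment> \<open>The maximum covers a \<open>y\<close> so short that the estimate below it is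
    void; \<open>nat_pow_len_reach\<close> asks for a nonnegative target.\<close>
  define R where "R = max 0 (len y - C - 2 * \<delta>)"
  have "len y - (C + 2 * \<delta>) \<le> gp y (h [^] (P + P))"
    using gp_mult_self[of y "inv k \<otimes> p"] 5 gp_sym[of "inv k \<otimes> p" "inv k \<otimes> inv p"] y k pc
    by (simp add: pp inv_y)
  then have R: "R \<le> gp y (h [^] (P + P))" using gp_nonneg[of y "h [^] (P + P)"] y cl by (simp add: R_def)
  then have "R \<le> len (h [^] (P + P))" using gp_le(2)[of y "h [^] (P + P)"] y cl by simp
  moreover have "0 \<le> R" by (simp add: R_def)
  ultimately obtain j :: nat where j: "j \<le> P + P" "R \<le> len (h [^] j)" "len (h [^] j) \<le> R + len h"
    using nat_pow_len_reach[OF cl] by metis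
  have "R - C \<le> gp (h [^] (P + P)) (h [^] j)"
    using nat_pow_gp[OF h j(1)] j(2) gp_sym[of "h [^] j" "h [^] (P + P)"] cl by (simp add: C_def)
  then have 6: "R - C - \<delta> \<le> gp y (h [^] j)"
    using gp_hyp[of y "h [^] (P + P)" "h [^] j"] R C y cl by (auto simp: min_def split: if_splits)
  have "len (inv (h [^] j) \<otimes> y) = len (h [^] j) + len y - 2 * gp y (h [^] j)"
    using gp_sym[of y "h [^] j"] y cl by (simp add: gp_def field_simps)
  also have "\<dots> \<le> len h + 3 * C + 4 * \<delta>"
  proof (cases "R = 0")
    case True
    then have "len y \<le> C + 2 * \<delta>" by (simp add: R_def)
    moreover have "0 \<le> gp y (h [^] j)" using gp_nonneg y cl by simp
    ultimately show ?thesis using True j C delta_nonneg by simp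
  next
    case False
    then have "len y \<le> R + C + 2 * \<delta>" by (simp add: R_def max_def split: if_splits)
    then show ?thesis using 6 j by simp
  qed
  finally have *: "len (inv (h [^] j) \<otimes> y) \<le> len h + 3 * C + 4 * \<delta>" .
  have "h [^] (int j - int P) = h [^] j \<otimes> inv p"
    using cl by (simp add: int_pow_diff int_pow_int p_def)
  also have "\<dots> = inv p \<otimes> h [^] j"
    using cl by (simp add: p_def) (metis int_pow_int int_pow_mult int_pow_neg add.commute cl)
  finally have "inv (h [^] (int j - int P)) \<otimes> k = inv (h [^] j) \<otimes> y"
    using cl pc k by (simp add: inv_mult_group m_assoc y_def)
  then show ?thesis using * by (metis C_def)
qed

text \<open>The trace that three distinct limit points leave on the group: \<open>C\<close> stays
  fixed while the lengths grow, so the three elements point in three separate directions.\<close>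

definition non_elementary_length :: "real \<Rightarrow> bool" where
  "non_elementary_length C \<longleftrightarrow> (\<forall>R. \<exists>u\<in>carrier G. \<exists>v\<in>carrier G. \<exists>w\<in>carrier G.
     R \<le> len u \<and> R \<le> len v \<and> R \<le> len w \<and> gp u v \<le> C \<and> gp v w \<le> C \<and> gp u w \<le> C)"

text \<open>One of \<open>u\<close>, \<open>v\<close>, \<open>u v\<close> is loxodromic.\<close>

lemma loxodromic_exists_aux:
  assumes uv: "u \<in> carrier G" "v \<in> carrier G" and "gp u v \<le> C" "0 \<le> C"
    and big: "3 * C + 20 * \<delta> + 2 \<le> len u" "3 * C + 20 * \<delta> + 2 \<le> len v"
  shows "\<exists>h c. loxodromic c h"
proof -
  consider "gp (inv u) u \<le> C + 2 * \<delta>" | "gp (inv v) v \<le> C + 2 * \<delta>"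
    | "C + 2 * \<delta> < gp (inv u) u" "C + 2 * \<delta> < gp (inv v) v" by linarith
  then show ?thesis
  proof cases
    case 1
    then have "loxodromic (C + 2 * \<delta>) u" using assms delta_nonneg by (simp add: loxodromic_def)
    then show ?thesis by blast
  next
    case 2
    then have "loxodromic (C + 2 * \<delta>) v" using assms delta_nonneg by (simp add: loxodromic_def)
    then show ?thesis by blast
  next
    \<comment> \<open>Each of \<open>u\<close>, \<open>v\<close> follows its own inverse for a
      while. The product \<open>u \<otimes> v\<close> starts like \<open>u\<close> and its inverse
      starts like \<open>inv v\<close>; since \<open>u\<close> diverges from \<open>v\<close>, it
      also diverges from \<open>inv v\<close>.\<close>
    case 3
    have s: "gp v u = gp u v" using gp_sym uv by simp
    have a: "gp v (inv u) \<le> C + \<delta>"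
      using gp_cases[of v "inv u" u C] 3 assms s delta_nonneg by simp
    have b: "gp u (inv v) \<le> C + \<delta>"
      using gp_cases[of u "inv v" v C] 3 assms delta_nonneg by simp
    define h where "h = u \<otimes> v"
    have h: "h \<in> carrier G" "inv h = inv v \<otimes> inv u" using uv by (auto simp: h_def inv_mult_group)
    have d: "len u - C - \<delta> \<le> gp h u"
      using gp_mult_self[of u v] a gp_sym[of v "inv u"] gp_sym[of h u] uv h by (simp add: h_def)
    have e: "len v - C - \<delta> \<le> gp (inv h) (inv v)"
      using gp_mult_self[of "inv v" "inv u"] a gp_sym[of "inv h" "inv v"] uv h by simp
    have f: "gp (inv v) h \<le> C + 2 * \<delta>"
      using gp_cases[of "inv v" h u "C + \<delta>"] b d gp_sym[of u "inv v"] uv h big \<open>0 \<le> C\<close> delta_nonneg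
      by simp
    have "gp h (inv h) \<le> C + 3 * \<delta>"
      using gp_cases[of h "inv h" "inv v" "C + 2 * \<delta>"] e f gp_sym[of h "inv v"] uv h big \<open>0 \<le> C\<close> delta_nonneg
      by simp
    moreover have "len h = len u + len v - 2 * gp v (inv u)"
      using len_mult_eq[OF uv] gp_sym[of v "inv u"] uv by (simp add: h_def)
    ultimately have "loxodromic (C + 3 * \<delta>) h"
      using a big h uv gp_sym[of h "inv h"] \<open>0 \<le> C\<close> delta_nonneg by (simp add: loxodromic_def)
    then show ?thesis by blast
  qed
qed

lemma loxodromic_exists:
  assumes "non_elementary_length C" "0 \<le> C"
  shows "\<exists>h c. loxodromic c h"
  using assms loxodromic_exists_aux[of _ _ C] unfolding non_elementary_length_def by metis

lemma gp_near:
  assumes "u \<in> carrier G" "v \<in> carrier G" "x \<in> carrier G" "y \<in> carrier G"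
    and "len (inv x \<otimes> u) \<le> D" "len (inv y \<otimes> v) \<le> D"
  shows "gp x y - 2 * D \<le> gp u v" "len u - D \<le> len x"
proof -
  have u: "x \<otimes> (inv x \<otimes> u) = u" "y \<otimes> (inv y \<otimes> v) = v"
    using assms by (simp_all add: mult_inv_cancel)
  have "gp x y - D \<le> gp u y"
    using gp_mult_right(2)[of "inv x \<otimes> u" x y] assms u by simp
  moreover have "gp v u \<ge> gp y u - D"
    using gp_mult_right(2)[of "inv y \<otimes> v" y u] assms u by simp
  ultimately show "gp x y - 2 * D \<le> gp u v" using gp_sym[of u y] gp_sym[of u v] assms by simp
  show "len u - D \<le> len x" using len_mult_le[of x "inv x \<otimes> u"] assms u by simp
qed

text \<open>Otherwise every element would be near the axis of \<open>h\<close>, which has only two ends.\<close>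

lemma independent_exists:
  assumes ne: "non_elementary_length C" and h: "loxodromic c h"
  shows "\<exists>k\<in>carrier G. \<exists>B. \<forall>(i::int) (j::int). gp (k \<otimes> h [^] i) (h [^] j) \<le> B"
proof (rule ccontr)
  assume *: "\<not> ?thesis"
  have cl: "h \<in> carrier G" and c: "0 \<le> c" using h by (auto simp: loxodromic_def)
  define D where "D = len h + 3 * (c + 2 * \<delta>) + 4 * \<delta>"
  have near: "\<exists>i::int. len (inv (h [^] i) \<otimes> k) \<le> D" if k: "k \<in> carrier G" for k
  proof -
    \<comment> \<open>The exponents in the statement are integers, so there are four pairs of half
      axes; \<open>h1\<close> and \<open>h2\<close> choose one, and unboundedness along any of them
      gives the same kind of relation for \<open>h\<close>.\<close>
    have unb: "\<exists>N M. 0 < (N::nat) \<and> h [^] N \<otimes> k = k \<otimes> h [^] (M::int)"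
      if unb: "\<And>B. \<exists>n m. B < gp (k \<otimes> h2 [^] (n::nat)) (h1 [^] (m::nat))"
        and h12: "h1 = h \<or> h1 = inv h" "h2 = h \<or> h2 = inv h" for h1 h2
    proof -
      have "loxodromic c h1" "loxodromic c h2" using h12 h loxodromic_inv by auto
      then obtain N M where N: "0 < (N::nat)" "h1 [^] N \<otimes> k = k \<otimes> h2 [^] (M::int)"
        using unbounded_imp_nat_pow_eq[OF _ _ k unb] by blast
      obtain M' where M': "h2 [^] M = h [^] (M'::int)"
        using h12(2) cl by (metis int_pow_inv int_pow_neg)
      show ?thesis
      proof (cases "h1 = h")
        case True
        then show ?thesis using N M' by metis
      next
        case False
        then have "inv (h [^] N) \<otimes> k = k \<otimes> h [^] M'" using N M' h12(1) cl by (simp add: nat_pow_inv)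
        then have "k = h [^] N \<otimes> (k \<otimes> h [^] M')" using cl k by (metis inv_closed inv_solve_left' m_closed nat_pow_closed int_pow_closed inv_inv inv_solve_left)
        then have "k = (h [^] N \<otimes> k) \<otimes> h [^] M'" using cl k by (simp add: m_assoc)
        then have "h [^] N \<otimes> k = k \<otimes> h [^] (- M')"
          using cl k by (metis int_pow_closed int_pow_neg inv_solve_right m_closed nat_pow_closed)
        then show ?thesis using N by blast
      qed
    qed
    have "\<exists>N M. 0 < (N::nat) \<and> h [^] N \<otimes> k = k \<otimes> h [^] (M::int)"
    proof (rule ccontr)
      assume no: "\<not> ?thesis"
      have "\<exists>B. \<forall>n m. gp (k \<otimes> h2 [^] (n::nat)) (h1 [^] (m::nat)) \<le> B"
        if "h1 = h \<or> h1 = inv h" "h2 = h \<or> h2 = inv h" for h1 h2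
        using unb[OF _ that] no by (meson not_le)
      then obtain B where B: "\<And>h1 h2 n m. h1 = h \<or> h1 = inv h \<Longrightarrow> h2 = h \<or> h2 = inv h \<Longrightarrow>
          gp (k \<otimes> h2 [^] (n::nat)) (h1 [^] (m::nat)) \<le> B h1 h2"
        by metis
      define B0 where "B0 = max (max (B h h) (B h (inv h))) (max (B (inv h) h) (B (inv h) (inv h)))"
      have "gp (k \<otimes> h [^] i) (h [^] j) \<le> B0" for i j :: int
      proof -
        obtain h2 n where "h [^] i = h2 [^] (n::nat)" "h2 = h \<or> h2 = inv h"
          using int_pow_cases[OF cl] by metis
        moreover obtain h1 m where "h [^] j = h1 [^] (m::nat)" "h1 = h \<or> h1 = inv h"
          using int_pow_cases[OF cl] by metis
        ultimately show ?thesis using B[of h1 h2 n m] by (auto simp: B0_def)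
      qed
      then show False using * k by blast
    qed
    then show ?thesis using near_axis[OF h k] unfolding D_def by blast
  qed
  \<comment> \<open>Chosen so that \<open>(R - D) - (c + 2 * \<delta>) - 2 * D = C + 1\<close>:
    powers with exponents of the same sign would force \<open>gp x y\<close> above
    \<open>C\<close>.\<close>
  define R where "R = C + (c + 2 * \<delta>) + 3 * D + 1"
  obtain u v w where uvw: "u \<in> carrier G" "v \<in> carrier G" "w \<in> carrier G"
    "R \<le> len u" "R \<le> len v" "R \<le> len w" "gp u v \<le> C" "gp v w \<le> C" "gp u w \<le> C"
    using ne unfolding non_elementary_length_def by blast
  obtain i j l :: int where ijl: "len (inv (h [^] i) \<otimes> u) \<le> D" "len (inv (h [^] j) \<otimes> v) \<le> D"
    "len (inv (h [^] l) \<otimes> w) \<le> D"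
    using near uvw by metis
  have bad: "\<not> (0 \<le> i \<and> 0 \<le> j \<or> i \<le> 0 \<and> j \<le> 0)"
    if "x \<in> carrier G" "y \<in> carrier G" "R \<le> len x" "R \<le> len y" "gp x y \<le> C"
      "len (inv (h [^] i) \<otimes> x) \<le> D" "len (inv (h [^] j) \<otimes> y) \<le> D" for x y and i j :: int
  proof
    assume "0 \<le> i \<and> 0 \<le> j \<or> i \<le> 0 \<and> j \<le> 0"
    then have 1: "min (len (h [^] i)) (len (h [^] j)) - (c + 2 * \<delta>) \<le> gp (h [^] i) (h [^] j)"
      using int_pow_gp_same_sign[OF h] by blast
    have "gp (h [^] i) (h [^] j) - 2 * D \<le> gp x y" "len x - D \<le> len (h [^] i)" "len y - D \<le> len (h [^] j)"
      using gp_near[of x y "h [^] i" "h [^] j" D] gp_near(2)[of y x "h [^] j" "h [^] i" D] that cl by auto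
    then show False using 1 that(3-5) by (auto simp: R_def min_def split: if_splits)
  qed
  \<comment> \<open>Among three integers, two are both nonnegative or both nonpositive.\<close>
  show False
    using bad[of u v i j] bad[of v w j l] bad[of u w i l] uvw ijl by linarith
qed

text \<open>The witnesses are \<open>h [^] n\<close> and its conjugate by \<open>k\<close>.
  Conjugation raises the Gromov product of a power with its inverse by at most
  \<open>3 * len k\<close>, and the mixed products are at most \<open>B + len k\<close> for all
  exponents of either sign; hence \<open>c'\<close> is independent of \<open>n\<close>, which is
  chosen last.\<close>

lemma schottky_pair_exists:
  assumes ne: "non_elementary_length C" "0 \<le> C"
  shows "\<exists>c\<ge>0. \<forall>R. \<exists>v1\<in>carrier G. \<exists>v2\<in>carrier G. R < len v1 \<and> R < len v2 \<and>
    gp (inv v1) v1 \<le> c \<and> gp (inv v2) v2 \<le> c \<and> gp v1 v2 \<le> c \<and>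
    gp (inv v1) v2 \<le> c \<and> gp (inv v2) v1 \<le> c \<and> gp (inv v1) (inv v2) \<le> c"
proof -
  obtain h c where h: "loxodromic c h" using loxodromic_exists[OF assms] by blast
  obtain k B where k: "k \<in> carrier G" and B: "\<And>(i::int) (j::int). gp (k \<otimes> h [^] i) (h [^] j) \<le> B"
    using independent_exists[OF ne(1) h] by blast
  have cl: "h \<in> carrier G" and c: "0 \<le> c" using h by (auto simp: loxodromic_def)
  define c' where "c' = max (c + 2 * \<delta> + 3 * len k) (B + len k)"
  have nn: "0 \<le> len k" using len_nonneg k by simp
  define v where "v i = k \<otimes> h [^] (i::int) \<otimes> inv k" for i :: int
  have v: "v i \<in> carrier G" "inv (v i) = v (- i)" for i
    using k cl by (auto simp: v_def inv_mult_group m_assoc int_pow_neg)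
  have vh: "gp (v i) (h [^] j) \<le> c'" for i j :: int
    using gp_mult_right(1)[of "inv k" "k \<otimes> h [^] i" "h [^] j"] B[of i j] k cl by (simp add: v_def c'_def)
  then have hv: "gp (h [^] j) (v i) \<le> c'" for i j :: int
    using gp_sym[of "h [^] j" "v i"] v cl by simp
  have hh: "gp (inv (h [^] i)) (h [^] i) \<le> c'" for i :: int
    using int_pow_gp_inv[OF h, of i] nn by (simp add: c'_def)
  have vv: "gp (inv (v i)) (v i) \<le> c'" for i
  proof -
    define a where "a = h [^] i"
    have a: "a \<in> carrier G" using cl by (simp add: a_def)
    have vi: "v i = k \<otimes> a \<otimes> inv k" by (simp add: v_def a_def)
    have "v i \<otimes> v i = k \<otimes> (a \<otimes> a) \<otimes> inv k"
      using a k by (simp add: vi m_assoc mult_inv_cancel)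
    then have "len (a \<otimes> a) \<le> len (v i \<otimes> v i) + 2 * len k"
      using len_mult_ge(2)[of "k \<otimes> (a \<otimes> a)" "inv k"] len_mult_ge(1)[of k "a \<otimes> a"] a k by simp
    moreover have "len (v i) \<le> len a + 2 * len k"
      using len_mult_le[of "k \<otimes> a" "inv k"] len_mult_le[of k a] a k by (simp add: vi)
    ultimately have "gp (inv (v i)) (v i) \<le> gp (inv a) a + 3 * len k"
      using v(1)[of i] a by (simp add: gp_def field_simps)
    then show ?thesis using int_pow_gp_inv[OF h, of i] by (simp add: a_def c'_def)
  qed
  have "0 \<le> c'" using c delta_nonneg nn by (simp add: c'_def)
  moreover have "\<exists>v1\<in>carrier G. \<exists>v2\<in>carrier G. R < len v1 \<and> R < len v2 \<and>
    gp (inv v1) v1 \<le> c' \<and> gp (inv v2) v2 \<le> c' \<and> gp v1 v2 \<le> c' \<and>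
    gp (inv v1) v2 \<le> c' \<and> gp (inv v2) v1 \<le> c' \<and> gp (inv v1) (inv v2) \<le> c'" for R
  proof -
    obtain n :: nat where n: "R + 2 * len k < real n" using reals_Archimedean2 by blast
    have 1: "real n \<le> len (h [^] int n)" using int_pow_len_ge[OF h, of "int n"] by simp
    have 2: "len (h [^] int n) - 2 * len k \<le> len (v (int n))"
      using len_mult_ge(2)[of "k \<otimes> h [^] int n" "inv k"] len_mult_ge(1)[of k "h [^] int n"] cl k
      by (simp add: v_def)
    have 3: "inv (h [^] int n) = h [^] (- int n)" using cl by (simp add: int_pow_neg)
    show ?thesis
    proof (intro bexI conjI)
      show "R < len (h [^] int n)" "R < len (v (int n))" using n nn 1 2 by linarith+
      show "gp (inv (h [^] int n)) (h [^] int n) \<le> c'" by (rule hh)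
      show "gp (inv (v (int n))) (v (int n)) \<le> c'" by (rule vv)
      show "gp (h [^] int n) (v (int n)) \<le> c'" by (rule hv)
      show "gp (inv (h [^] int n)) (v (int n)) \<le> c'" unfolding 3 by (rule hv)
      show "gp (inv (v (int n))) (h [^] int n) \<le> c'" unfolding v(2) by (rule vh)
      show "gp (inv (h [^] int n)) (inv (v (int n))) \<le> c'" unfolding v(2) 3 by (rule hv)
    qed (use cl v in auto)
  qed
  ultimately show ?thesis by blast
qed

section \<open>Exponential series\<close>

text \<open>Convergence with an explicit bound, expressed by finite partial sums, so that all
  estimates concern finite sums of reals.\<close>

definition series_le :: "'a set \<Rightarrow> real \<Rightarrow> real \<Rightarrow> bool" where
  "series_le A s B \<longleftrightarrow> (\<forall>T. finite T \<and> T \<subseteq> A \<longrightarrow> (\<Sum>g\<in>T. exp (- s * len g)) \<le> B)"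

lemma series_leI:
  "(\<And>T. finite T \<Longrightarrow> T \<subseteq> A \<Longrightarrow> (\<Sum>g\<in>T. exp (- s * len g)) \<le> B) \<Longrightarrow> series_le A s B"
  by (simp add: series_le_def)

lemma series_leD:
  "series_le A s B \<Longrightarrow> finite T \<Longrightarrow> T \<subseteq> A \<Longrightarrow> (\<Sum>g\<in>T. exp (- s * len g)) \<le> B"
  by (simp add: series_le_def)

lemma series_le_nonneg: "series_le A s B \<Longrightarrow> 0 \<le> B"
  using series_leD[of A s B "{}"] by simp

lemma series_le_mono: "series_le A s B \<Longrightarrow> A' \<subseteq> A \<Longrightarrow> B \<le> B' \<Longrightarrow> series_le A' s B'"
  unfolding series_le_def by (meson order_trans)

lemma series_le_finite: "finite A \<Longrightarrow> series_le A s (\<Sum>g\<in>A. exp (- s * len g))"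
  by (intro series_leI sum_mono2) auto

lemma series_le_exponent_mono:
  assumes "A \<subseteq> carrier G" "series_le A s B" "s \<le> s'"
  shows "series_le A s' B"
proof (rule series_leI)
  fix T assume T: "finite T" "T \<subseteq> A"
  have "(\<Sum>g\<in>T. exp (- s' * len g)) \<le> (\<Sum>g\<in>T. exp (- s * len g))"
    using T assms(1,3) by (intro sum_mono) (auto intro!: mult_right_mono len_nonneg)
  also have "\<dots> \<le> B" using series_leD[OF assms(2) T] .
  finally show "(\<Sum>g\<in>T. exp (- s' * len g)) \<le> B" .
qed

lemma series_le_Un:
  assumes "series_le A s a" "series_le B s b"
  shows "series_le (A \<union> B) s (a + b)"
proof (rule series_leI)
  fix T assume T: "finite T" "T \<subseteq> A \<union> B"
  have "(\<Sum>g\<in>T. exp (- s * len g)) = (\<Sum>g\<in>T \<inter> A. exp (- s * len g)) + (\<Sum>g\<in>T - A. exp (- s * len g))"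
    using T(1) by (subst sum.union_disjoint[symmetric]) (auto intro!: sum.cong)
  also have "\<dots> \<le> a + b"
    using T by (intro add_mono series_leD[OF assms(1)] series_leD[OF assms(2)]) auto
  finally show "(\<Sum>g\<in>T. exp (- s * len g)) \<le> a + b" .
qed

lemma series_le_UN_less:
  fixes n :: nat
  assumes "\<And>k. series_le (A k) s (f k)"
  shows "series_le (\<Union>k<n. A k) s (\<Sum>k<n. f k)"
proof (induction n)
  case 0
  then show ?case by (auto intro!: series_leI)
next
  case (Suc n)
  then show ?case using series_le_Un[OF Suc assms[of n]] by (simp add: lessThan_Suc Un_commute add.commute)
qed

lemma series_le_UN:
  assumes "\<And>k. series_le (A k) s (f k)" "summable f"
  shows "series_le (\<Union>k. A k) s (suminf f)"
proof (rule series_leI)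
  fix T assume T: "finite T" "T \<subseteq> (\<Union>k. A k)"
  then have "\<forall>g\<in>T. \<exists>k. g \<in> A k" by blast
  then obtain K where K: "\<And>g. g \<in> T \<Longrightarrow> g \<in> A (K g)" by metis
  obtain n where n: "\<And>g. g \<in> T \<Longrightarrow> K g < n"
    using finite_nat_bounded[of "K ` T"] T(1) by auto
  then have "T \<subseteq> (\<Union>k<n. A k)" using K by fastforce
  then have "(\<Sum>g\<in>T. exp (- s * len g)) \<le> (\<Sum>k<n. f k)"
    using series_leD[OF series_le_UN_less[of A s f n] T(1)] assms(1) by blast
  also have "\<dots> \<le> suminf f"
    using assms series_le_nonneg by (intro sum_le_suminf) auto
  finally show "(\<Sum>g\<in>T. exp (- s * len g)) \<le> suminf f" .
qed

text \<open>An element with several factorizations is counted once on the left and once per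
  factorization on the right, and each pair loses at most the factor
  \<open>exp (c * s)\<close>.\<close>

lemma series_le_mult:
  assumes A: "series_le A s a" and B: "series_le B s b" and "0 \<le> s"
    and len: "\<And>g h. g \<in> A \<Longrightarrow> h \<in> B \<Longrightarrow> len g + len h - c \<le> len (g \<otimes> h)"
  shows "series_le ((\<lambda>(g, h). g \<otimes> h) ` (A \<times> B)) s (exp (c * s) * a * b)"
proof (rule series_leI)
  fix T assume T: "finite T" "T \<subseteq> (\<lambda>(g, h). g \<otimes> h) ` (A \<times> B)"
  then obtain U where U: "U \<subseteq> A \<times> B" "finite U" "T = (\<lambda>(g, h). g \<otimes> h) ` U"
    by (meson finite_subset_image)
  define V where "V = fst ` U \<times> snd ` U"
  have V: "finite (fst ` U)" "finite (snd ` U)" "fst ` U \<subseteq> A" "snd ` U \<subseteq> B" "U \<subseteq> V" "finite V"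
    using U by (auto simp: V_def image_iff) force+
  have "(\<Sum>g\<in>T. exp (- s * len g)) \<le> (\<Sum>p\<in>U. exp (- s * len (case p of (g, h) \<Rightarrow> g \<otimes> h)))"
    unfolding U(3) using sum_image_le[OF U(2), of "\<lambda>g. exp (- s * len g)" "\<lambda>(g, h). g \<otimes> h"] by (simp add: comp_def)
  also have "\<dots> \<le> (\<Sum>p\<in>V. exp (- s * len (case p of (g, h) \<Rightarrow> g \<otimes> h)))"
    using V by (intro sum_mono2) auto
  also have "\<dots> \<le> (\<Sum>p\<in>V. exp (c * s) * (exp (- s * len (fst p)) * exp (- s * len (snd p))))"
  proof (rule sum_mono)
    fix p assume "p \<in> V"
    then have "fst p \<in> A" "snd p \<in> B" using V by (auto simp: V_def)
    then obtain g h where p: "p = (g, h)" "g \<in> A" "h \<in> B" by (cases p) auto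
    have "s * (len g + len h - c) \<le> s * len (g \<otimes> h)"
      using len p \<open>0 \<le> s\<close> by (intro mult_left_mono) auto
    then show "exp (- s * len (case p of (g, h) \<Rightarrow> g \<otimes> h))
        \<le> exp (c * s) * (exp (- s * len (fst p)) * exp (- s * len (snd p)))"
      by (simp add: p exp_add[symmetric] algebra_simps)
  qed
  also have "\<dots> = exp (c * s) * ((\<Sum>g\<in>fst ` U. exp (- s * len g)) * (\<Sum>h\<in>snd ` U. exp (- s * len h)))"
  proof -
    have "(\<Sum>p\<in>X \<times> Y. f (fst p) * g (snd p)) = sum f X * sum g Y"
      for X Y :: "'a set" and f g :: "'a \<Rightarrow> real"
      by (simp add: sum_product sum.cartesian_product case_prod_beta)
    from this[of "\<lambda>g. exp (- s * len g)" "\<lambda>g. exp (- s * len g)"] show ?thesis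
      by (simp only: V_def sum_distrib_left[symmetric])
  qed
  also have "\<dots> \<le> exp (c * s) * (a * b)"
    using V series_le_nonneg[OF A] by (intro mult_left_mono mult_mono series_leD[OF A] series_leD[OF B] sum_nonneg) auto
  finally show "(\<Sum>g\<in>T. exp (- s * len g)) \<le> exp (c * s) * a * b" by (simp add: mult.assoc)
qed

lemma series_le_convex:
  assumes "series_le A s a" "series_le A t b" "0 \<le> \<theta>" "\<theta> \<le> 1"
  shows "series_le A (\<theta> * s + (1 - \<theta>) * t) (\<theta> * a + (1 - \<theta>) * b)"
proof (rule series_leI)
  fix T assume T: "finite T" "T \<subseteq> A"
  have "(\<Sum>g\<in>T. exp (- (\<theta> * s + (1 - \<theta>) * t) * len g))
      \<le> (\<Sum>g\<in>T. \<theta> * exp (- s * len g) + (1 - \<theta>) * exp (- t * len g))"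
  proof (rule sum_mono)
    fix g
    have "exp ((1 - (1 - \<theta>)) *\<^sub>R (- s * len g) + (1 - \<theta>) *\<^sub>R (- t * len g))
        \<le> (1 - (1 - \<theta>)) * exp (- s * len g) + (1 - \<theta>) * exp (- t * len g)"
      using assms(3,4) by (intro convex_onD[OF exp_convex]) auto
    then show "exp (- (\<theta> * s + (1 - \<theta>) * t) * len g)
        \<le> \<theta> * exp (- s * len g) + (1 - \<theta>) * exp (- t * len g)"
      by (simp add: algebra_simps)
  qed
  also have "\<dots> = \<theta> * (\<Sum>g\<in>T. exp (- s * len g)) + (1 - \<theta>) * (\<Sum>g\<in>T. exp (- t * len g))"
    by (simp add: sum.distrib sum_distrib_left)
  also have "\<dots> \<le> \<theta> * a + (1 - \<theta>) * b"
    using series_leD[OF assms(1) T] series_leD[OF assms(2) T] assms(3,4)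
    by (intro add_mono mult_left_mono) auto
  finally show "(\<Sum>g\<in>T. exp (- (\<theta> * s + (1 - \<theta>) * t) * len g)) \<le> \<theta> * a + (1 - \<theta>) * b" .
qed

text \<open>From \<open>N\<close> on, the annulus of lengths between \<open>n\<close> and
  \<open>n + 1\<close> contributes at most \<open>M * exp (\<sigma> - s) ^ n\<close>, and each
  earlier annulus is a finite sum.\<close>

lemma series_le_annuli:
  assumes A: "A \<subseteq> carrier G"
    and card: "\<And>n. n \<ge> N \<Longrightarrow> real (card {g \<in> A. real n \<le> len g \<and> len g < real n + 1}) \<le> M * exp (\<sigma> * real n)"
    and s: "\<sigma> < s" "0 \<le> s" and M: "0 \<le> M"
  shows "\<exists>B. series_le A s B"
proof -
  define R where "R n = {g \<in> A. real n \<le> len g \<and> len g < real n + 1}" for n :: nat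
  have fin: "finite (R n)" for n
    using A by (intro finite_subset[OF _ finite_len_le[of "real n + 1"]]) (auto simp: R_def)
  define f where "f n = (if n < N then \<Sum>g\<in>R n. exp (- s * len g) else M * exp (\<sigma> - s) ^ n)" for n
  have "series_le (R n) s (f n)" for n
  proof (cases "n < N")
    case True
    then show ?thesis using series_le_finite[OF fin] by (simp add: f_def)
  next
    case False
    have "(\<Sum>g\<in>R n. exp (- s * len g)) \<le> (\<Sum>g\<in>R n. exp (- s * real n))"
      using s by (intro sum_mono) (auto simp: R_def intro!: mult_left_mono)
    also have "\<dots> = real (card (R n)) * exp (- s * real n)" by simp
    also have "\<dots> \<le> M * exp (\<sigma> * real n) * exp (- s * real n)"
      using card[of n] False by (intro mult_right_mono) (auto simp: R_def)
    also have "\<dots> = f n"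
      using False by (simp add: f_def exp_of_nat_mult[symmetric] exp_add[symmetric] algebra_simps)
    finally show ?thesis using series_le_finite[OF fin] series_le_mono by blast
  qed
  moreover have "summable f"
  proof -
    have "summable (\<lambda>n. M * exp (\<sigma> - s) ^ n)" using s by (intro summable_mult summable_geometric) auto
    then show ?thesis
      by (rule summable_cong[THEN iffD1, rotated]) (auto simp: f_def eventually_at_top_linorder intro!: exI[of _ N])
  qed
  ultimately have "series_le (\<Union>n. R n) s (suminf f)" by (rule series_le_UN)
  moreover have "A \<subseteq> (\<Union>n. R n)"
  proof
    fix g assume "g \<in> A"
    then have "g \<in> R (nat \<lfloor>len g\<rfloor>)" using len_nonneg[of g] A by (auto simp: R_def)
    then show "g \<in> (\<Union>n. R n)" by blast
  qed
  ultimately show ?thesis using series_le_mono by blast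
qed

section \<open>Products of a fixed number of letters and divergence at the critical exponent\<close>

definition words :: "'a set \<Rightarrow> nat \<Rightarrow> 'a set" where
  "words S n = word_prod ` {w \<in> lists S. length w = n}"

lemma words_0 [simp]: "words S 0 = {\<one>}"
  by (auto simp: words_def)

lemma words_add:
  assumes "S \<subseteq> carrier G"
  shows "words S (n + m) = (\<lambda>(g, h). g \<otimes> h) ` (words S n \<times> words S m)"
proof (intro equalityI subsetI)
  fix x assume "x \<in> words S (n + m)"
  then obtain w where w: "w \<in> lists S" "length w = n + m" "x = word_prod w" by (auto simp: words_def)
  have "take n w \<in> lists S" "drop n w \<in> lists S" using w by (auto dest: in_set_takeD in_set_dropD)
  moreover have "x = word_prod (take n w) \<otimes> word_prod (drop n w)"
    using w assms calculation by (subst word_prod_append[symmetric]) auto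
  ultimately show "x \<in> (\<lambda>(g, h). g \<otimes> h) ` (words S n \<times> words S m)"
    using w by (intro image_eqI[of _ _ "(word_prod (take n w), word_prod (drop n w))"])
      (auto simp: words_def simp del: in_lists_conv_set)
next
  fix x assume "x \<in> (\<lambda>(g, h). g \<otimes> h) ` (words S n \<times> words S m)"
  then obtain v w where vw: "v \<in> lists S" "w \<in> lists S" "length v = n" "length w = m"
      "x = word_prod v \<otimes> word_prod w"
    by (auto simp: words_def simp del: in_lists_conv_set)
  then have "x = word_prod (v @ w)" using assms by (subst word_prod_append) auto
  then show "x \<in> words S (n + m)" using vw by (auto simp: words_def intro!: image_eqI[of _ _ "v @ w"])
qed

lemma words_1:
  assumes "S \<subseteq> carrier G" shows "words S (Suc 0) = S"
proof -
  have "{w \<in> lists S. length w = Suc 0} = (\<lambda>x. [x]) ` S" by (auto simp: length_Suc_conv)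
  then show ?thesis using assms by (force simp: words_def image_image)
qed

end

text \<open>\<open>S_len\<close> matches the loss \<open>c\<close> in \<open>S_add\<close>: every
  further letter adds length at least 1, so the number of letters is bounded by the length.
  \<open>S_series\<close> stands in for finiteness of the generating set.\<close>

locale quasi_free_semigroup = hyperbolic_length +
  fixes S :: "'a set" and c :: real
  assumes S_closed: "S \<subseteq> carrier G" and S_nonempty: "S \<noteq> {}" and c_nonneg: "0 \<le> c"
    and S_len: "g \<in> S \<Longrightarrow> c + 1 \<le> len g"
    and S_add: "v \<in> lists S - {[]} \<Longrightarrow> w \<in> lists S - {[]} \<Longrightarrow>
      len (word_prod v) + len (word_prod w) - c \<le> len (word_prod v \<otimes> word_prod w)"
    and S_series: "0 < s \<Longrightarrow> \<exists>B. series_le S s B"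
begin

definition F where "F = word_prod ` (lists S - {[]})"

lemma F_closed: "F \<subseteq> carrier G"
  using S_closed by (auto simp: F_def lists_eq_set)

lemma words_sub_F: "0 < n \<Longrightarrow> words S n \<subseteq> F"
  by (auto simp: words_def F_def)

lemma F_UN_words: "F = (\<Union>n. words S (Suc n))"
proof (intro equalityI subsetI)
  fix x assume "x \<in> F"
  then obtain w where w: "w \<in> lists S" "w \<noteq> []" "x = word_prod w" by (auto simp: F_def)
  then have "x \<in> words S (Suc (length w - 1))" by (auto simp: words_def)
  then show "x \<in> (\<Union>n. words S (Suc n))" by blast
qed (use words_sub_F in blast)

lemma F_add: "g \<in> F \<Longrightarrow> h \<in> F \<Longrightarrow> len g + len h - c \<le> len (g \<otimes> h)"
  unfolding F_def using S_add by blast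

lemma F_mult: "g \<in> F \<Longrightarrow> h \<in> F \<Longrightarrow> g \<otimes> h \<in> F"
proof -
  assume "g \<in> F" "h \<in> F"
  then obtain n m where "g \<in> words S (Suc n)" "h \<in> words S (Suc m)" by (auto simp: F_UN_words)
  then have "g \<otimes> h \<in> words S (Suc n + Suc m)" unfolding words_add[OF S_closed] by force
  then show ?thesis using words_sub_F by auto
qed

lemma words_Suc: "words S (Suc n) = (\<lambda>(g, h). g \<otimes> h) ` (S \<times> words S n)"
  using words_add[OF S_closed, of "Suc 0" n] words_1[OF S_closed] by simp

lemma words_len: "g \<in> words S n \<Longrightarrow> real n \<le> len g"
proof (induction n arbitrary: g)
  case (Suc n)
  then obtain s h where g: "g = s \<otimes> h" "s \<in> S" "h \<in> words S n" by (auto simp: words_Suc)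
  show ?case
  proof (cases n)
    case 0
    then show ?thesis using g S_closed S_len[of s] c_nonneg by auto
  next
    case (Suc m)
    then have "h \<in> F" "s \<in> F" using g words_sub_F[of n] words_1[OF S_closed] words_sub_F[of "Suc 0"] by auto
    then show ?thesis using F_add[of s h] S_len[of s] Suc.IH[of h] g by simp
  qed
qed simp

lemma words_nonempty: "words S n \<noteq> {}"
  using S_nonempty by (induction n) (auto simp: words_Suc)

lemma words_series: "0 < s \<Longrightarrow> \<exists>B. series_le (words S (Suc n)) s B"
proof (induction n)
  case 0
  then show ?case using S_series words_1[OF S_closed] by simp
next
  case (Suc n)
  obtain a b where "series_le S s a" "series_le (words S (Suc n)) s b"
    using Suc S_series by blast
  then have "series_le ((\<lambda>(g, h). g \<otimes> h) ` (S \<times> words S (Suc n))) s (exp (c * s) * a * b)"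
    using F_add words_sub_F[of "Suc n"] words_sub_F[of "Suc 0"] words_1[OF S_closed] \<open>0 < s\<close>
    by (intro series_le_mult) auto
  then show ?case by (subst words_Suc) blast
qed

lemma F_infinite: "infinite F"
proof
  assume "finite F"
  then have "finite (len ` F)" by simp
  then obtain b where b: "\<And>x. x \<in> len ` F \<Longrightarrow> x \<le> b" by (meson bdd_above_finite bdd_above.unfold)
  obtain n :: nat where "b < real n" using reals_Archimedean2 by blast
  obtain g where "g \<in> words S (Suc n)" using words_nonempty by blast
  then show False using words_len[of g "Suc n"] b[of "len g"] words_sub_F[of "Suc n"] \<open>b < real n\<close> by force
qed

text \<open>A tail argument: a finite \<open>T\<close> almost exhausts the supremum of the partial
  sums, and words with more letters than the largest length occurring in \<open>T\<close> avoid
  \<open>T\<close>.\<close>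

lemma words_series_small:
  assumes F: "series_le F s B" and "0 < \<eta>"
  shows "\<exists>n. series_le (words S (Suc n)) s \<eta>"
proof -
  define X where "X = {\<Sum>g\<in>T. exp (- s * len g) | T. finite T \<and> T \<subseteq> F}"
  have bdd: "bdd_above X" using series_leD[OF F] by (intro bdd_aboveI[of _ B]) (auto simp: X_def)
  have "X \<noteq> {}" by (auto simp: X_def)
  then obtain x where "x \<in> X" "Sup X - \<eta> < x" using less_cSup_iff[OF _ bdd, of "Sup X - \<eta>"] \<open>0 < \<eta>\<close> by auto
  then obtain T where T: "finite T" "T \<subseteq> F" "Sup X - \<eta> < (\<Sum>g\<in>T. exp (- s * len g))"
    by (auto simp: X_def)
  have "finite (len ` T)" using T by simp
  then obtain b where b: "\<And>x. x \<in> len ` T \<Longrightarrow> x \<le> b" by (meson bdd_above_finite bdd_above.unfold)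
  obtain n :: nat where n: "b < real n" using reals_Archimedean2 by blast
  have "series_le (words S (Suc n)) s \<eta>"
  proof (rule series_leI)
    fix U assume U: "finite U" "U \<subseteq> words S (Suc n)"
    have "T \<inter> U = {}" using words_len[of _ "Suc n"] U b n by force
    then have "(\<Sum>g\<in>T. exp (- s * len g)) + (\<Sum>g\<in>U. exp (- s * len g)) = (\<Sum>g\<in>T \<union> U. exp (- s * len g))"
      using T U by (simp add: sum.union_disjoint)
    also have "\<dots> \<le> Sup X"
      using T U words_sub_F[of "Suc n"] by (intro cSup_upper bdd) (auto simp: X_def intro!: exI[of _ "T \<union> U"])
    finally show "(\<Sum>g\<in>U. exp (- s * len g)) \<le> \<eta>" using T(3) by simp
  qed
  then show ?thesis ..
qed

text \<open>The set of exponents of convergence has no least element. Cutting words into blocks of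
  \<open>n + 1\<close> letters bounds the series by a geometric one, whose ratio is the sum over one
  block times the loss at a junction.\<close>

lemma F_series_open:
  assumes "series_le F t B" "0 \<le> t"
  shows "\<exists>s B'. 0 \<le> s \<and> s < t \<and> series_le F s B'"
proof -
  have "t \<noteq> 0"
  proof
    assume "t = 0"
    obtain n :: nat where n: "B < real n" using reals_Archimedean2 by blast
    obtain T where "finite T" "card T = n" "T \<subseteq> F" using infinite_arbitrarily_large[OF F_infinite] by blast
    then show False using series_leD[OF assms(1), of T] \<open>t = 0\<close> n by simp
  qed
  then have t: "0 < t" using assms by simp
  \<comment> \<open>The convex combination of the exponents \<open>t / 2\<close> and
    \<open>t\<close> leaves a block sum of at most \<open>2 * \<eta>\<close>; with the loss
    \<open>exp (c * t)\<close> at a junction the ratio becomes 1/2.\<close>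
  define \<eta> where "\<eta> = exp (- (c * t)) / 4"
  have eta: "0 < \<eta>" by (simp add: \<eta>_def)
  obtain n where n: "series_le (words S (Suc n)) t \<eta>" using words_series_small[OF assms(1) eta] by blast
  obtain b where b: "series_le (words S (Suc n)) (t / 2) b" using words_series[of "t / 2" n] t by auto
  have b0: "0 \<le> b" using series_le_nonneg[OF b] .
  define \<theta> where "\<theta> = min 1 (\<eta> / (b + 1))"
  have th: "0 < \<theta>" "\<theta> \<le> 1" "\<theta> * b \<le> \<eta>"
  proof -
    show "0 < \<theta>" "\<theta> \<le> 1" using eta b0 by (auto simp: \<theta>_def)
    have "\<theta> * b \<le> \<eta> / (b + 1) * b" using b0 by (intro mult_right_mono) (auto simp: \<theta>_def)
    also have "\<dots> \<le> \<eta>" using b0 eta by (simp add: field_simps)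
    finally show "\<theta> * b \<le> \<eta>" .
  qed
  define s where "s = \<theta> * (t / 2) + (1 - \<theta>) * t"
  have "s = t - \<theta> * t / 2" by (simp add: s_def field_simps)
  moreover have "0 < \<theta> * t" "\<theta> * t \<le> t" using th t by (auto simp: mult_left_le_one_le)
  ultimately have s: "s < t" "0 < s" using t by linarith+
  have "series_le (words S (Suc n)) s (\<theta> * b + (1 - \<theta>) * \<eta>)"
    unfolding s_def using th by (intro series_le_convex b n) auto
  moreover have "\<theta> * b + (1 - \<theta>) * \<eta> \<le> \<eta> + 1 * \<eta>"
    using th eta by (intro add_mono mult_right_mono) auto
  ultimately have Q: "series_le (words S (Suc n)) s (2 * \<eta>)" using series_le_mono by auto
  \<comment> \<open>The remainder after cutting off full blocks has between 1 and
    \<open>n + 1\<close> letters. It is kept nonempty because almost additivity is stated for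
    elements of \<open>F\<close>, which come from nonempty words.\<close>
  define Y where "Y = (\<Union>r<Suc n. words S (Suc r))"
  obtain f where "\<And>r. series_le (words S (Suc r)) s (f r)" using words_series[OF s(2)] by metis
  then have M: "series_le Y s (\<Sum>r<Suc n. f r)" unfolding Y_def by (intro series_le_UN_less)
  define M where "M = (\<Sum>r<Suc n. f r)"
  define Z where "Z k = ((\<lambda>X. (\<lambda>(g, h). g \<otimes> h) ` (words S (Suc n) \<times> X)) ^^ k) Y" for k
  have Z_Suc: "Z (Suc k) = (\<lambda>(g, h). g \<otimes> h) ` (words S (Suc n) \<times> Z k)" for k by (simp add: Z_def)
  have Z_F: "Z k \<subseteq> F" for k
  proof (induction k)
    case 0
    then show ?case using words_sub_F by (auto simp: Z_def Y_def)
  next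
    case (Suc k)
    then show ?case using F_mult words_sub_F[of "Suc n"] unfolding Z_Suc by auto
  qed
  have Z: "series_le (Z k) s (M * (1 / 2) ^ k)" for k
  proof (induction k)
    case 0
    then show ?case using M by (simp add: Z_def M_def)
  next
    case (Suc k)
    have "series_le (Z (Suc k)) s (exp (c * s) * (2 * \<eta>) * (M * (1 / 2) ^ k))"
      unfolding Z_Suc using Q Suc s F_add Z_F words_sub_F[of "Suc n"]
      by (intro series_le_mult) (auto dest!: subsetD)
    moreover have "exp (c * s) * (2 * \<eta>) \<le> exp (c * t) * (2 * \<eta>)"
      using s c_nonneg eta by (intro mult_right_mono) (auto intro!: mult_left_mono)
    moreover have "exp (c * t) * (2 * \<eta>) = 1 / 2"
      by (simp add: \<eta>_def exp_minus)
    ultimately have "exp (c * s) * (2 * \<eta>) * (M * (1 / 2) ^ k) \<le> 1 / 2 * (M * (1 / 2) ^ k)"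
      using series_le_nonneg[OF Suc] by (intro mult_right_mono) auto
    then show ?case using series_le_mono[OF \<open>series_le (Z (Suc k)) s _\<close> order_refl] by simp
  qed
  have "word_prod w \<in> (\<Union>k. Z k)" if "w \<in> lists S - {[]}" for w
    using that
  proof (induction "length w" arbitrary: w rule: less_induct)
    case less
    show ?case
    proof (cases "length w \<le> Suc n")
      case True
      then have "word_prod w \<in> words S (Suc (length w - 1))" using less.prems by (auto simp: words_def)
      moreover have "length w - 1 < Suc n" using True less.prems by (cases w) auto
      ultimately have "word_prod w \<in> Z 0" unfolding Z_def Y_def by auto
      then show ?thesis by blast
    next
      case False
      have d: "drop (Suc n) w \<in> lists S - {[]}" "take (Suc n) w \<in> lists S"
        using less.prems False by (auto dest: in_set_takeD in_set_dropD)
      then obtain k where k: "word_prod (drop (Suc n) w) \<in> Z k"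
        using less.hyps[of "drop (Suc n) w"] False by (metis UN_E diff_less length_drop less_le_trans not_le zero_less_Suc order.strict_trans)
      have "word_prod (take (Suc n) w) \<in> words S (Suc n)" using d False by (auto simp: words_def)
      then have "word_prod (take (Suc n) w) \<otimes> word_prod (drop (Suc n) w) \<in> Z (Suc k)"
        unfolding Z_Suc using k by force
      moreover have "word_prod (take (Suc n) w) \<otimes> word_prod (drop (Suc n) w) = word_prod w"
        using d S_closed by (subst word_prod_append[symmetric]) (auto simp del: foldr_append)
      ultimately show ?thesis by auto
    qed
  qed
  then have "F \<subseteq> (\<Union>k. Z k)" by (auto simp: F_def)
  moreover have "series_le (\<Union>k. Z k) s (\<Sum>k. M * (1 / 2) ^ k)"
    by (intro series_le_UN Z summable_mult summable_geometric) auto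
  ultimately have "series_le F s (\<Sum>k. M * (1 / 2) ^ k)" using series_le_mono by blast
  then show ?thesis using s less_imp_le by blast
qed

end

section \<open>Free semigroups from a Schottky pair\<close>

context hyperbolic_length begin

text \<open>A separated subset of greatest cardinality is maximal, so the translates of the
  \<open>r\<close>-ball by its elements cover \<open>X\<close>.\<close>

lemma separated_subset_exists:
  assumes X: "finite X" "X \<subseteq> carrier G" and "0 \<le> r"
  shows "\<exists>A\<subseteq>X. (\<forall>g\<in>A. \<forall>h\<in>A. g \<noteq> h \<longrightarrow> r < len (inv g \<otimes> h)) \<and>
    card X \<le> card A * card {g \<in> carrier G. len g \<le> r}"
proof -
  define sep where "sep A \<longleftrightarrow> A \<subseteq> X \<and> (\<forall>g\<in>A. \<forall>h\<in>A. g \<noteq> h \<longrightarrow> r < len (inv g \<otimes> h))" for A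
  have "sep {}" by (simp add: sep_def)
  moreover have bound: "\<forall>A. sep A \<longrightarrow> card A < Suc (card X)"
    using X by (auto simp: sep_def less_Suc_eq_le intro: card_mono)
  ultimately obtain A where A: "sep A" "\<And>A'. sep A' \<Longrightarrow> card A' \<le> card A"
    using ex_has_greatest_nat[of sep "{}" card "Suc (card X)"] by (metis less_imp_le)
  have AX: "A \<subseteq> X" "finite A" using A(1) X finite_subset by (auto simp: sep_def)
  let ?B = "{g \<in> carrier G. len g \<le> r}"
  have near: "\<exists>a\<in>A. len (inv a \<otimes> x) \<le> r" if "x \<in> X" for x
  proof (rule ccontr)
    assume *: "\<not> ?thesis"
    have "x \<notin> A" using * that X \<open>0 \<le> r\<close> by force
    moreover have "sep (insert x A)"
      using A(1) * that X len_inv_mult_sym[of x] unfolding sep_def by (auto simp: not_le subset_iff)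
    ultimately show False using A(2)[of "insert x A"] AX by simp
  qed
  have "X \<subseteq> (\<lambda>(a, b). a \<otimes> b) ` (A \<times> ?B)"
  proof
    fix x assume x: "x \<in> X"
    then obtain a where a: "a \<in> A" "len (inv a \<otimes> x) \<le> r" using near by blast
    then have "(a, inv a \<otimes> x) \<in> A \<times> ?B" using x X AX by auto
    moreover have "x = a \<otimes> (inv a \<otimes> x)" using x a X AX by (subst mult_inv_cancel) auto
    ultimately show "x \<in> (\<lambda>(a, b). a \<otimes> b) ` (A \<times> ?B)" by (intro image_eqI[of _ _ "(a, inv a \<otimes> x)"]) auto
  qed
  then have "card X \<le> card (A \<times> ?B)"
    using AX finite_len_le by (intro surj_card_le) auto
  then show ?thesis using A(1) by (auto simp: sep_def card_cartesian_product intro!: exI[of _ A])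
qed

text \<open>By freeness and subadditivity of the length, the sum over words of \<open>n\<close>
  letters is at least the \<open>n\<close>-th power of the sum over \<open>S\<close>, hence at least
  1; freeness also makes these levels disjoint.\<close>

lemma free_series_unbounded:
  assumes S: "finite S" "S \<subseteq> carrier G" and inj: "inj_on word_prod (lists S)" and "0 \<le> s"
    and one: "1 \<le> (\<Sum>g\<in>S. exp (- s * len g))"
  shows "\<not> series_le (word_prod ` (lists S - {[]})) s B"
proof
  assume B: "series_le (word_prod ` (lists S - {[]})) s B"
  have Suc_eq: "words S (Suc n) = (\<lambda>(g, h). g \<otimes> h) ` (S \<times> words S n)" for n
    using words_add[OF S(2), of "Suc 0" n] words_1[OF S(2)] by simp
  have inj_mult: "inj_on (\<lambda>(g, h). g \<otimes> h) (S \<times> words S n)" for n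
  proof (rule inj_onI, clarify)
    fix a h a' h' assume a: "a \<in> S" "h \<in> words S n" "a' \<in> S" "h' \<in> words S n" "a \<otimes> h = a' \<otimes> h'"
    then obtain w w' where w: "w \<in> lists S" "h = word_prod w" "w' \<in> lists S" "h' = word_prod w'"
      by (auto simp: words_def simp del: in_lists_conv_set)
    then have "word_prod (a # w) = word_prod (a' # w')" using a by simp
    then have "a # w = a' # w'" using inj a(1,3) w by (meson inj_onD lists.Cons)
    then show "a = a' \<and> h = h'" using w by simp
  qed
  have fin: "finite (words S n)" for n
    using S(1) by (induction n) (auto simp: Suc_eq)
  have ge: "1 \<le> (\<Sum>g\<in>words S n. exp (- s * len g))" for n
  proof (induction n)
    case (Suc n)
    have wc: "words S n \<subseteq> carrier G" using S(2) by (auto simp: words_def lists_eq_set)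
    have "1 \<le> (\<Sum>g\<in>S. exp (- s * len g)) * (\<Sum>g\<in>words S n. exp (- s * len g))"
      using mult_mono[OF one Suc] by (simp add: sum_nonneg)
    also have "\<dots> = (\<Sum>(g, h)\<in>S \<times> words S n. exp (- s * len g) * exp (- s * len h))"
      by (simp add: sum_product sum.cartesian_product)
    also have "\<dots> \<le> (\<Sum>(g, h)\<in>S \<times> words S n. exp (- s * len (g \<otimes> h)))"
    proof (rule sum_mono, clarify)
      fix g h assume "g \<in> S" "h \<in> words S n"
      then have "s * len (g \<otimes> h) \<le> s * (len g + len h)"
        using len_mult_le[of g h] S(2) wc \<open>0 \<le> s\<close> by (intro mult_left_mono) auto
      then show "exp (- s * len g) * exp (- s * len h) \<le> exp (- s * len (g \<otimes> h))"
        by (simp add: exp_add[symmetric] algebra_simps)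
    qed
    also have "\<dots> = (\<Sum>g\<in>words S (Suc n). exp (- s * len g))"
      unfolding Suc_eq by (subst sum.reindex[OF inj_mult]) (simp add: case_prod_beta comp_def)
    finally show ?case .
  qed simp
  have disj: "words S n \<inter> words S m = {}" if "n \<noteq> m" for n m
  proof (rule equals0I)
    fix x assume x: "x \<in> words S n \<inter> words S m"
    obtain w where w: "w \<in> lists S" "length w = n" "x = word_prod w"
      using x unfolding words_def by blast
    obtain w' where w': "w' \<in> lists S" "length w' = m" "x = word_prod w'"
      using x unfolding words_def by blast
    have "w = w'" by (rule inj_onD[OF inj]) (use w w' in simp_all)
    then show False using w(2) w'(2) that by simp
  qed
  obtain N :: nat where N: "B < real N" using reals_Archimedean2 by blast
  define T where "T = (\<Union>n<N. words S (Suc n))"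
  have "real N = (\<Sum>n<N. 1)" by simp
  also have "\<dots> \<le> (\<Sum>n<N. \<Sum>g\<in>words S (Suc n). exp (- s * len g))" by (intro sum_mono ge)
  also have "\<dots> = (\<Sum>g\<in>T. exp (- s * len g))"
    unfolding T_def by (rule sum.UNION_disjoint[symmetric]) (use fin disj in auto)
  also have "\<dots> \<le> B"
  proof (rule series_leD[OF B])
    show "finite T" using fin by (simp add: T_def)
    show "T \<subseteq> word_prod ` (lists S - {[]})" by (auto simp: T_def words_def)
  qed
  finally show False using N by simp
qed

end

section \<open>Coding group elements by chains over a Schottky pair\<close>

locale schottky_pair = hyperbolic_length +
  fixes v1 v2 :: 'a and c0 :: real
  assumes c0: "0 \<le> c0" and v_closed [simp]: "v1 \<in> carrier G" "v2 \<in> carrier G"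
    and v_long: "3 * (c0 + \<delta>) + 6 * \<delta> + 1 < len v1" "3 * (c0 + \<delta>) + 6 * \<delta> + 1 < len v2"
    and v_gp: "gp (inv v1) v1 \<le> c0" "gp (inv v2) v2 \<le> c0" "gp v1 v2 \<le> c0"
      "gp (inv v1) v2 \<le> c0" "gp (inv v2) v1 \<le> c0" "gp (inv v1) (inv v2) \<le> c0"
begin

text \<open>No \<open>g\<close> can follow two diverging elements for long: since
  \<open>gp (inv v1) (inv v2) \<le> c0\<close>, hyperbolicity lets one of the two inverses part from
  \<open>g\<close> by \<open>c0 + \<delta>\<close>, and likewise \<open>v1\<close> or
  \<open>v2\<close> from \<open>inv g\<close>. This makes \<open>pre\<close> and \<open>post\<close>
  work.\<close>

definition c where "c = c0 + \<delta>"

lemma c_nonneg: "0 \<le> c" using c0 delta_nonneg by (simp add: c_def)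

definition pre where "pre g = (if gp (inv v1) g \<le> c then v1 else v2)"
definition post where "post g = (if gp (inv g) v1 \<le> c then v1 else v2)"

lemma pre_post_in: "pre g \<in> {v1, v2}" "post g \<in> {v1, v2}"
  by (auto simp: pre_def post_def)

lemma pre_post_closed [simp]: "pre g \<in> carrier G" "post g \<in> carrier G"
  by (auto simp: pre_def post_def)

lemma gp_pre: "g \<in> carrier G \<Longrightarrow> gp (inv (pre g)) g \<le> c"
  using gp_hyp[of "inv v1" g "inv v2"] v_gp(6) gp_sym[of g "inv v2"]
  by (auto simp: pre_def c_def min_def split: if_splits)

lemma gp_post: "g \<in> carrier G \<Longrightarrow> gp (inv g) (post g) \<le> c"
  using gp_hyp[of v1 "inv g" v2] v_gp(3) gp_sym[of v1 "inv g"]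
  by (auto simp: post_def c_def min_def split: if_splits)

lemma gp_inv_v: "a \<in> {v1, v2} \<Longrightarrow> b \<in> {v1, v2} \<Longrightarrow> gp (inv a) b \<le> c"
  using v_gp delta_nonneg by (auto simp: c_def)

lemma v_long': "a \<in> {v1, v2} \<Longrightarrow> a \<in> carrier G \<and> 3 * c + 6 * \<delta> + 1 < len a"
  using v_long by (auto simp: c_def)

definition letters where
  "letters j = replicate (fst j) v1 @ [v2, pre (snd j), snd j, post (snd j)]"

definition gen where "gen j = word_prod (letters j)"

definition long where "long g \<longleftrightarrow> g \<in> carrier G \<and> 3 * c + 6 * \<delta> + 1 < len g"

lemma chain_replicate_v: "chain c (replicate n v1)"
proof (induction n)
  case (Suc n)
  then show ?case using gp_inv_v v_long' by (cases n) auto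
qed auto

lemma chain_letters:
  assumes "long (snd j)"
  shows "chain c (letters j)"
proof -
  have "chain c [v2, pre (snd j), snd j, post (snd j)]"
    using assms gp_inv_v[OF _ pre_post_in(1)] gp_pre gp_post v_long' pre_post_in by (simp add: long_def)
  then show ?thesis
    unfolding letters_def chain_append_iff using chain_replicate_v[of "fst j"] gp_inv_v by (cases "fst j") auto
qed

lemma hd_letters: "hd (letters j @ w) \<in> {v1, v2}"
  by (cases "fst j") (auto simp: letters_def)

lemma last_letters: "last (letters j) \<in> {v1, v2}" "letters j \<noteq> []"
  using pre_post_in by (auto simp: letters_def)

lemma chain_concat_letters:
  "(\<And>j. j \<in> set js \<Longrightarrow> long (snd j)) \<Longrightarrow> chain c (concat (map letters js))"
proof (induction js)
  case (Cons j js)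
  have "gp (inv (last (letters j))) (hd (concat (map letters js))) \<le> c" if "js \<noteq> []"
    using that gp_inv_v[OF last_letters(1) hd_letters] by (cases js) simp_all
  then show ?case
    using Cons chain_letters[of j] by (cases "js = []") (simp_all add: chain_append_iff)
qed auto

lemma letters_closed: "long (snd j) \<Longrightarrow> set (letters j) \<subseteq> carrier G"
  using chain_letters chain_closed by blast

lemma gen_closed: "long (snd j) \<Longrightarrow> gen j \<in> carrier G"
  unfolding gen_def using letters_closed by simp

lemma word_prod_gen:
  "(\<And>j. j \<in> set js \<Longrightarrow> long (snd j)) \<Longrightarrow> word_prod (map gen js) = word_prod (concat (map letters js))"
proof (induction js)
  case (Cons j js)
  have "set (letters j) \<subseteq> carrier G" using Cons.prems letters_closed by auto
  moreover have "set (concat (map letters js)) \<subseteq> carrier G"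
    using chain_closed chain_concat_letters Cons.prems by (metis list.set_intros(2))
  ultimately show ?case using Cons by (simp add: word_prod_append gen_def del: foldr_append)
qed simp

lemma v_fork: "s \<in> {v1, v2} \<Longrightarrow> t \<in> {v1, v2} \<Longrightarrow> s \<noteq> t \<Longrightarrow> gp s t < min (len s) (len t) - c - 2 * \<delta>"
  using v_gp(3) v_long gp_sym[of v2 v1] c0 delta_nonneg by (auto simp: c_def)

lemma gen_length: "long (snd j) \<Longrightarrow> 2 * (c + 2 * \<delta>) + 1 \<le> len (gen j)" "long (snd j) \<Longrightarrow> real (fst j) \<le> len (gen j)"
proof -
  assume j: "long (snd j)"
  have "(c + 2 * \<delta> + 1) * real (length (letters j)) \<le> len (gen j)"
    unfolding gen_def by (rule chain_len_ge[OF c_nonneg chain_letters[OF j]])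
  moreover have "real (length (letters j)) = real (fst j) + 4" by (simp add: letters_def)
  moreover have "0 \<le> (c + 2 * \<delta>) * real (fst j)" using c_nonneg delta_nonneg by simp
  ultimately have "4 * (c + 2 * \<delta> + 1) + real (fst j) \<le> len (gen j)" by (simp add: algebra_simps)
  then show "2 * (c + 2 * \<delta>) + 1 \<le> len (gen j)" "real (fst j) \<le> len (gen j)"
    using c_nonneg delta_nonneg by (simp_all add: algebra_simps)
qed

text \<open>The chain is cut before and after the letter \<open>snd j\<close>, and each cut loses
  \<open>2 * (c + 2 * \<delta>)\<close>. Almost additive lengths mean that the geodesic to
  \<open>gen j\<close> passes near \<open>h\<close> and near
  \<open>h \<otimes> snd j\<close>.\<close>

lemma gen_myrberg:
  assumes "long (snd j)"
  shows "\<exists>h\<in>carrier G. \<exists>b\<in>carrier G. gen j = h \<otimes> (snd j \<otimes> b) \<and>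
    len h + len (snd j) + len b - 4 * (c + 2 * \<delta>) \<le> len (gen j)"
proof -
  define p where "p = replicate (fst j) v1 @ [v2, pre (snd j)]"
  let ?g = "snd j" and ?b = "post (snd j)"
  have g: "?g \<in> carrier G" using assms by (simp add: long_def)
  have l: "letters j = p @ [?g, ?b]" by (simp add: letters_def p_def)
  have ch: "chain c (p @ [?g, ?b])" using chain_letters[OF assms] l by simp
  then have p: "set p \<subseteq> carrier G" using chain_closed by fastforce
  have "chain c ([?g] @ [?b])" using ch by (simp add: chain_append_iff)
  from chain_len_append[OF c_nonneg this] have 1: "len ?g + len ?b - 2 * (c + 2 * \<delta>) \<le> len (?g \<otimes> ?b)"
    using g by simp
  from chain_len_append[OF c_nonneg ch]
  have "len (word_prod p) + len (?g \<otimes> ?b) - 2 * (c + 2 * \<delta>) \<le> len (gen j)"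
    using g by (simp add: gen_def l del: foldr_append) 
  moreover have "gen j = word_prod p \<otimes> (?g \<otimes> ?b)"
    using g p by (simp add: gen_def l word_prod_append del: foldr_append)
  ultimately show ?thesis using 1 p by (intro bexI[of _ "word_prod p"] bexI[of _ ?b]) auto
qed

end

text \<open>The index \<open>(i, g)\<close> stands for the generator \<open>v1\<^sup>i v2 (pre g) g (post g)\<close>; the prefix code
  \<open>v1\<^sup>i v2\<close> tells generators with different first index apart.\<close>

locale schottky_code = schottky_pair +
  fixes J :: "(nat \<times> 'a) set"
  assumes J_long: "j \<in> J \<Longrightarrow> long (snd j)" and J_nonempty: "J \<noteq> {}"
    and J_sep: "(i, g) \<in> J \<Longrightarrow> (i, g') \<in> J \<Longrightarrow> g \<noteq> g' \<Longrightarrow>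
      \<bar>len g - len g'\<bar> \<le> 1 \<and> 1 + 2 * c + 4 * \<delta> < len (inv g \<otimes> g')"
    and J_finite: "finite {j \<in> J. fst j = 0}"
    and J_inj: "inj_on fst {j \<in> J. fst j \<noteq> 0}"
begin

text \<open>Two decodings can part only at the end of the shorter run of \<open>v1\<close>, at the
  letter \<open>pre\<close>, or at the middle letter. In the first two places \<open>v1\<close>
  faces \<open>v2\<close>, which diverge early; the third is excluded by
  \<open>J_sep\<close>.\<close>

lemma gen_first_le:
  assumes j: "(i, g) \<in> J" "(i', g') \<in> J" and js: "set js \<subseteq> J" "set js' \<subseteq> J"
    and eq: "word_prod (concat (map letters ((i, g) # js))) = word_prod (concat (map letters ((i', g') # js')))"
    and le: "i \<le> i'"
  shows "i = i' \<and> g = g'"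
proof (rule ccontr)
  assume ne: "\<not> ?thesis"
  define r where "r = concat (map letters js)"
  define r' where "r' = concat (map letters js')"
  define W where "W = replicate i v1 @ v2 # pre g # g # post g # r"
  define W' where "W' = replicate i' v1 @ v2 # pre g' # g' # post g' # r'"
  have W: "concat (map letters ((i, g) # js)) = W" "concat (map letters ((i', g') # js')) = W'"
    by (simp_all add: W_def W'_def r_def r'_def letters_def)
  have "set ((i, g) # js) \<subseteq> J" "set ((i', g') # js') \<subseteq> J" using j js by simp_all
  then have ch: "chain c W" "chain c W'"
    using chain_concat_letters J_long unfolding W[symmetric] by blast+
  have eq': "word_prod W = word_prod W'" using eq by (simp only: W)
  have fork: "\<not> gp s s' < min (len s) (len s') - c - 2 * \<delta>"
    if "W = v @ s # w" "W' = v @ s' # w'" for v s w s' w'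
    using chain_fork[OF c_nonneg ch(1)[unfolded that(1)] ch(2)[unfolded that(2)] eq'[unfolded that]] by linarith
  have "v1 \<noteq> v2" using v_gp(3) v_long(1) gp_self[of v1] c0 delta_nonneg by auto
  show False
  proof (cases "i = i'")
    case False
    define d where "d = i' - Suc i"
    have "i' = i + Suc d" using le False by (simp add: d_def)
    then have "W' = replicate i v1 @ v1 # replicate d v1 @ v2 # pre g' # g' # post g' # r'"
      by (simp add: W'_def replicate_add replicate_app_Cons_same)
    then show False using fork[OF W_def] v_fork[of v2 v1] \<open>v1 \<noteq> v2\<close> by blast
  next
    case True
    then have gg: "g \<noteq> g'" using ne by simp
    show False
    proof (cases "pre g = pre g'")
      case False
      have "W = (replicate i v1 @ [v2]) @ pre g # g # post g # r"
        "W' = (replicate i v1 @ [v2]) @ pre g' # g' # post g' # r'"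
        using True by (simp_all add: W_def W'_def)
      from fork[OF this] show False using v_fork[OF pre_post_in(1) pre_post_in(1) False] by blast
    next
      case pre: True
      have "W = (replicate i v1 @ [v2, pre g]) @ g # post g # r"
        "W' = (replicate i v1 @ [v2, pre g]) @ g' # post g' # r'"
        using True pre by (simp_all add: W_def W'_def)
      from fork[OF this] have "min (len g) (len g') - c - 2 * \<delta> \<le> gp g g'" by simp
      moreover have "\<bar>len g - len g'\<bar> \<le> 1 \<and> 1 + 2 * c + 4 * \<delta> < len (inv g \<otimes> g')"
        using J_sep gg j True by blast
      \<comment> \<open>Half the sum of the lengths exceeds their minimum by at most 1/2, and half
        of the 1 in the separation constant absorbs this.\<close>
      ultimately show False by (auto simp: gp_def min_def field_simps split: if_splits)
    qed
  qed
qed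

lemma gen_first:
  assumes "j \<in> J" "j' \<in> J" "set js \<subseteq> J" "set js' \<subseteq> J"
    and "word_prod (concat (map letters (j # js))) = word_prod (concat (map letters (j' # js')))"
  shows "j = j'"
proof (cases "fst j \<le> fst j'")
  case True
  then show ?thesis
    using gen_first_le[of "fst j" "snd j" "fst j'" "snd j'" js js'] assms by (simp add: prod_eq_iff)
next
  case False
  then show ?thesis
    using gen_first_le[of "fst j'" "snd j'" "fst j" "snd j" js' js] assms by (simp add: prod_eq_iff)
qed

lemma word_prod_gen_J: "set js \<subseteq> J \<Longrightarrow> word_prod (map gen js) = word_prod (concat (map letters js))"
  using word_prod_gen J_long by blast

lemma gen_cl: "j \<in> J \<Longrightarrow> gen j \<in> carrier G"
  using gen_closed J_long by blast

lemma word_prod_letters_one: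
  assumes "set js \<subseteq> J" "word_prod (concat (map letters js)) = \<one>"
  shows "js = []"
proof (rule ccontr)
  assume ne: "js \<noteq> []"
  define n where "n = length (concat (map letters js))"
  have "chain c (concat (map letters js))" using chain_concat_letters J_long assms(1) by blast
  then have "(c + 2 * \<delta> + 1) * real n \<le> 0"
    using chain_len_ge[OF c_nonneg, of "concat (map letters js)"] assms(2) by (simp add: n_def)
  moreover have "0 < c + 2 * \<delta> + 1" using c_nonneg delta_nonneg by simp
  ultimately have "n = 0" by (simp add: mult_le_0_iff)
  then have "concat (map letters js) = []" unfolding n_def by (simp only: length_0_conv)
  then show False using ne last_letters(2) by (cases js) auto
qed

lemma gen_words_inj:
  assumes "set js \<subseteq> J" "set js' \<subseteq> J" "word_prod (map gen js) = word_prod (map gen js')"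
  shows "js = js'"
  using assms
proof (induction js arbitrary: js')
  case Nil
  then show ?case using word_prod_letters_one[of js'] word_prod_gen_J[of js'] by simp
next
  case (Cons j js)
  have ne: "js' \<noteq> []"
    using word_prod_letters_one[OF Cons.prems(1)] word_prod_gen_J[OF Cons.prems(1)] Cons.prems(3) by auto
  then obtain j' ks where js': "js' = j' # ks" by (cases js') auto
  have mem: "j \<in> J" "j' \<in> J" "set js \<subseteq> J" "set ks \<subseteq> J" using Cons.prems js' by auto
  have "j = j'"
    using gen_first[OF mem] Cons.prems(3) word_prod_gen_J[OF Cons.prems(1)] word_prod_gen_J[OF Cons.prems(2)] js'
    by simp
  moreover have "set (map gen js) \<subseteq> carrier G" "set (map gen ks) \<subseteq> carrier G"
    using mem gen_cl by auto
  then have "word_prod (map gen js) = word_prod (map gen ks)"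
    using Cons.prems(3) gen_cl[OF mem(1)] js' calculation by simp
  then have "js = ks" using Cons.IH mem by blast
  ultimately show ?case using js' by simp
qed

lemma gen_inj: "inj_on gen J"
proof (rule inj_onI)
  fix j j' assume "j \<in> J" "j' \<in> J" "gen j = gen j'"
  then show "j = j'" using gen_words_inj[of "[j]" "[j']"] by simp
qed

lemma word_prod_inj: "inj_on word_prod (lists (gen ` J))"
proof (rule inj_onI)
  fix w w' assume w: "w \<in> lists (gen ` J)" "w' \<in> lists (gen ` J)" "word_prod w = word_prod w'"
  obtain js where js: "js \<in> lists J" "w = map gen js" using w(1) unfolding lists_image by blast
  obtain js' where js': "js' \<in> lists J" "w' = map gen js'" using w(2) unfolding lists_image by blast
  have "js = js'" using gen_words_inj[of js js'] js js' w(3) by auto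
  then show "w = w'" using js js' by simp
qed

text \<open>At most one generator belongs to each \<open>k > 0\<close>, and its length is at least
  \<open>k\<close>; this gives a geometric series besides the finite part with first index
  0.\<close>

lemma gen_series: "0 < s \<Longrightarrow> \<exists>B. series_le (gen ` J) s B"
proof -
  assume s: "0 < s"
  define A where "A k = gen ` {j \<in> J. fst j \<noteq> 0 \<and> fst j = k}" for k
  have "series_le (A k) s (exp (- s) ^ k)" for k
  proof (rule series_leI)
    fix T assume T: "finite T" "T \<subseteq> A k"
    have one: "x = y" if xy: "x \<in> T" "y \<in> T" for x y
    proof -
      obtain j where j: "j \<in> J" "fst j \<noteq> 0" "fst j = k" "x = gen j" using xy T by (auto simp: A_def)
      obtain j' where j': "j' \<in> J" "fst j' \<noteq> 0" "fst j' = k" "y = gen j'" using xy T by (auto simp: A_def)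
      have "j = j'" by (rule inj_onD[OF J_inj]) (use j j' in simp_all)
      then show ?thesis using j j' by simp
    qed
    have card: "card T \<le> 1" using one T(1) by (simp add: card_le_Suc0_iff_eq)
    have "(\<Sum>g\<in>T. exp (- s * len g)) \<le> (\<Sum>g\<in>T. exp (- s) ^ k)"
    proof (rule sum_mono)
      fix g assume "g \<in> T"
      then have "real k \<le> len g" using T gen_length(2) J_long by (auto simp: A_def)
      then have "s * real k \<le> s * len g" using s by (intro mult_left_mono) auto
      then show "exp (- s * len g) \<le> exp (- s) ^ k"
        by (simp add: exp_of_nat_mult[symmetric] mult.commute)
    qed
    also have "\<dots> \<le> 1 * exp (- s) ^ k"
      using card by (simp only: sum_constant) (intro mult_right_mono, auto)
    finally show "(\<Sum>g\<in>T. exp (- s * len g)) \<le> exp (- s) ^ k" by simp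
  qed
  moreover have "summable (\<lambda>k. exp (- s) ^ k)" using s by (intro summable_geometric) simp
  ultimately have "series_le (\<Union>k. A k) s (\<Sum>k. exp (- s) ^ k)" by (rule series_le_UN)
  moreover have "finite (gen ` {j \<in> J. fst j = 0})" using J_finite by simp
  ultimately have "series_le (gen ` {j \<in> J. fst j = 0} \<union> (\<Union>k. A k)) s
      ((\<Sum>g\<in>gen ` {j \<in> J. fst j = 0}. exp (- s * len g)) + (\<Sum>k. exp (- s) ^ k))"
    using series_le_finite series_le_Un by blast
  moreover have "gen ` J \<subseteq> gen ` {j \<in> J. fst j = 0} \<union> (\<Union>k. A k)"
  proof (intro image_subsetI)
    fix j assume "j \<in> J"
    then have "gen j \<in> gen ` {j \<in> J. fst j = 0} \<or> gen j \<in> A (fst j)"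
      unfolding A_def by blast
    then show "gen j \<in> gen ` {j \<in> J. fst j = 0} \<union> (\<Union>k. A k)" by blast
  qed
  ultimately show ?thesis using series_le_mono by blast
qed

lemma quasi_free: "quasi_free_semigroup G len \<delta> (gen ` J) (2 * (c + 2 * \<delta>))"
proof unfold_locales
  show "gen ` J \<subseteq> carrier G" using gen_cl by blast
  show "gen ` J \<noteq> {}" using J_nonempty by simp
  show "0 \<le> 2 * (c + 2 * \<delta>)" using c_nonneg delta_nonneg by simp
  show "2 * (c + 2 * \<delta>) + 1 \<le> len g" if "g \<in> gen ` J" for g
    using that gen_length(1) J_long by auto
  show "len (word_prod v) + len (word_prod w) - 2 * (c + 2 * \<delta>) \<le> len (word_prod v \<otimes> word_prod w)"
    if vw: "v \<in> lists (gen ` J) - {[]}" "w \<in> lists (gen ` J) - {[]}" for v w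
  proof -
    obtain js where js: "js \<in> lists J" "v = map gen js" using vw(1) unfolding lists_image by blast
    obtain js' where js': "js' \<in> lists J" "w = map gen js'" using vw(2) unfolding lists_image by blast
    have ch: "chain c (concat (map letters js) @ concat (map letters js'))"
      using chain_concat_letters[of "js @ js'"] js js' J_long by auto
    then have cl: "set (concat (map letters js)) \<subseteq> carrier G" "set (concat (map letters js')) \<subseteq> carrier G"
      using chain_closed[OF ch] by (simp_all only: set_append Un_subset_iff)
    have "word_prod v = word_prod (concat (map letters js))" "word_prod w = word_prod (concat (map letters js'))"
      using word_prod_gen_J js js' by auto
    then show ?thesis
      using chain_len_append[OF c_nonneg ch] word_prod_append[OF cl] by (simp del: foldr_append)
  qed
  show "\<exists>B. series_le (gen ` J) s B" if "0 < s" for s using gen_series that .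
qed

end

section \<open>Choice of the generators\<close>

context hyperbolic_length begin

lemma countable_carrier: "countable (carrier G)"
proof -
  have "carrier G = (\<Union>n::nat. {g \<in> carrier G. len g \<le> real n})"
    using real_arch_simple by auto
  moreover have "countable {g \<in> carrier G. len g \<le> real n}" for n :: nat
    using finite_len_le by (rule countable_finite)
  then have "countable (\<Union>n::nat. {g \<in> carrier G. len g \<le> real n})" by simp
  ultimately show ?thesis by simp
qed

lemma large_annulus_exists:
  assumes "0 \<le> \<sigma>" "0 < \<eta>" "0 \<le> M"
    and big: "\<And>s B. 0 \<le> s \<Longrightarrow> s < \<sigma> + \<eta> \<Longrightarrow> \<not> series_le (carrier G) s B"
  shows "\<exists>n\<ge>N. M * exp (\<sigma> * real n) < real (card {g \<in> carrier G. real n \<le> len g \<and> len g < real n + 1})"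
proof (rule ccontr)
  assume "\<not> ?thesis"
  then have "\<exists>B. series_le (carrier G) (\<sigma> + \<eta> / 2) B"
    using assms(1-3) by (intro series_le_annuli[of _ N M \<sigma>]) (auto simp: not_less)
  then show False using big[of "\<sigma> + \<eta> / 2"] assms(1,2) by auto
qed

text \<open>\<sigma> will be the critical exponent of the group minus \<epsilon>; it may fail to be
  positive, hence the guards \<open>0 < \<sigma>\<close>. Elements of length at most
  \<open>K\<close> are set aside, as only long ones can be letters of a chain.\<close>

lemma free_semigroup_exists:
  assumes ne: "non_elementary_length C" "0 \<le> C" and "0 < \<eta>"
    and big: "\<And>s B. 0 < \<sigma> \<Longrightarrow> 0 \<le> s \<Longrightarrow> s < \<sigma> + \<eta> \<Longrightarrow> \<not> series_le (carrier G) s B"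
  shows "\<exists>S d. quasi_free_semigroup G len \<delta> S d \<and> inj_on word_prod (lists S) \<and>
    (0 < \<sigma> \<longrightarrow> (\<forall>B. \<not> series_le (word_prod ` (lists S - {[]})) \<sigma> B)) \<and>
    (\<exists>K. \<forall>g\<in>carrier G. len g \<le> K \<or> (\<exists>h\<in>carrier G. \<exists>b\<in>carrier G.
      h \<otimes> (g \<otimes> b) \<in> word_prod ` (lists S - {[]}) \<and>
      len h + len g + len b - K \<le> len (h \<otimes> (g \<otimes> b))))"
proof -
  obtain c0 where c0: "0 \<le> c0" and "\<forall>R. \<exists>v1\<in>carrier G. \<exists>v2\<in>carrier G. R < len v1 \<and> R < len v2 \<and>
    gp (inv v1) v1 \<le> c0 \<and> gp (inv v2) v2 \<le> c0 \<and> gp v1 v2 \<le> c0 \<and>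
    gp (inv v1) v2 \<le> c0 \<and> gp (inv v2) v1 \<le> c0 \<and> gp (inv v1) (inv v2) \<le> c0"
    using schottky_pair_exists[OF ne] by blast
  then obtain v1 v2 where v: "v1 \<in> carrier G" "v2 \<in> carrier G"
    "3 * (c0 + \<delta>) + 6 * \<delta> + 1 < len v1" "3 * (c0 + \<delta>) + 6 * \<delta> + 1 < len v2"
    "gp (inv v1) v1 \<le> c0" "gp (inv v2) v2 \<le> c0" "gp v1 v2 \<le> c0"
    "gp (inv v1) v2 \<le> c0" "gp (inv v2) v1 \<le> c0" "gp (inv v1) (inv v2) \<le> c0"
    by blast
  interpret schottky_pair G len \<delta> v1 v2 c0
    by unfold_locales (use c0 v in auto)
  define r where "r = 1 + 2 * c + 4 * \<delta>"
  define L where "L = 3 * c + 6 * \<delta> + 1"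
  have r0: "0 \<le> r" using c_nonneg delta_nonneg by (simp add: r_def)
  have "\<exists>A. finite A \<and> Collect long \<supseteq> A \<and> (\<forall>g\<in>A. \<forall>h\<in>A. \<bar>len g - len h\<bar> \<le> 1) \<and>
    (\<forall>g\<in>A. \<forall>h\<in>A. g \<noteq> h \<longrightarrow> r < len (inv g \<otimes> h)) \<and>
    (0 < \<sigma> \<longrightarrow> 1 \<le> (\<Sum>g\<in>A. exp (- \<sigma> * len (gen (0, g)))))"
  proof (cases "0 < \<sigma>")
    case False
    then show ?thesis by (intro exI[of _ "{}"]) auto
  next
    case s: True
    define m where "m = card {g \<in> carrier G. len g \<le> r}"
    \<comment> \<open>\<open>q\<close> bounds the length added by \<open>v2\<close>,
      \<open>pre g\<close> and \<open>post g\<close>. With the width 1 of the annulus and the factor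
      \<open>m\<close> lost in passing to a separated subset, it determines how large the annulus
      must be.\<close>
    define q where "q = 3 * max (len v1) (len v2)"
    obtain n :: nat where "n \<ge> Suc (nat \<lceil>L\<rceil>)" and
      card: "real m * exp (\<sigma> * (q + 1)) * exp (\<sigma> * real n)
        < real (card {g \<in> carrier G. real n \<le> len g \<and> len g < real n + 1})"
      using large_annulus_exists[of \<sigma> \<eta> "real m * exp (\<sigma> * (q + 1))" "Suc (nat \<lceil>L\<rceil>)"] s \<open>0 < \<eta>\<close> big[OF s]
      by auto
    then have nL: "L < real n" by linarith
    define X where "X = {g \<in> carrier G. real n \<le> len g \<and> len g < real n + 1}"
    have X: "finite X" "X \<subseteq> carrier G"
      by (rule finite_subset[OF _ finite_len_le[of "real n + 1"]]) (auto simp: X_def)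
    obtain A where A: "A \<subseteq> X" "\<forall>g\<in>A. \<forall>h\<in>A. g \<noteq> h \<longrightarrow> r < len (inv g \<otimes> h)" "card X \<le> card A * m"
      using separated_subset_exists[OF X r0] unfolding m_def by blast
    have finA: "finite A" using A(1) X(1) finite_subset by blast
    have "real m * (exp (\<sigma> * (q + 1)) * exp (\<sigma> * real n)) < real (card A * m)"
      using card A(3) unfolding X_def[symmetric] by (simp only: mult.assoc)
    then have "real m * (exp (\<sigma> * (q + 1)) * exp (\<sigma> * real n)) < real m * real (card A)"
      by (simp add: mult.commute)
    then have cardA: "exp (\<sigma> * (q + 1)) * exp (\<sigma> * real n) \<le> real (card A)"
      by (simp add: mult_less_cancel_left)
    have "1 = exp (- (\<sigma> * (q + 1 + real n))) * exp (\<sigma> * (q + 1 + real n))"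
      by (simp add: exp_add[symmetric])
    also have "\<dots> \<le> exp (- (\<sigma> * (q + 1 + real n))) * real (card A)"
      using cardA by (intro mult_left_mono) (simp_all add: exp_add[symmetric] algebra_simps)
    also have "\<dots> = (\<Sum>g\<in>A. exp (- (\<sigma> * (q + 1 + real n))))" by simp
    also have "\<dots> \<le> (\<Sum>g\<in>A. exp (- \<sigma> * len (gen (0, g))))"
    proof (rule sum_mono)
      fix g assume "g \<in> A"
      then have g: "g \<in> carrier G" "len g < real n + 1" using A(1) by (auto simp: X_def)
      have "gen (0, g) = v2 \<otimes> (pre g \<otimes> (g \<otimes> post g))" using g by (simp add: gen_def letters_def)
      then have "len (gen (0, g)) \<le> len v2 + (len (pre g) + (len g + len (post g)))"
        using len_mult_le[of v2 "pre g \<otimes> (g \<otimes> post g)"] len_mult_le[of "pre g" "g \<otimes> post g"]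
          len_mult_le[of g "post g"] g by simp
      moreover have "len (pre g) \<le> max (len v1) (len v2)" "len (post g) \<le> max (len v1) (len v2)"
        by (auto simp: pre_def post_def)
      ultimately have "len (gen (0, g)) \<le> q + 1 + real n" using g by (simp add: q_def)
      then show "exp (- (\<sigma> * (q + 1 + real n))) \<le> exp (- \<sigma> * len (gen (0, g)))" using s by simp
    qed
    finally have "1 \<le> (\<Sum>g\<in>A. exp (- \<sigma> * len (gen (0, g))))" .
    moreover have "A \<subseteq> Collect long" using A(1) nL by (auto simp: X_def long_def L_def)
    moreover have "\<bar>len g - len h\<bar> \<le> 1" if "g \<in> A" "h \<in> A" for g h
      using subsetD[OF A(1) that(1)] subsetD[OF A(1) that(2)] by (auto simp: X_def)
    ultimately show ?thesis using A(2) finA by blast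
  qed
  then obtain A where A: "finite A" "A \<subseteq> Collect long"
    and A_len: "\<forall>g\<in>A. \<forall>h\<in>A. \<bar>len g - len h\<bar> \<le> 1"
    and A_sep: "\<forall>g\<in>A. \<forall>h\<in>A. g \<noteq> h \<longrightarrow> r < len (inv g \<otimes> h)"
    and A_sum: "0 < \<sigma> \<longrightarrow> 1 \<le> (\<Sum>g\<in>A. exp (- \<sigma> * len (gen (0, g))))"
    by (elim exE conjE)
  have cnt: "countable (Collect long)"
    by (rule countable_subset[OF _ countable_carrier]) (auto simp: long_def)
  define \<iota> where "\<iota> = to_nat_on (Collect long)"
  have iota: "inj_on \<iota> (Collect long)" unfolding \<iota>_def using cnt by (rule inj_on_to_nat_on)
  \<comment> \<open>\<open>Suc\<close> reserves the index 0 for \<open>A\<close>; an element of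
    \<open>A\<close> occurs once more under a positive index and then yields a different
    generator.\<close>
  define J where "J = (\<lambda>g. (0, g)) ` A \<union> (\<lambda>g. (Suc (\<iota> g), g)) ` Collect long"
  interpret schottky_code G len \<delta> v1 v2 c0 J
  proof unfold_locales
    show "long (snd j)" if "j \<in> J" for j using that A by (auto simp: J_def)
    show "J \<noteq> {}" using v_long' by (auto simp: J_def long_def)
    show "\<bar>len g - len g'\<bar> \<le> 1 \<and> 1 + 2 * c + 4 * \<delta> < len (inv g \<otimes> g')"
      if "(i, g) \<in> J" "(i, g') \<in> J" "g \<noteq> g'" for i g g'
      using that A_len A_sep inj_onD[OF iota] unfolding r_def[symmetric] J_def by auto
    have "{j \<in> J. fst j = 0} = (\<lambda>g. (0, g)) ` A" by (auto simp: J_def)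
    then show "finite {j \<in> J. fst j = 0}" using A by simp
    show "inj_on fst {j \<in> J. fst j \<noteq> 0}"
      using inj_onD[OF iota] by (auto simp: inj_on_def J_def)
  qed
  let ?S = "gen ` J"
  have "\<not> series_le (word_prod ` (lists ?S - {[]})) \<sigma> B" if "0 < \<sigma>" for B
  proof
    assume B: "series_le (word_prod ` (lists ?S - {[]})) \<sigma> B"
    define S0 where "S0 = (\<lambda>g. gen (0, g)) ` A"
    have sub: "S0 \<subseteq> ?S" by (auto simp: S0_def J_def)
    then have lsub: "lists S0 \<subseteq> lists ?S" by (rule lists_mono)
    have inj: "inj_on (\<lambda>g. gen (0, g)) A"
      using gen_inj by (auto simp: inj_on_def J_def)
    have "1 \<le> (\<Sum>g\<in>S0. exp (- \<sigma> * len g))"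
      using A_sum that unfolding S0_def by (subst sum.reindex[OF inj]) (simp add: comp_def)
    then have "\<not> series_le (word_prod ` (lists S0 - {[]})) \<sigma> B"
      using A sub gen_cl inj_on_subset[OF word_prod_inj lsub] that
      by (intro free_series_unbounded) (auto simp: S0_def)
    moreover have "word_prod ` (lists S0 - {[]}) \<subseteq> word_prod ` (lists ?S - {[]})"
      using lsub by blast
    ultimately show False using series_le_mono[OF B] by blast
  qed
  moreover have "\<forall>g\<in>carrier G. len g \<le> L + 4 * (c + 2 * \<delta>) \<or> (\<exists>h\<in>carrier G. \<exists>b\<in>carrier G.
      h \<otimes> (g \<otimes> b) \<in> word_prod ` (lists ?S - {[]}) \<and>
      len h + len g + len b - (L + 4 * (c + 2 * \<delta>)) \<le> len (h \<otimes> (g \<otimes> b)))"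
  proof
    fix g assume g: "g \<in> carrier G"
    have nn: "0 \<le> L" "0 \<le> 4 * (c + 2 * \<delta>)" using c_nonneg delta_nonneg by (simp_all add: L_def)
    show "len g \<le> L + 4 * (c + 2 * \<delta>) \<or> (\<exists>h\<in>carrier G. \<exists>b\<in>carrier G.
      h \<otimes> (g \<otimes> b) \<in> word_prod ` (lists ?S - {[]}) \<and>
      len h + len g + len b - (L + 4 * (c + 2 * \<delta>)) \<le> len (h \<otimes> (g \<otimes> b)))"
    proof (cases "len g \<le> L")
      case True
      then show ?thesis using nn by simp
    next
      case False
      then have g_long: "long g" using g by (simp add: long_def L_def)
      define j where "j = (Suc (\<iota> g), g)"
      have j: "j \<in> J" "snd j = g" using g_long by (auto simp: J_def j_def)
      obtain h b where hb: "h \<in> carrier G" "b \<in> carrier G" "gen j = h \<otimes> (g \<otimes> b)"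
        "len h + len g + len b - 4 * (c + 2 * \<delta>) \<le> len (gen j)"
        using gen_myrberg[of j] g_long j by auto
      have "gen j \<in> word_prod ` (lists ?S - {[]})"
        using gen_cl[OF j(1)] j(1) by (intro image_eqI[of _ _ "[gen j]"]) auto
      then show ?thesis using hb nn by (intro disjI2 bexI[of _ h] bexI[of _ b]) auto
    qed
  qed
  ultimately show ?thesis
    using quasi_free word_prod_inj by (intro exI[of _ ?S] exI[of _ "2 * (c + 2 * \<delta>)"]) blast
qed

end

section \<open>Isometric actions on hyperbolic space\<close>

definition orbit_len :: "('g \<Rightarrow> real ^ 'n \<Rightarrow> real ^ 'n) \<Rightarrow> real ^ 'n \<Rightarrow> 'g \<Rightarrow> real" where
  "orbit_len \<phi> x0 g = hyp_dist x0 (\<phi> g x0)"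

locale hyperbolic_action =
  fixes \<Gamma> :: "('g, 'b) monoid_scheme" (structure)
    and \<phi> :: "'g \<Rightarrow> real ^ 'n \<Rightarrow> real ^ 'n" and x0 :: "real ^ 'n"
  assumes isom: "acts_by_isometries \<Gamma> \<phi>" and proper: "acts_properly \<Gamma> \<phi>"
    and x0 [simp]: "x0 \<in> hyp_space"
begin

lemma action: "group_action \<Gamma> hyp_space \<phi>"
  using isom by (simp add: acts_by_isometries_def)

sublocale act: group_action \<Gamma> hyp_space \<phi> by (rule action)

sublocale grp: group \<Gamma>
  using act.group_hom by (simp add: group_hom_def)

lemma act_closed [simp]: "g \<in> carrier \<Gamma> \<Longrightarrow> x \<in> hyp_space \<Longrightarrow> \<phi> g x \<in> hyp_space"
  using act.element_image by blast

lemma act_one [simp]: "x \<in> hyp_space \<Longrightarrow> \<phi> \<one> x = x"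
  using act.id_eq_one by (metis restrict_apply')

lemma act_isom: "g \<in> carrier \<Gamma> \<Longrightarrow> x \<in> hyp_space \<Longrightarrow> y \<in> hyp_space \<Longrightarrow>
    hyp_dist (\<phi> g x) (\<phi> g y) = hyp_dist x y"
  using isom by (simp add: acts_by_isometries_def)

abbreviation "ol \<equiv> orbit_len \<phi> x0"

lemma ol_inv_mult:
  assumes "g \<in> carrier \<Gamma>" "h \<in> carrier \<Gamma>"
  shows "ol (inv g \<otimes> h) = hyp_dist (\<phi> g x0) (\<phi> h x0)"
proof -
  have "\<phi> g (\<phi> (inv g \<otimes> h) x0) = \<phi> (g \<otimes> (inv g \<otimes> h)) x0"
    using assms by (simp add: act.composition_rule)
  also have "g \<otimes> (inv g \<otimes> h) = h" using assms by (simp add: grp.m_assoc[symmetric])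
  finally show ?thesis
    using act_isom[of g x0 "\<phi> (inv g \<otimes> h) x0"] assms by (simp add: orbit_len_def)
qed

lemma finite_ol_le: "finite {g \<in> carrier \<Gamma>. ol g \<le> R}"
proof -
  obtain C where C: "compact C" "C \<subseteq> hyp_space" "{z \<in> hyp_space. hyp_dist x0 z \<le> max R 0} \<subseteq> C"
    using hyp_ball_subset_compact[OF x0] by blast
  have "finite {g \<in> carrier \<Gamma>. \<phi> g ` C \<inter> C \<noteq> {}}"
    using proper C unfolding acts_properly_def by blast
  moreover have "{g \<in> carrier \<Gamma>. ol g \<le> R} \<subseteq> {g \<in> carrier \<Gamma>. \<phi> g ` C \<inter> C \<noteq> {}}"
  proof safe
    fix g assume g: "g \<in> carrier \<Gamma>" "ol g \<le> R" "\<phi> g ` C \<inter> C = {}"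
    have "x0 \<in> C" "\<phi> g x0 \<in> C" using C(3) g x0 by (auto simp: orbit_len_def)
    then show "False" using g(3) by blast
  qed
  ultimately show ?thesis by (rule finite_subset[rotated])
qed

sublocale hyperbolic_length \<Gamma> ol "ln 8"
proof unfold_locales
  show "ol \<one> = 0" by (simp add: orbit_len_def)
  show "ol (inv g) = ol g" if "g \<in> carrier \<Gamma>" for g
    using ol_inv_mult[of g \<one>] that hyp_dist_commute[of x0 "\<phi> g x0"] by (simp add: orbit_len_def)
  show "ol (g \<otimes> h) \<le> ol g + ol h" if "g \<in> carrier \<Gamma>" "h \<in> carrier \<Gamma>" for g h
    using hyp_dist_triangle[of x0 "\<phi> g x0" "\<phi> g (\<phi> h x0)"] that act_isom[of g x0 "\<phi> h x0"]
    by (simp add: orbit_len_def act.composition_rule)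
  show "ol (inv x \<otimes> z) + ol y \<le> max (ol (inv x \<otimes> y) + ol z) (ol (inv y \<otimes> z) + ol x) + 2 * ln 8"
    if "x \<in> carrier \<Gamma>" "y \<in> carrier \<Gamma>" "z \<in> carrier \<Gamma>" for x y z
    using hyp_dist_four_point[of "\<phi> x x0" "\<phi> z x0" x0 "\<phi> y x0"] that
    unfolding ol_inv_mult[OF that(1,3)] ol_inv_mult[OF that(1,2)] ol_inv_mult[OF that(2,3)]
    by (simp add: orbit_len_def hyp_dist_commute[of _ x0] hyp_dist_commute[of "\<phi> z x0" "\<phi> y x0"]
        max.commute add.commute)
  show "finite {g \<in> carrier \<Gamma>. ol g \<le> R}" for R by (rule finite_ol_le)
qed

section \<open>Exponents of convergence and orbit growth\<close>

lemma poincare_series_finite_iff: "poincare_series \<phi> x0 A s < \<infinity> \<longleftrightarrow> (\<exists>B. series_le A s B)"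
proof -
  have eq: "poincare_series \<phi> x0 A s = (SUP T\<in>{T. finite T \<and> T \<subseteq> A}. ennreal (\<Sum>g\<in>T. exp (- s * ol g)))"
    unfolding poincare_series_def orbit_len_def
    by (subst nonneg_infsum_complete) (auto intro!: SUP_cong simp: sum_ennreal)
  show ?thesis
  proof
    assume "poincare_series \<phi> x0 A s < \<infinity>"
    then obtain B where B: "0 \<le> B" "poincare_series \<phi> x0 A s = ennreal B"
      by (cases "poincare_series \<phi> x0 A s") auto
    have "series_le A s B"
    proof (rule series_leI)
      fix T assume "finite T" "T \<subseteq> A"
      then have "ennreal (\<Sum>g\<in>T. exp (- s * ol g)) \<le> ennreal B"
        unfolding B(2)[symmetric] eq by (intro SUP_upper) auto
      then show "(\<Sum>g\<in>T. exp (- s * ol g)) \<le> B" using B(1) by simp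
    qed
    then show "\<exists>B. series_le A s B" ..
  next
    assume "\<exists>B. series_le A s B"
    then obtain B where "series_le A s B" ..
    then have "poincare_series \<phi> x0 A s \<le> ennreal B"
      unfolding eq by (intro SUP_least) (auto intro!: ennreal_leI dest: series_leD)
    then show "poincare_series \<phi> x0 A s < \<infinity>" by (simp add: order_le_less_trans)
  qed
qed

definition conv_set where "conv_set A = {s. 0 \<le> s \<and> (\<exists>B. series_le A s B)}"

lemma critical_exponent_eq:
  assumes "conv_set A \<noteq> {}"
  shows "critical_exponent \<phi> x0 A = ereal (Inf (conv_set A))"
proof -
  have "critical_exponent \<phi> x0 A = Inf (ereal ` conv_set A)"
    by (simp add: critical_exponent_def poincare_series_finite_iff[simplified] conv_set_def)
  also have "\<dots> = ereal (Inf (conv_set A))"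
    using assms by (intro ereal_Inf'[symmetric]) (auto simp: conv_set_def bdd_below_def)
  finally show ?thesis .
qed

lemma conv_set_bdd: "bdd_below (conv_set A)"
  by (auto simp: conv_set_def bdd_below_def)

text \<open>Growth at most exponential with rate \<open>N\<close> gives convergence at
  \<open>N + 1\<close>. Different group elements may give equal or close orbit points; translating
  by \<open>inv g\<close> bounds their number by that of the elements of length at most 2.\<close>

lemma conv_set_carrier_nonempty: "conv_set (carrier \<Gamma>) \<noteq> {}"
proof -
  define N where "N = real CARD('n)"
  define M where "M = card {g \<in> carrier \<Gamma>. ol g \<le> 2}"
  define d where "d = hyp_dist 0 x0"
  have 0: "0 \<in> hyp_space" by (simp add: hyp_space_iff)
  have d0: "0 \<le> d" using hyp_dist_nonneg[OF 0 x0] by (simp add: d_def)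
  define Q where "Q = real M * (2 * N + 3) ^ CARD('n) * exp (N * (d + 1))"
  have "real (card {g \<in> carrier \<Gamma>. real n \<le> ol g \<and> ol g < real n + 1}) \<le> Q * exp (N * real n)" for n
  proof -
    define A where "A = {g \<in> carrier \<Gamma>. real n \<le> ol g \<and> ol g < real n + 1}"
    have A: "finite A" "A \<subseteq> carrier \<Gamma>"
      by (rule finite_subset[OF _ finite_ol_le[of "real n + 1"]]) (auto simp: A_def)
    have "card {h \<in> A. hyp_dist (\<phi> g x0) (\<phi> h x0) \<le> 2} \<le> M" if "g \<in> A" for g
      unfolding M_def
    proof (rule card_inj_on_le[of "\<lambda>h. inv g \<otimes> h"])
      have g: "g \<in> carrier \<Gamma>" using that A by auto
      show "inj_on (\<lambda>h. inv g \<otimes> h) {h \<in> A. hyp_dist (\<phi> g x0) (\<phi> h x0) \<le> 2}"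
      proof (rule inj_onI)
        fix x y assume "x \<in> {h \<in> A. hyp_dist (\<phi> g x0) (\<phi> h x0) \<le> 2}"
          "y \<in> {h \<in> A. hyp_dist (\<phi> g x0) (\<phi> h x0) \<le> 2}" "inv g \<otimes> x = inv g \<otimes> y"
        then show "x = y" using mult_inv_cancel(1)[of g x] mult_inv_cancel(1)[of g y] A g by auto
      qed
      show "(\<lambda>h. inv g \<otimes> h) ` {h \<in> A. hyp_dist (\<phi> g x0) (\<phi> h x0) \<le> 2} \<subseteq> {g \<in> carrier \<Gamma>. ol g \<le> 2}"
        using A g by (auto simp: ol_inv_mult)
    qed (rule finite_ol_le)
    moreover have "\<phi> g x0 \<in> hyp_space \<and> hyp_dist 0 (\<phi> g x0) \<le> d + (real n + 1)" if "g \<in> A" for g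
      using that hyp_dist_triangle[OF 0 x0, of "\<phi> g x0"] by (auto simp: A_def orbit_len_def d_def)
    ultimately have "real (card A) \<le> real M * (2 * N + 3) ^ CARD('n) * exp (N * (d + (real n + 1)))"
      unfolding N_def using A d0 by (intro card_le_grid[of A "\<lambda>g. \<phi> g x0"]) auto
    also have "\<dots> = Q * exp (N * real n)"
      by (simp add: Q_def mult.assoc exp_add[symmetric] algebra_simps)
    finally show ?thesis by (simp add: A_def)
  qed
  then have "\<exists>B. series_le (carrier \<Gamma>) (N + 1) B"
    by (intro series_le_annuli[of _ 0 Q N]) (auto simp: Q_def N_def)
  then have "N + 1 \<in> conv_set (carrier \<Gamma>)" by (simp add: conv_set_def N_def)
  then show ?thesis by blast
qed

section \<open>Limit points as directions in the group\<close>

lemma limit_point_approx: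
  assumes "\<xi> \<in> limit_set \<Gamma> \<phi> x0" "0 < \<rho>"
  shows "\<exists>g\<in>carrier \<Gamma>. R \<le> ol g \<and> dist \<xi> (\<phi> g x0) < \<rho>"
proof (rule ccontr)
  assume *: "\<not> ?thesis"
  have "\<xi> islimpt ((\<lambda>g. \<phi> g x0) ` carrier \<Gamma>)" using assms(1) by (simp add: limit_set_def)
  then have "infinite ((\<lambda>g. \<phi> g x0) ` carrier \<Gamma> \<inter> ball \<xi> \<rho>)"
    using assms(2) islimpt_eq_infinite_ball by blast
  moreover have "(\<lambda>g. \<phi> g x0) ` carrier \<Gamma> \<inter> ball \<xi> \<rho> \<subseteq> (\<lambda>g. \<phi> g x0) ` {g \<in> carrier \<Gamma>. ol g \<le> R}"
    using * by (auto simp: not_le)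
  ultimately show False using finite_ol_le finite_subset by blast
qed

text \<open>Moving the base point from the origin to \<open>x0\<close> raises a Gromov product by at
  most \<open>hyp_dist 0 x0\<close>.\<close>

lemma gp_le_of_dist:
  assumes "g \<in> carrier \<Gamma>" "h \<in> carrier \<Gamma>" "0 < \<rho>" "\<rho> \<le> dist (\<phi> g x0) (\<phi> h x0)"
  shows "gp g h \<le> ln (2 / \<rho>) + hyp_dist 0 x0"
proof -
  have 0: "0 \<in> hyp_space" by (simp add: hyp_space_iff)
  have "ol u \<le> hyp_dist 0 x0 + hyp_dist 0 (\<phi> u x0)" if "u \<in> carrier \<Gamma>" for u
    using hyp_dist_triangle[OF x0 0, of "\<phi> u x0"] that hyp_dist_commute[of x0 0] by (simp add: orbit_len_def)
  from this[OF assms(1)] this[OF assms(2)]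
  have "ol g + ol h \<le> 2 * hyp_dist 0 x0 + hyp_dist 0 (\<phi> g x0) + hyp_dist 0 (\<phi> h x0)" by simp
  then show ?thesis
    using gromov_product_origin_le[of "\<phi> g x0" "\<phi> h x0" \<rho>] assms
    by (simp add: gp_def ol_inv_mult dist_norm field_simps)
qed

lemma non_elementary_length:
  assumes "non_elementary \<Gamma> \<phi> x0"
  shows "\<exists>C\<ge>0. non_elementary_length C"
proof -
  have "\<exists>T\<subseteq>limit_set \<Gamma> \<phi> x0. card T = 3"
    using assms unfolding non_elementary_def
    by (metis Suc_leI eval_nat_numeral(3) infinite_arbitrarily_large obtain_subset_with_card_n)
  then obtain \<xi> \<eta> \<zeta> where l: "\<xi> \<in> limit_set \<Gamma> \<phi> x0" "\<eta> \<in> limit_set \<Gamma> \<phi> x0" "\<zeta> \<in> limit_set \<Gamma> \<phi> x0"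
    and ne: "\<xi> \<noteq> \<eta>" "\<eta> \<noteq> \<zeta>" "\<xi> \<noteq> \<zeta>"
    by (auto simp: card_3_iff)
  \<comment> \<open>With a third of the least distance, orbit points within \<rho> of two of the
    limit points are still \<rho> apart.\<close>
  define \<rho> where "\<rho> = min (dist \<xi> \<eta>) (min (dist \<eta> \<zeta>) (dist \<xi> \<zeta>)) / 3"
  have rho: "0 < \<rho>" using ne by (simp add: \<rho>_def)
  have rho3: "3 * \<rho> \<le> dist \<xi> \<eta>" "3 * \<rho> \<le> dist \<eta> \<zeta>" "3 * \<rho> \<le> dist \<xi> \<zeta>"
    by (simp_all add: \<rho>_def)
  define C where "C = max 0 (ln (2 / \<rho>) + hyp_dist 0 x0)"
  have sep: "gp u v \<le> C" if "u \<in> carrier \<Gamma>" "v \<in> carrier \<Gamma>"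
    "dist a (\<phi> u x0) < \<rho>" "dist b (\<phi> v x0) < \<rho>" "3 * \<rho> \<le> dist a b" for u v a b
  proof -
    have "dist a b \<le> dist a (\<phi> u x0) + dist (\<phi> u x0) (\<phi> v x0) + dist b (\<phi> v x0)"
      using dist_triangle[of a b "\<phi> u x0"] dist_triangle[of "\<phi> u x0" b "\<phi> v x0"]
      by (simp add: dist_commute)
    then have "\<rho> \<le> dist (\<phi> u x0) (\<phi> v x0)" using that by linarith
    then show ?thesis using gp_le_of_dist[of u v \<rho>] that rho by (simp add: C_def)
  qed
  have "non_elementary_length C"
    unfolding non_elementary_length_def
  proof
    fix R
    obtain u where u: "u \<in> carrier \<Gamma>" "R \<le> ol u" "dist \<xi> (\<phi> u x0) < \<rho>"
      using limit_point_approx[OF l(1) rho] by blast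
    obtain v where v: "v \<in> carrier \<Gamma>" "R \<le> ol v" "dist \<eta> (\<phi> v x0) < \<rho>"
      using limit_point_approx[OF l(2) rho] by blast
    obtain w where w: "w \<in> carrier \<Gamma>" "R \<le> ol w" "dist \<zeta> (\<phi> w x0) < \<rho>"
      using limit_point_approx[OF l(3) rho] by blast
    have "gp u v \<le> C" "gp v w \<le> C" "gp u w \<le> C"
      using sep u v w rho3 by blast+
    then show "\<exists>u\<in>carrier \<Gamma>. \<exists>v\<in>carrier \<Gamma>. \<exists>w\<in>carrier \<Gamma>.
       R \<le> ol u \<and> R \<le> ol v \<and> R \<le> ol w \<and> gp u v \<le> C \<and> gp v w \<le> C \<and> gp u w \<le> C"
      using u v w by blast
  qed
  then show ?thesis by (intro exI[of _ C]) (simp add: C_def)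
qed

section \<open>Geodesic form of the Myrberg property\<close>

lemma translate_near_segment:
  assumes g: "g \<in> carrier \<Gamma>" and h: "h \<in> carrier \<Gamma>" and b: "b \<in> carrier \<Gamma>"
    and len: "ol h + ol g + ol b - K \<le> ol (h \<otimes> (g \<otimes> b))"
  shows "\<phi> h ` geodesic_segment x0 (\<phi> g x0)
    \<subseteq> hyp_neighborhood (K + 2 * ln 8 + 1) (geodesic_segment x0 (\<phi> (h \<otimes> (g \<otimes> b)) x0))"
proof
  fix q assume "q \<in> \<phi> h ` geodesic_segment x0 (\<phi> g x0)"
  then obtain p where p: "p \<in> geodesic_segment x0 (\<phi> g x0)" "q = \<phi> h p" by blast
  define f where "f = h \<otimes> (g \<otimes> b)"
  have f: "f \<in> carrier \<Gamma>" "\<phi> f x0 = \<phi> h (\<phi> g (\<phi> b x0))"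
    using g h b by (simp_all add: f_def act.composition_rule)
  have pb: "p \<in> hyp_space" "hyp_dist x0 p + hyp_dist p (\<phi> g x0) = ol g"
    using geodesic_segment_between[OF p(1)] g by (simp_all add: orbit_len_def)
  have q: "q \<in> hyp_space" using p pb h by simp
  have "hyp_dist x0 q \<le> ol h + hyp_dist x0 p"
    using hyp_dist_triangle[of x0 "\<phi> h x0" q] act_isom[of h x0 p] p pb h by (simp add: orbit_len_def)
  moreover have "hyp_dist q (\<phi> f x0) \<le> hyp_dist p (\<phi> g x0) + ol b"
    using hyp_dist_triangle[of p "\<phi> g x0" "\<phi> g (\<phi> b x0)"] act_isom[of h p "\<phi> g (\<phi> b x0)"]
      act_isom[of g x0 "\<phi> b x0"] p pb g h b f by (simp add: orbit_len_def)
  \<comment> \<open>The path from \<open>x0\<close> through \<open>\<phi> h x0\<close>,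
    \<open>q\<close> and \<open>\<phi> h (\<phi> g x0)\<close> to \<open>\<phi> f x0\<close> exceeds
    the distance of its ends by at most \<open>K\<close>, so \<open>q\<close> nearly realizes that
    distance.\<close>
  ultimately have near: "hyp_dist x0 q + hyp_dist q (\<phi> f x0) \<le> hyp_dist x0 (\<phi> f x0) + K"
    using pb(2) len by (simp add: f_def[symmetric] orbit_len_def)
  obtain w where "w \<in> geodesic_segment x0 (\<phi> f x0)" "hyp_dist q w \<le> K + 2 * ln 8"
    using geodesic_segment_near[OF x0 act_closed[OF f(1) x0] q near] by blast
  then show "q \<in> hyp_neighborhood (K + 2 * ln 8 + 1) (geodesic_segment x0 (\<phi> (h \<otimes> (g \<otimes> b)) x0))"
    using q unfolding hyp_neighborhood_def f_def by (auto intro!: bexI[of _ w])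
qed

lemma start_in_segment:
  assumes "y \<in> hyp_space" shows "x0 \<in> geodesic_segment x0 y"
proof -
  obtain c where c: "geodesic_from_to c x0 y" using geodesic_exists[OF x0 assms] by blast
  then have "c 0 = x0" by (simp add: geodesic_from_to_def)
  moreover have "c 0 \<in> c ` {0..hyp_dist x0 y}" using hyp_dist_nonneg[OF x0 assms] by auto
  ultimately show ?thesis using c unfolding geodesic_segment_def by blast
qed

text \<open>The segment of a short \<open>g\<close> stays within \<open>K\<close> of
  \<open>x0\<close>, which is an end of the segment to any \<open>\<phi> f x0\<close>; so the
  trivial translate serves.\<close>

lemma short_segment_near:
  assumes "g \<in> carrier \<Gamma>" "f \<in> carrier \<Gamma>" "ol g < K"
  shows "\<phi> \<one> ` geodesic_segment x0 (\<phi> g x0) \<subseteq> hyp_neighborhood K (geodesic_segment x0 (\<phi> f x0))"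
proof
  fix q assume "q \<in> \<phi> \<one> ` geodesic_segment x0 (\<phi> g x0)"
  then obtain p where p: "p \<in> geodesic_segment x0 (\<phi> g x0)" "q = \<phi> \<one> p" by blast
  have pb: "p \<in> hyp_space" "hyp_dist x0 p + hyp_dist p (\<phi> g x0) = ol g"
    using geodesic_segment_between[OF p(1)] assms by (simp_all add: orbit_len_def)
  then have "hyp_dist p x0 < K"
    using hyp_dist_nonneg[of p "\<phi> g x0"] assms hyp_dist_commute[of p x0] by simp
  then show "q \<in> hyp_neighborhood K (geodesic_segment x0 (\<phi> f x0))"
    using p pb start_in_segment[of "\<phi> f x0"] assms unfolding hyp_neighborhood_def by auto
qed

end

theorem theorem1:
  fixes \<Gamma> :: "('g, 'b) monoid_scheme"
    and \<phi> :: "'g \<Rightarrow> real ^ 'n \<Rightarrow> real ^ 'n"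
    and x0 :: "real ^ 'n"
    and \<epsilon> :: real
  assumes "acts_by_isometries \<Gamma> \<phi>"
    and "acts_properly \<Gamma> \<phi>"
    and "x0 \<in> hyp_space"
    and "non_elementary \<Gamma> \<phi> x0"
    and "\<epsilon> > 0"
  shows "\<exists>K F. K > 0 \<and> F \<subseteq> carrier \<Gamma> \<and> free_subsemigroup \<Gamma> F \<and>
    (\<exists>s. critical_exponent \<phi> x0 F = ereal s \<and> poincare_series \<phi> x0 F s = \<infinity>) \<and>
    critical_exponent \<phi> x0 F \<ge> critical_exponent \<phi> x0 (carrier \<Gamma>) - ereal \<epsilon> \<and>
    (\<forall>g\<in>carrier \<Gamma>. \<exists>f\<in>F. \<exists>h\<in>carrier \<Gamma>.
       \<phi> h ` geodesic_segment x0 (\<phi> g x0)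
         \<subseteq> hyp_neighborhood K (geodesic_segment x0 (\<phi> f x0)))"
proof -
  interpret hyperbolic_action \<Gamma> \<phi> x0
    using assms(1-3) by unfold_locales
  obtain C where C: "0 \<le> C" "non_elementary_length C"
    using non_elementary_length[OF assms(4)] by blast
  define t where "t = Inf (conv_set (carrier \<Gamma>))"
  have big: "\<not> series_le (carrier \<Gamma>) s B" if "0 \<le> s" "s < t - \<epsilon> + \<epsilon>" for s B
  proof
    assume "series_le (carrier \<Gamma>) s B"
    then have "s \<in> conv_set (carrier \<Gamma>)" using that by (auto simp: conv_set_def)
    then have "t \<le> s" unfolding t_def by (intro cInf_lower conv_set_bdd)
    then show False using that by simp
  qed
  obtain S d K0 where S: "quasi_free_semigroup \<Gamma> ol (ln 8) S d" "inj_on word_prod (lists S)"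
    and div: "\<And>B. 0 < t - \<epsilon> \<Longrightarrow> \<not> series_le (word_prod ` (lists S - {[]})) (t - \<epsilon>) B"
    and K0: "\<And>g. g \<in> carrier \<Gamma> \<Longrightarrow> ol g \<le> K0 \<or> (\<exists>h\<in>carrier \<Gamma>. \<exists>b\<in>carrier \<Gamma>.
      mult \<Gamma> h (mult \<Gamma> g b) \<in> word_prod ` (lists S - {[]}) \<and>
      ol h + ol g + ol b - K0 \<le> ol (mult \<Gamma> h (mult \<Gamma> g b)))"
    using free_semigroup_exists[OF C(2,1) assms(5), of "t - \<epsilon>"] big by blast
  interpret quasi_free_semigroup \<Gamma> ol "ln 8" S d by (rule S(1))
  have F: "word_prod ` (lists S - {[]}) = F" by (simp add: F_def)
  have free: "free_subsemigroup \<Gamma> F"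
    unfolding free_subsemigroup_def bij_betw_def
    using S_closed inj_on_subset[OF S(2)] F by (intro exI[of _ S]) auto
  have sub: "conv_set (carrier \<Gamma>) \<subseteq> conv_set F"
    using series_le_mono[OF _ F_closed order_refl] unfolding conv_set_def by blast
  then have ne: "conv_set F \<noteq> {}" using conv_set_carrier_nonempty by blast
  define s where "s = Inf (conv_set F)"
  have s0: "0 \<le> s" unfolding s_def using ne by (intro cInf_greatest) (auto simp: conv_set_def)
  have crit: "critical_exponent \<phi> x0 F = ereal s"
    unfolding s_def by (rule critical_exponent_eq[OF ne])
  have "poincare_series \<phi> x0 F s = \<infinity>"
  proof (rule ccontr)
    assume "poincare_series \<phi> x0 F s \<noteq> \<infinity>"
    then have "poincare_series \<phi> x0 F s < \<infinity>" by (simp add: less_top)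
    then obtain B where "series_le F s B" using poincare_series_finite_iff by blast
    \<comment> \<open>Convergence at the infimum would produce a smaller exponent of
      convergence.\<close>
    then obtain s' B' where "0 \<le> s'" "s' < s" "series_le F s' B'"
      using F_series_open[OF _ s0] by blast
    then have "s' \<in> conv_set F" by (auto simp: conv_set_def)
    then have "s \<le> s'" unfolding s_def by (intro cInf_lower conv_set_bdd)
    then show False using \<open>s' < s\<close> by simp
  qed
  moreover have "t - \<epsilon> \<le> s"
  proof (cases "0 < t - \<epsilon>")
    case True
    show ?thesis unfolding s_def
    proof (rule cInf_greatest[OF ne])
      fix r assume "r \<in> conv_set F"
      then obtain B where B: "0 \<le> r" "series_le F r B" by (auto simp: conv_set_def)
      show "t - \<epsilon> \<le> r"
      proof (rule ccontr)
        assume "\<not> t - \<epsilon> \<le> r"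
        then have "series_le F (t - \<epsilon>) B" using series_le_exponent_mono[OF F_closed B(2)] by simp
        then show False using div[OF True] F by simp
      qed
    qed
  qed (use s0 in linarith)
  then have "critical_exponent \<phi> x0 F \<ge> critical_exponent \<phi> x0 (carrier \<Gamma>) - ereal \<epsilon>"
    unfolding crit critical_exponent_eq[OF conv_set_carrier_nonempty] t_def by simp
  \<comment> \<open>\<open>2 * ln 8\<close> is the cost of comparison with a geodesic, 1 makes the
    inequality strict, and the absolute value guards against a negative \<open>K0\<close>.\<close>
  moreover define K where "K = \<bar>K0\<bar> + 2 * ln 8 + 1"
  have ln8: "0 \<le> ln (8::real)" by simp
  have "\<exists>f\<in>F. \<exists>h\<in>carrier \<Gamma>. \<phi> h ` geodesic_segment x0 (\<phi> g x0)
         \<subseteq> hyp_neighborhood K (geodesic_segment x0 (\<phi> f x0))" if g: "g \<in> carrier \<Gamma>" for g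
    using K0[OF g]
  proof (elim disjE bexE conjE)
    assume "ol g \<le> K0"
    then have lt: "ol g < K" unfolding K_def using ln8 by linarith
    obtain f where f: "f \<in> F" using F_infinite by (metis ex_in_conv finite.emptyI)
    then have "f \<in> carrier \<Gamma>" using F_closed by blast
    then show ?thesis using short_segment_near[OF g _ lt] f grp.one_closed by blast
  next
    fix h b assume h: "h \<in> carrier \<Gamma>" "b \<in> carrier \<Gamma>"
      and m: "mult \<Gamma> h (mult \<Gamma> g b) \<in> word_prod ` (lists S - {[]})"
      and "ol h + ol g + ol b - K0 \<le> ol (mult \<Gamma> h (mult \<Gamma> g b))"
    then have "ol h + ol g + ol b - \<bar>K0\<bar> \<le> ol (mult \<Gamma> h (mult \<Gamma> g b))" by simp
    then show ?thesis
      using translate_near_segment[OF g h] m h(1) unfolding F K_def by blast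
  qed
  moreover have "K > 0" unfolding K_def using ln8 by linarith
  ultimately show ?thesis using crit free F_closed by blast
qed

end
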